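(* Let $n\ge 2$, let $D$ be an open $SL(n,\mathbb{R})$-orbit in the manifold $Z$ of complete flags in $\mathbb{C}^n$, and let $C_0\subset D$ be its base cycle. Let $\mathcal{S}_{C_0}$ be the set of Schubert varieties $S_w$ ($w\in\Sigma_n$) with $\dim S_w+\dim C_0=\dim Z$ and $S_w\cap C_0\neq\emptyset$. Then $S_w\in\mathcal{S}_{C_0}$ if and only if $w$ satisfies the double box contraction condition. In particular, in this case $w$ satisfies the spacing condition, and $|w|=m^2$ if $n=2m$, while $|w|=m^2+m$ if $n=2m+1$.
   Context: Let $G=SL(n,\mathbb{C})$, $G_0=SL(n,\mathbb{R})$, $K_0=SO(n,\mathbb{R})$, $B\subset G$ the upper triangular Borel subgroup, $m=\lfloor n/2\rfloor$. $Z=G/B$ is the manifold of complete flags in $\mathbb{C}^n$. $G_0$ has one open orbit in $Z$ if $n$ is odd and two if $n$ is even. The base cycle $C_0$ of an open $G_0$-orbit $D$ is the unique $K_0$-orbit in $D$ which is a complex submanifold; equivalently it is the set of flags in $D$ that are isotropic for $b(v,w)=v^tw$, i.e. $\dim (V_i\cap V_j^\perp)=\min\{i,n-j\}$ for all $i,j$. For $w\in\Sigma_n$ written in one-line notation $w(1)w(2)\dots w(n)$, let $V_w$ be the complete flag whose $k$-th subspace is $\langle e_{w(1)},\dots,e_{w(k)}\rangle$; the Schubert cell is $\mathcal{O}_w=B.V_w$ and the Schubert variety $S_w$ is its closure. $|w|=\dim S_w$ is the number of inversions of $w$. Write $w=k_1\dots k_m l_* l_m\dots l_1$, where $l_*$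 is omitted if $n=2m$. Spacing condition: $l_i<k_i$ for all $1\le i\le m$. Double box contraction condition: $w$ is constructed by the following algorithm. Choose $k_1$ and $l_1=k_1-1$ in $\{1,\dots,n\}$. Once $k_1,l_1,\dots,k_i,l_i$ are chosen, choose $k_{i+1},l_{i+1}$ in the ordered set $\{1,\dots,n\}\setminus\{k_1,l_1,\dots,k_i,l_i\}$ such that $l_{i+1}$ is the immediate predecessor of $k_{i+1}$ in this ordered set. (If $n$ is odd, $l_*$ is the remaining element after $m$ steps.) *)

theory Defs
  imports "HOL-Analysis.Analysis"
begin

section \<open>Complete flags\<close>

text \<open>
  The dimension \<open>n\<close> is \<open>CARD('n)\<close>; the linear order on \<open>'n\<close> orders the standard basis.
  Subspaces and dimensions are complex: \<open>vec.subspace\<close>, \<open>vec.span\<close> and \<open>vec.dim\<close> refer to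
  multiplication by complex scalars.
\<close>

type_synonym 'n flag = "nat \<Rightarrow> (complex, 'n) vec set"

definition basis_vec :: "nat \<Rightarrow> complex ^ 'n::{finite,linorder}" where
  "basis_vec k = axis (sorted_list_of_set (UNIV :: 'n set) ! (k - 1)) 1"
  \<comment> \<open>\<open>basis_vec 1, \<dots>, basis_vec n\<close> is the ordered standard basis\<close>

text \<open>The members with index \<open>k \<ge> n\<close> are the whole space.\<close>

definition flags :: "'n::{finite,linorder} flag set" where
  "flags = {V. mono V \<and> (\<forall>k. vec.subspace (V k) \<and> vec.dim (V k) = min k CARD('n))}"

definition coordinate_flag :: "(nat \<Rightarrow> nat) \<Rightarrow> 'n::{finite,linorder} flag" where
  "coordinate_flag w = (\<lambda>k. vec.span ((\<lambda>i. basis_vec (w i)) ` {1..min k CARD('n)}))"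

section \<open>Groups and orbits\<close>

type_synonym 'n cmat = "((complex, 'n) vec, 'n) vec"

definition SL_C :: "'n::{finite,linorder} cmat set" where
  "SL_C = {g. det g = 1}"

definition SL_R :: "'n::{finite,linorder} cmat set" where
  "SL_R = {g \<in> SL_C. \<forall>i j. g $ i $ j \<in> \<real>}"

definition Borel :: "'n::{finite,linorder} cmat set" where
  "Borel = {g \<in> SL_C. \<forall>i j. j < i \<longrightarrow> g $ i $ j = 0}"

definition act :: "'n cmat \<Rightarrow> 'n::{finite,linorder} flag \<Rightarrow> 'n flag" where
  "act g V = (\<lambda>k. (\<lambda>v. g *v v) ` V k)"

definition orbit_of :: "'n cmat set \<Rightarrow> 'n::{finite,linorder} flag \<Rightarrow> 'n flag set" where
  "orbit_of H V = (\<lambda>g. act g V) ` H"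

section \<open>Topology and dimension\<close>

text \<open>
  The topology of \<open>G/B\<close>: the quotient topology for the orbit map of the standard flag,
  whose stabilizer in \<open>SL(n, C)\<close> is \<open>Borel\<close>.
\<close>

definition flag_topology :: "'n::{finite,linorder} flag topology" where
  "flag_topology = topology (\<lambda>U. U \<subseteq> flags \<and>
     openin (top_of_set SL_C) {g \<in> SL_C. act g (coordinate_flag id) \<in> U})"

lemma openin_flag_topology:
  "openin flag_topology U \<longleftrightarrow> U \<subseteq> flags \<and>
     openin (top_of_set SL_C) {g \<in> SL_C. act g (coordinate_flag id) \<in> U}"
proof -
  let ?P = "\<lambda>U :: 'a flag set. {g \<in> SL_C. act g (coordinate_flag id) \<in> U}"
  have "?P (S \<inter> T) = ?P S \<inter> ?P T" for S T
    by auto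
  moreover have "?P (\<Union>K) = \<Union>(?P ` K)" for K
    by auto
  ultimately have "istopology (\<lambda>U. U \<subseteq> flags \<and> openin (top_of_set SL_C) (?P U))"
    unfolding istopology_def by (auto simp only: intro!: openin_Int openin_Union)
  then show ?thesis
    by (simp add: flag_topology_def topology_inverse')
qed

text \<open>
  Complex dimension of a complex manifold or analytic set, read off from the underlying space:
  the largest \<open>d\<close> such that some nonempty open subset is homeomorphic to \<open>C^d = R^(2d)\<close>.
  For an analytic set this is the dimension of its regular locus: the regular points are dense,
  so by invariance of dimension no open subset can contribute any other \<open>d\<close> than the local
  dimensions at regular points.
\<close>

definition complex_dimension :: "'a topology \<Rightarrow> nat" where
  "complex_dimension T = (GREATEST d. \<exists>U. openin T U \<and> U \<noteq> {} \<and>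
     subtopology T U homeomorphic_space Euclidean_space (2 * d))"

definition flag_dim :: "'n::{finite,linorder} flag set \<Rightarrow> nat" where
  "flag_dim X = complex_dimension (subtopology flag_topology X)"

section \<open>Open orbits, base cycles and Schubert varieties\<close>

definition open_real_orbit :: "'n::{finite,linorder} flag set \<Rightarrow> bool" where
  "open_real_orbit D \<longleftrightarrow> (\<exists>V \<in> flags. D = orbit_of SL_R V) \<and> openin flag_topology D"

text \<open>\<open>b(v, w) = v\<^sup>t w\<close> is bilinear, not Hermitian.\<close>

definition bilin :: "complex ^ 'n \<Rightarrow> complex ^ 'n::finite \<Rightarrow> complex" where
  "bilin v w = (\<Sum>i\<in>UNIV. v $ i * w $ i)"

definition perp :: "(complex ^ 'n::finite) set \<Rightarrow> (complex ^ 'n) set" where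
  "perp S = {v. \<forall>w\<in>S. bilin v w = 0}"

definition isotropic_flag :: "'n::{finite,linorder} flag \<Rightarrow> bool" where
  "isotropic_flag V \<longleftrightarrow> (\<forall>i\<le>CARD('n). \<forall>j\<le>CARD('n).
     vec.dim (V i \<inter> perp (V j)) = min i (CARD('n) - j))"

text \<open>
  For an open orbit \<open>D\<close>, the unique orbit of \<open>SO(n, R)\<close> in \<open>D\<close> that is a complex submanifold
  consists of the isotropic flags in \<open>D\<close>.
\<close>

definition base_cycle :: "'n::{finite,linorder} flag set \<Rightarrow> 'n flag set" where
  "base_cycle D = {V \<in> D. isotropic_flag V}"

definition schubert_cell :: "(nat \<Rightarrow> nat) \<Rightarrow> 'n::{finite,linorder} flag set" where
  "schubert_cell w = orbit_of Borel (coordinate_flag w)"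

definition schubert_variety :: "(nat \<Rightarrow> nat) \<Rightarrow> 'n::{finite,linorder} flag set" where
  "schubert_variety w = flag_topology closure_of schubert_cell w"

definition dual_schubert_varieties ::
    "'n::{finite,linorder} flag set \<Rightarrow> 'n flag set set" where
  "dual_schubert_varieties C = {schubert_variety w | w. w permutes {1..CARD('n)} \<and>
     flag_dim (schubert_variety w :: 'n flag set) + flag_dim C = flag_dim (flags :: 'n flag set) \<and>
     schubert_variety w \<inter> C \<noteq> {}}"

section \<open>Combinatorics of permutations of \<open>{1..n}\<close>\<close>

definition inversions :: "nat \<Rightarrow> (nat \<Rightarrow> nat) \<Rightarrow> nat" where
  "inversions n w = card {(i, j). 1 \<le> i \<and> i < j \<and> j \<le> n \<and> w j < w i}"

text \<open>
  In \<open>w = k\<^sub>1 \<dots> k\<^sub>m l\<^sub>* l\<^sub>m \<dots> l\<^sub>1\<close> we have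
  \<open>k\<^sub>i = w i\<close> and \<open>l\<^sub>i = w (n + 1 - i)\<close> for \<open>1 \<le> i \<le> m = n div 2\<close>.
\<close>

definition spacing_condition :: "nat \<Rightarrow> (nat \<Rightarrow> nat) \<Rightarrow> bool" where
  "spacing_condition n w \<longleftrightarrow> (\<forall>i\<in>{1..n div 2}. w (n + 1 - i) < w i)"

definition immediate_predecessor :: "nat set \<Rightarrow> nat \<Rightarrow> nat \<Rightarrow> bool" where
  "immediate_predecessor R l k \<longleftrightarrow>
     l \<in> R \<and> k \<in> R \<and> l < k \<and> \<not> (\<exists>x\<in>R. l < x \<and> x < k)"

text \<open>
  The first step (\<open>l\<^sub>1 = k\<^sub>1 - 1\<close>) is the case \<open>i = 1\<close>, where nothing has been removed yet.
\<close>

definition double_box_contraction :: "nat \<Rightarrow> (nat \<Rightarrow> nat) \<Rightarrow> bool" where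
  "double_box_contraction n w \<longleftrightarrow> (\<forall>i\<in>{1..n div 2}.
     immediate_predecessor ({1..n} - (\<Union>j\<in>{1..<i}. {w j, w (n + 1 - j)})) (w (n + 1 - i)) (w i))"

end

theory Submission
  imports Defs "HOL-Homology.Invariance_of_Domain"
begin

text \<open>
  Write a flag as \<open>g\<close> applied to the standard flag, and compute dimensions in the charts
  \<open>X \<mapsto> g (1 + X)\<close>, \<open>X\<close> strictly lower triangular. Near a point of its open cell,
  \<open>S\<^sub>w\<close> is the coordinate subspace indexed by the inversions of \<open>w\<close>. Near an isotropic flag the
  isotropic flags are the \<open>u = 1 + X\<close> preserving the antidiagonal form, which the Cayley
  transform makes linear. The dimension condition becomes \<open>|w| = m (n - m)\<close>.

  If \<open>V \<in> S\<^sub>w\<close> is isotropic and \<open>E\<^sub>k\<close> is the standard flag, then \<open>V\<^sub>t \<inter> E\<^sub>k\<close> and the complex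
  conjugate of \<open>V\<^sub>n\<^sub>-\<^sub>t \<inter> E\<^sub>k\<close> are independent subspaces of \<open>E\<^sub>k\<close>. Semicontinuity turns this into a
  condition on \<open>w\<close> (the first \<open>t\<close> values dominate the last \<open>t\<close> values). It is weaker than the
  spacing condition, but if spacing fails, exchanging two positions preserves it and removes
  inversions. Under spacing, \<open>|w| - m (n - m)\<close> counts the values that lie between \<open>l\<^sub>i\<close> and \<open>k\<^sub>i\<close> in a
  position between theirs, and the double box contraction condition says that there are none.

  Conversely, under spacing the vectors \<open>e(k\<^sub>i) \<plusminus> \<i> e(l\<^sub>i)\<close> span isotropic flags in the cell of
  \<open>w\<close>; exchanging the signs of one pair reverses an orientation, so every open orbit
  contains one of them.
\<close>

section \<open>Inversions of permutations\<close>

text \<open>Two obstacles shape the proof. Dimension is defined by topology alone, so each value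
  needs a local homeomorphism with an open part of a real vector space, and invariance of domain to
  exclude every other value. Charts around a dense set of points suffice for this. Open orbits are
  given without any description of their flags. The link is transversality of a flag to its complex
  conjugate (\<open>generic_flag\<close>). It follows from the nonvanishing of finitely many
  determinants, so every open orbit contains such a flag. A transversal flag has a basis that
  conjugation merely reverses, two such bases differ by a real matrix, and only the sign of the
  determinant of that matrix can keep two flags in different orbits. The constant
  \<open>m (n - m)\<close> arises twice: as the number of matrix positions below the diagonal that
  lie on or below the antidiagonal, which is the codimension of the base cycle, and as the sum of
  the distances \<open>n + 1 - 2 p\<close> between the positions of \<open>k\<^sub>p\<close> and
  \<open>l\<^sub>p\<close>.\<close>

lemma inversions_swap_less:
  assumes "1 \<le> p" "p < q" "q \<le> n" "w q < w p"
  shows "inversions n (w \<circ> Transposition.transpose p q) < inversions n w"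
proof -
  let ?w = "w \<circ> Transposition.transpose p q" and ?t = "Transposition.transpose p q"
  let ?I = "\<lambda>w::nat \<Rightarrow> nat. {(i, j). 1 \<le> i \<and> i < j \<and> j \<le> n \<and> w j < w i}"
  \<comment> \<open>The swap \<open>?t\<close> carries an inversion of \<open>?w\<close> to one of
    \<open>w\<close> whenever it keeps the order of the two positions. Otherwise one position is
    \<open>p\<close> or \<open>q\<close> and the other lies between them, and
    \<open>w q < w p\<close> makes the unmoved pair an inversion of \<open>w\<close>. The pair
    \<open>(p, q)\<close> is never hit.\<close>
  define f where "f = (\<lambda>(a, b). if ?t a < ?t b then (?t a, ?t b) else (a, b))"
  have fin: "finite (?I w)"
    by (rule finite_subset[of _ "{1..n} \<times> {1..n}"]) auto
  have f: "f z \<in> ?I w - {(p, q)}" if zI: "z \<in> ?I ?w" for z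
  proof -
    obtain a b where z: "z = (a, b)" "1 \<le> a" "a < b" "b \<le> n" "w (?t b) < w (?t a)"
      using zI by (cases z) simp
    consider "a \<noteq> p" "a \<noteq> q" "b \<noteq> p" "b \<noteq> q" | "a = p" "b = q" | "a = p" "b \<noteq> q" | "a = q" | "b = p" | "b = q" "a \<noteq> p"
      by blast
    then show ?thesis
      by cases (use z assms in \<open>simp_all add: f_def Transposition.transpose_def split: if_splits\<close>)
  qed
  then have "f ` ?I ?w \<subseteq> ?I w - {(p, q)}"
    by (rule image_subsetI)
  then have "card (f ` ?I ?w) \<le> card (?I w - {(p, q)})"
    using fin by (intro card_mono) auto
  moreover have "inj_on f (?I ?w)"
  proof (rule inj_onI)
    fix y z assume yz: "y \<in> ?I ?w" "z \<in> ?I ?w" "f y = f z"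
    obtain a b c d where "y = (a, b)" "z = (c, d)" "a < b" "c < d"
      using yz(1,2) by (cases y, cases z) simp
    with yz(3) show "y = z"
      by (auto simp: f_def split: if_splits dest: transpose_eq_imp_eq)
  qed
  ultimately have "card (?I ?w) \<le> card (?I w - {(p, q)})"
    by (simp only: card_image)
  also have "\<dots> < card (?I w)"
    using assms fin by (intro card_Diff1_less) auto
  finally show ?thesis
    by (simp add: inversions_def)
qed

text \<open>As \<open>w q < w p\<close>, every position strictly between forms an inversion with
  \<open>p\<close> or with \<open>q\<close>, and with both exactly when its value lies between
  theirs. Together with the pair \<open>(p, q)\<close> this gives \<open>(q - p - 1) + 1\<close>
  plus the number of doubly counted positions.\<close>

lemma card_inversions_peel:
  fixes w :: "nat \<Rightarrow> nat"
  assumes "p < q" "w q < w p" "inj_on w {p..q}"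
  shows "card {(i, j). p \<le> i \<and> i < j \<and> j \<le> q \<and> w j < w i} =
    card {(i, j). Suc p \<le> i \<and> i < j \<and> j \<le> q - 1 \<and> w j < w i} +
    (q - p) + card {j\<in>{p<..<q}. w q < w j \<and> w j < w p}"
proof -
  let ?I = "{(i, j). Suc p \<le> i \<and> i < j \<and> j \<le> q - 1 \<and> w j < w i}"
  let ?A = "{j\<in>{p<..<q}. w j < w p}" and ?B = "{j\<in>{p<..<q}. w q < w j}"
  have dec: "{(i, j). p \<le> i \<and> i < j \<and> j \<le> q \<and> w j < w i} =
      ?I \<union> (Pair p ` ?A \<union> ((\<lambda>i. (i, q)) ` ?B \<union> {(p, q)}))" (is "?L = _")
  proof (intro Set.set_eqI iffI)
    fix z assume "z \<in> ?L"
    then obtain i j where z: "z = (i, j)" "p \<le> i" "i < j" "j \<le> q" "w j < w i"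
      by auto
    consider "i = p" "j = q" | "i = p" "j < q" | "p < i" "j = q" | "p < i" "j < q"
      using z by linarith
    then show "z \<in> ?I \<union> (Pair p ` ?A \<union> ((\<lambda>i. (i, q)) ` ?B \<union> {(p, q)}))"
      using z by cases auto
  qed (use assms in auto)
  have fin: "finite ?I"
    by (rule finite_subset[of _ "{p..q} \<times> {p..q}"]) auto
  have "card (?I \<union> (Pair p ` ?A \<union> ((\<lambda>i. (i, q)) ` ?B \<union> {(p, q)}))) =
      card ?I + card (Pair p ` ?A \<union> ((\<lambda>i. (i, q)) ` ?B \<union> {(p, q)}))"
    using fin \<open>p < q\<close> by (intro card_Un_disjoint) auto
  also have "card (Pair p ` ?A \<union> ((\<lambda>i. (i, q)) ` ?B \<union> {(p, q)})) =
      card (Pair p ` ?A) + card ((\<lambda>i. (i, q)) ` ?B \<union> {(p, q)})"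
    using \<open>p < q\<close> by (intro card_Un_disjoint) auto
  also have "card ((\<lambda>i. (i, q)) ` ?B \<union> {(p, q)}) = card ((\<lambda>i. (i, q)) ` ?B) + 1"
    by (subst card_Un_disjoint) auto
  finally have "card ?L = card ?I + (card (Pair p ` ?A) + (card ((\<lambda>i. (i, q)) ` ?B) + 1))"
    by (simp only: dec)
  also have "card (Pair p ` ?A) = card ?A"
    by (intro card_image inj_onI) auto
  also have "card ((\<lambda>i. (i, q)) ` ?B) = card ?B"
    by (intro card_image inj_onI) auto
  finally have L: "card ?L = card ?I + (card ?A + (card ?B + 1))" .
  have "?A \<union> ?B = {p<..<q}"
    using assms by force
  moreover have "?A \<inter> ?B = {j\<in>{p<..<q}. w q < w j \<and> w j < w p}"
    by auto
  ultimately have "card ?A + card ?B = card {p<..<q} + card {j\<in>{p<..<q}. w q < w j \<and> w j < w p}"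
    using card_Un_Int[of ?A ?B] by simp
  with L \<open>p < q\<close> show ?thesis
    by simp
qed

definition nested :: "nat \<Rightarrow> (nat \<Rightarrow> nat) \<Rightarrow> nat \<Rightarrow> nat set" where
  "nested n w p = {j\<in>{p<..<n + 1 - p}. w (n + 1 - p) < w j \<and> w j < w p}"

lemma sum_odd_steps:
  fixes n t :: nat
  assumes "t \<le> n div 2"
  shows "(\<Sum>p = 1..t. n + 1 - 2 * p) = t * (n - t)"
  using assms
proof (induction t)
  case (Suc t)
  then have "n = 2 * t + 2 + (n - (2 * t + 2))"
    by simp
  then obtain r where r: "n = 2 * t + 2 + r" ..
  show ?case
  proof -
    have "(\<Sum>p = 1..t. n + 1 - 2 * p) = t * (n - t)"
      using Suc by simp
    moreover have "n - t = t + 2 + r" "n - Suc t = t + 1 + r" "n + 1 - 2 * Suc t = 1 + r"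
      using r by simp_all
    ultimately show ?thesis
      by simp
  qed
qed simp

text \<open>Peel the pairs of positions \<open>p\<close> and \<open>n + 1 - p\<close> from the
  outside inwards; spacing is the hypothesis of \<open>card_inversions_peel\<close> at each
  stage.\<close>

lemma inversions_spaced:
  assumes w: "w permutes {1..n}" and sp: "spacing_condition n w"
  shows "inversions n w = (n div 2) * (n - n div 2) + (\<Sum>p = 1..n div 2. card (nested n w p))"
proof -
  have inj: "inj_on w A" for A
    using w by (rule inj_on_subset[OF permutes_inj]) simp
  let ?J = "\<lambda>t. {(i, j). Suc t \<le> i \<and> i < j \<and> j \<le> n - t \<and> w j < w i}"
  have *: "card (?J 0) = card (?J t) + (\<Sum>p = 1..t. (n + 1 - 2 * p) + card (nested n w p))"
    if "t \<le> n div 2" for t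
    using that
  proof (induction t)
    case (Suc t)
    have "Suc t < n - t" "w (n - t) < w (Suc t)"
      using Suc.prems sp by (auto simp: spacing_condition_def dest!: bspec[of _ _ "Suc t"])
    then have "card (?J t) = card (?J (Suc t)) + ((n - t) - Suc t) + card (nested n w (Suc t))"
      using card_inversions_peel[of "Suc t" "n - t" w, OF _ _ inj] by (simp add: nested_def)
    moreover have "card (?J 0) = card (?J t) + (\<Sum>p = 1..t. (n + 1 - 2 * p) + card (nested n w p))"
      using Suc by simp
    moreover have "n - t - Suc t = n + 1 - 2 * Suc t"
      by simp
    ultimately show ?case
      by (simp add: sum.cl_ivl_Suc)
  qed simp
  \<comment> \<open>At most one position is left in the middle.\<close>
  have "?J (n div 2) = {}"
    by auto
  with *[of "n div 2"] show ?thesis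
    by (simp add: inversions_def sum.distrib sum_odd_steps del: One_nat_def) simp
qed

text \<open>The values removed before step \<open>i\<close> stand at the outer positions, so what
  remains is the image of \<open>{i..n + 1 - i}\<close>. An immediate predecessor in that set leaves
  no value for \<open>nested\<close>.\<close>

lemma double_box_contraction_iff:
  assumes w: "w permutes {1..n}"
  shows "double_box_contraction n w \<longleftrightarrow>
    spacing_condition n w \<and> (\<forall>p\<in>{1..n div 2}. nested n w p = {})"
proof -
  have "immediate_predecessor ({1..n} - (\<Union>j\<in>{1..<i}. {w j, w (n + 1 - j)})) (w (n + 1 - i)) (w i)
      \<longleftrightarrow> w (n + 1 - i) < w i \<and> nested n w i = {}" if i: "i \<in> {1..n div 2}" for i
  proof -
    have "(\<lambda>j. n + 1 - j) ` {1..<i} = {n + 1 - i<..n}"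
    proof (intro Set.set_eqI iffI)
      fix j assume "j \<in> {n + 1 - i<..n}"
      then have "j = n + 1 - (n + 1 - j)" "n + 1 - j \<in> {1..<i}"
        by auto
      then show "j \<in> (\<lambda>j. n + 1 - j) ` {1..<i}"
        by blast
    qed (use i in auto)
    moreover have "(\<Union>j\<in>{1..<i}. {w j, w (n + 1 - j)}) = w ` {1..<i} \<union> w ` (\<lambda>j. n + 1 - j) ` {1..<i}"
      by blast
    ultimately have "{1..n} - (\<Union>j\<in>{1..<i}. {w j, w (n + 1 - j)}) =
        w ` {1..n} - w ` ({1..<i} \<union> {n + 1 - i<..n})"
      by (simp only: permutes_image[OF w] image_Un)
    also have "\<dots> = w ` ({1..n} - ({1..<i} \<union> {n + 1 - i<..n}))"
      using permutes_inj[OF w] by (simp add: image_set_diff)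
    also have "{1..n} - ({1..<i} \<union> {n + 1 - i<..n}) = {i..n + 1 - i}"
      using i by auto
    finally have R: "{1..n} - (\<Union>j\<in>{1..<i}. {w j, w (n + 1 - j)}) = w ` {i..n + 1 - i}" .
    have "w i \<in> w ` {i..n + 1 - i}" "w (n + 1 - i) \<in> w ` {i..n + 1 - i}"
      using i by auto
    moreover have "(\<exists>x\<in>w ` {i..n + 1 - i}. w (n + 1 - i) < x \<and> x < w i) \<longleftrightarrow> nested n w i \<noteq> {}"
    proof
      assume "\<exists>x\<in>w ` {i..n + 1 - i}. w (n + 1 - i) < x \<and> x < w i"
      then obtain j where j: "j \<in> {i..n + 1 - i}" "w (n + 1 - i) < w j" "w j < w i"
        by blast
      then have "j \<noteq> i" "j \<noteq> n + 1 - i"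
        by auto
      with j have "j \<in> nested n w i"
        by (simp add: nested_def)
      then show "nested n w i \<noteq> {}"
        by blast
    next
      assume "nested n w i \<noteq> {}"
      then obtain j where "j \<in> nested n w i"
        by blast
      then have "j \<in> {i..n + 1 - i}" "w (n + 1 - i) < w j" "w j < w i"
        by (simp_all add: nested_def)
      then show "\<exists>x\<in>w ` {i..n + 1 - i}. w (n + 1 - i) < x \<and> x < w i"
        by blast
    qed
    ultimately show ?thesis
      unfolding R immediate_predecessor_def by blast
  qed
  then show ?thesis
    unfolding double_box_contraction_def spacing_condition_def by auto
qed

lemma inversions_spaced_eq_iff:
  assumes w: "w permutes {1..n}" and sp: "spacing_condition n w"
  shows "(n div 2) * (n - n div 2) \<le> inversions n w"
    and "inversions n w = (n div 2) * (n - n div 2) \<longleftrightarrow> double_box_contraction n w"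
proof -
  have "finite (nested n w p)" for p
    by (simp add: nested_def)
  then show "(n div 2) * (n - n div 2) \<le> inversions n w"
    and "inversions n w = (n div 2) * (n - n div 2) \<longleftrightarrow> double_box_contraction n w"
    using inversions_spaced[OF assms] sp by (simp_all add: double_box_contraction_iff[OF w])
qed

section \<open>Domination of the last values by the first ones\<close>

text \<open>Threshold form of an entrywise comparison: sorted increasingly, the first
  \<open>t\<close> values are at least the last \<open>t\<close> values. Thresholds are what
  dimensions of intersections with the standard flag provide.\<close>

definition dominated :: "nat \<Rightarrow> (nat \<Rightarrow> nat) \<Rightarrow> bool" where
  "dominated n w \<longleftrightarrow> (\<forall>t\<le>n div 2. \<forall>k.
     card {i\<in>{1..t}. w i \<le> k} \<le> card {i\<in>{1..t}. w (n + 1 - i) \<le> k})"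

lemma card_filter_Suc:
  "card {i\<in>{1..Suc t}. P i} = card {i\<in>{1..t}. P i} + (if P (Suc t) then 1 else 0)"
proof -
  have "{i\<in>{1..Suc t}. P i} = (if P (Suc t) then insert (Suc t) {i\<in>{1..t}. P i} else {i\<in>{1..t}. P i})"
    by (auto simp: le_Suc_eq)
  then show ?thesis by simp
qed

text \<open>Each pair whose interval from \<open>l i\<close> to \<open>k i\<close> covers the
  threshold contributes one unit of slack to the domination inequality.\<close>

lemma card_covering:
  fixes k l :: "nat \<Rightarrow> nat"
  assumes "\<forall>i\<in>{1..t}. l i < k i"
  shows "card {i\<in>{1..t}. l i \<le> x} = card {i\<in>{1..t}. k i \<le> x} + card {i\<in>{1..t}. l i \<le> x \<and> x < k i}"
proof -
  have "{i\<in>{1..t}. l i \<le> x} = {i\<in>{1..t}. k i \<le> x} \<union> {i\<in>{1..t}. l i \<le> x \<and> x < k i}"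
    using assms by fastforce
  then show ?thesis
    by (simp only:) (subst card_Un_disjoint; auto)
qed

lemma card_filter_remove:
  fixes t :: nat
  assumes "p \<in> {1..t}"
  shows "card {i\<in>{1..t}. P i} = card {i\<in>{1..t} - {p}. P i} + (if P p then 1 else 0)"
proof -
  have "{i\<in>{1..t}. P i} = (if P p then insert p {i\<in>{1..t} - {p}. P i} else {i\<in>{1..t} - {p}. P i})"
    using assms by auto
  then show ?thesis by simp
qed

lemma card_filter_swap:
  fixes w :: "nat \<Rightarrow> nat"
  assumes "p \<in> {1..t}" "q \<notin> {1..t}"
  shows "card {i\<in>{1..t}. (w \<circ> Transposition.transpose p q) i \<le> x} =
    card {i\<in>{1..t} - {p}. w i \<le> x} + (if w q \<le> x then 1 else 0)"
proof -
  have "{i\<in>{1..t} - {p}. (w \<circ> Transposition.transpose p q) i \<le> x} = {i\<in>{1..t} - {p}. w i \<le> x}"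
    using assms by (auto simp: Transposition.transpose_def)
  then show ?thesis
    by (simp only: card_filter_remove[OF assms(1)]) simp
qed

text \<open>The set of the first \<open>t\<close> values changes only for
  \<open>p \<le> t < i\<close>, where \<open>w p\<close> is replaced by the smaller
  \<open>w i\<close>. This raises the count by one at thresholds from \<open>w i\<close> up to, but
  excluding, \<open>w p\<close>; there the pair of \<open>p\<close> covers the threshold and
  supplies the slack.\<close>

lemma dominated_swap:
  assumes w: "w permutes {1..n}" and dom: "dominated n w"
    and sp: "\<And>j. j \<in> {1..<i} \<Longrightarrow> w (n + 1 - j) < w j"
    and p: "1 \<le> p" "p < i" "i \<le> n div 2" "w (n + 1 - p) < w i" "w i < w p"
  shows "dominated n (w \<circ> Transposition.transpose p i)"
  unfolding dominated_def
proof (intro allI impI)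
  fix t x assume t: "t \<le> n div 2"
  let ?w = "w \<circ> Transposition.transpose p i"
  have far: "?w (n + 1 - j) = w (n + 1 - j)" if "j \<in> {1..t}" for j
    using that t p by (auto simp: Transposition.transpose_def)
  have R: "{j\<in>{1..t}. ?w (n + 1 - j) \<le> x} = {j\<in>{1..t}. w (n + 1 - j) \<le> x}"
    using far by auto
  consider "t < p" | "i \<le> t" | "p \<le> t" "t < i" by linarith
  then have "card {j\<in>{1..t}. ?w j \<le> x} \<le> card {j\<in>{1..t}. w (n + 1 - j) \<le> x}"
  proof cases
    case 1
    then have "?w j = w j" if "j \<in> {1..t}" for j
      using that p by (auto simp: Transposition.transpose_def)
    then have "{j\<in>{1..t}. ?w j \<le> x} = {j\<in>{1..t}. w j \<le> x}"
      by auto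
    then show ?thesis
      using dom t unfolding dominated_def by simp
  next
    case 2
    have T: "Transposition.transpose p i j \<in> {1..t} \<longleftrightarrow> j \<in> {1..t}" for j
      using p 2 by (auto simp: Transposition.transpose_def)
    have "Transposition.transpose p i ` {j\<in>{1..t}. ?w j \<le> x} = {j\<in>{1..t}. w j \<le> x}"
    proof (intro Set.set_eqI iffI)
      fix j assume "j \<in> {j\<in>{1..t}. w j \<le> x}"
      then have "Transposition.transpose p i j \<in> {j\<in>{1..t}. ?w j \<le> x}"
        using T by simp
      then show "j \<in> Transposition.transpose p i ` {j\<in>{1..t}. ?w j \<le> x}"
        by (metis imageI transpose_involutory)
    qed (use T in auto)
    moreover have "inj_on (Transposition.transpose p i) {j\<in>{1..t}. ?w j \<le> x}"
      by (rule inj_on_subset[OF inj_transpose]) simp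
    ultimately have "card {j\<in>{1..t}. ?w j \<le> x} = card {j\<in>{1..t}. w j \<le> x}"
      by (simp only: flip: card_image)
    then show ?thesis
      using dom t unfolding dominated_def by simp
  next
    case 3
    have pt: "p \<in> {1..t}" "i \<notin> {1..t}"
      using 3 p by auto
    have sp': "\<forall>j\<in>{1..t}. w (n + 1 - j) < w j"
      using sp 3 by auto
    have eq: "card {j\<in>{1..t}. w j \<le> x} = card {j\<in>{1..t} - {p}. w j \<le> x} + (if w p \<le> x then 1 else 0)"
      using card_filter_remove[OF pt(1)] .
    have cov: "p \<in> {j\<in>{1..t}. w (n + 1 - j) \<le> x \<and> x < w j}" if "w i \<le> x" "x < w p"
      using that p pt by auto
    have "1 \<le> card {j\<in>{1..t}. w (n + 1 - j) \<le> x \<and> x < w j}" if "w i \<le> x" "x < w p"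
      using card_mono[of "{j\<in>{1..t}. w (n + 1 - j) \<le> x \<and> x < w j}" "{p}"] cov[OF that] by simp
    moreover have "card {j\<in>{1..t}. ?w j \<le> x} = card {j\<in>{1..t} - {p}. w j \<le> x} + (if w i \<le> x then 1 else 0)"
      by (rule card_filter_swap[OF pt])
    moreover have "card {j\<in>{1..t}. w (n + 1 - j) \<le> x} =
        card {j\<in>{1..t}. w j \<le> x} + card {j\<in>{1..t}. w (n + 1 - j) \<le> x \<and> x < w j}"
      by (rule card_covering[OF sp'])
    ultimately show ?thesis
      using eq p(5) by (cases "w i \<le> x"; cases "x < w p") simp_all
  qed
  then show "card {j\<in>{1..t}. ?w j \<le> x} \<le> card {j\<in>{1..t}. ?w (n + 1 - j) \<le> x}"
    by (simp only: R)
qed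

text \<open>Induction on the number of inversions. At the first failure \<open>i\<close> of spacing,
  the threshold \<open>w i\<close> counts \<open>w i\<close> but not \<open>w (n + 1 - i)\<close>.
  Domination then forces an earlier pair, that of \<open>p\<close>, to cover \<open>w i\<close>,
  which is the situation of \<open>dominated_swap\<close>.\<close>

lemma dominated_imp_inversions:
  assumes "w permutes {1..n}" "dominated n w"
  shows "(n div 2) * (n - n div 2) \<le> inversions n w \<and>
    (inversions n w = (n div 2) * (n - n div 2) \<longrightarrow> double_box_contraction n w)"
  using assms
proof (induction "inversions n w" arbitrary: w rule: less_induct)
  case less
  show ?case
  proof (cases "spacing_condition n w")
    case True
    then show ?thesis
      using inversions_spaced_eq_iff less.prems by blast
  next
    case False
    let ?bad = "\<lambda>i. i \<in> {1..n div 2} \<and> \<not> w (n + 1 - i) < w i"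
    define i where "i = (LEAST i. ?bad i)"
    have "\<exists>i. ?bad i"
      using False by (auto simp: spacing_condition_def)
    then have i: "?bad i"
      unfolding i_def by (rule LeastI_ex)
    have least: "i \<le> j" if "?bad j" for j
      unfolding i_def using that by (rule Least_le)
    have sp: "w (n + 1 - j) < w j" if j: "j \<in> {1..<i}" for j
    proof (rule ccontr)
      assume "\<not> w (n + 1 - j) < w j"
      with i j have "?bad j"
        by simp
      then show False
        using least j by fastforce
    qed
    obtain t where t: "i = Suc t"
      using i by (cases i) auto
    have inj: "inj w"
      using less.prems permutes_inj by blast
    have "i \<noteq> n + 1 - i"
      using i by auto
    then have lt: "w i < w (n + 1 - i)"
      using i inj_eq[OF inj, of i "n + 1 - i"] by linarith
    have "card {j\<in>{1..i}. w j \<le> w i} \<le> card {j\<in>{1..i}. w (n + 1 - j) \<le> w i}"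
      using less.prems(2) i unfolding dominated_def atLeastAtMost_iff by blast
    then have "card {j\<in>{1..t}. w j \<le> w i} < card {j\<in>{1..t}. w (n + 1 - j) \<le> w i}"
      using lt card_filter_Suc[of t "\<lambda>j. w j \<le> w i"] card_filter_Suc[of t "\<lambda>j. w (n + 1 - j) \<le> w i"]
      unfolding t[symmetric] by simp
    moreover have "card {j\<in>{1..t}. w (n + 1 - j) \<le> w i} = card {j\<in>{1..t}. w j \<le> w i} +
        card {j\<in>{1..t}. w (n + 1 - j) \<le> w i \<and> w i < w j}"
      by (rule card_covering[of t "\<lambda>j. w (n + 1 - j)" w "w i"]) (use sp t in auto)
    ultimately have "card {j\<in>{1..t}. w (n + 1 - j) \<le> w i \<and> w i < w j} \<noteq> 0"
      by linarith
    then have "{j\<in>{1..t}. w (n + 1 - j) \<le> w i \<and> w i < w j} \<noteq> {}"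
      by (metis card.empty)
    then obtain p where p: "p \<in> {1..t}" "w (n + 1 - p) \<le> w i" "w i < w p"
      by blast
    have "n + 1 - p \<noteq> i"
      using p i unfolding t by auto
    then have lp: "w (n + 1 - p) < w i"
      using p(2) inj_eq[OF inj, of "n + 1 - p" i] by linarith
    let ?w = "w \<circ> Transposition.transpose p i"
    have "p \<le> n" "1 \<le> p" "p < i" "i \<le> n" "i \<le> n div 2"
      using p i t by auto
    have "dominated n ?w"
      by (rule dominated_swap[OF less.prems sp \<open>1 \<le> p\<close> \<open>p < i\<close> \<open>i \<le> n div 2\<close> lp p(3)])
    moreover have "?w permutes {1..n}"
      by (rule permutes_compose[OF permutes_swap_id less.prems(1)])
        (use \<open>p \<le> n\<close> \<open>1 \<le> p\<close> \<open>p < i\<close> \<open>i \<le> n\<close> in simp_all)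
    moreover have inv: "inversions n ?w < inversions n w"
      by (rule inversions_swap_less) fact+
    ultimately have "(n div 2) * (n - n div 2) \<le> inversions n ?w"
      using less.hyps by blast
    \<comment> \<open>The bound for \<open>?w\<close> makes the one for \<open>w\<close> strict, so
      the equality case is vacuous.\<close>
    with inv show ?thesis
      by linarith
  qed
qed

section \<open>Flags\<close>

definition rk :: "'n::{finite,linorder} \<Rightarrow> nat" where
  "rk a = card {..a}"

lemma rk_less_iff: "rk a < rk b \<longleftrightarrow> a < b"
proof -
  have *: "rk a < rk b" if "a < b" for a b :: 'a
    unfolding rk_def by (rule psubset_card_mono) (use that in auto)
  show ?thesis
    using *[of a b] *[of b a] by (metis less_asym' linorder_neqE less_irrefl)
qed

lemma rk_le_iff: "rk a \<le> rk b \<longleftrightarrow> a \<le> b"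
  using rk_less_iff[of b a] by (simp add: not_less[symmetric])

lemma rk_eq_iff [simp]: "rk a = rk b \<longleftrightarrow> a = b"
  by (metis order_antisym_conv order_refl rk_le_iff)

lemma rk_pos: "1 \<le> rk a"
  by (auto simp: rk_def Suc_le_eq card_gt_0_iff)

lemma rk_le: "rk (a :: 'n::{finite,linorder}) \<le> CARD('n)"
  by (simp add: rk_def card_mono)

lemma bij_betw_rk: "bij_betw (rk :: 'n::{finite,linorder} \<Rightarrow> nat) UNIV {1..CARD('n)}"
proof -
  have inj: "inj (rk :: 'n \<Rightarrow> nat)"
    by (rule injI) simp
  moreover have "range (rk :: 'n \<Rightarrow> nat) = {1..CARD('n)}"
    by (rule card_subset_eq) (use rk_pos rk_le in \<open>auto simp: card_image[OF inj]\<close>)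
  ultimately show ?thesis
    by (simp add: bij_betw_def)
qed

definition unrk :: "nat \<Rightarrow> 'n::{finite,linorder}" where
  "unrk = inv_into UNIV rk"

lemma unrk_rk [simp]: "unrk (rk a) = a"
  by (simp add: unrk_def inj_on_def)

lemma rk_unrk: "k \<in> {1..CARD('n)} \<Longrightarrow> rk (unrk k :: 'n::{finite,linorder}) = k"
  unfolding unrk_def using bij_betw_rk[where 'n = 'n]
  by (intro f_inv_into_f) (simp add: bij_betw_def)

text \<open>In the sorted list, exactly \<open>k\<close> elements are at most the
  \<open>k\<close>-th entry, and this number is its \<open>rk\<close>.\<close>

lemma basis_vec_eq:
  assumes "k \<in> {1..CARD('n)}"
  shows "basis_vec k = axis (unrk k :: 'n::{finite,linorder}) 1"
proof -
  let ?xs = "sorted_list_of_set (UNIV :: 'n set)"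
  have len: "length ?xs = CARD('n)"
    by (simp add: length_sorted_list_of_set)
  have mono: "?xs ! i < ?xs ! j \<longleftrightarrow> i < j" if "i < CARD('n)" "j < CARD('n)" for i j
    using sorted_wrt_nth_less[OF strict_sorted_list_of_set[of "UNIV :: 'n set"]] that len
    by (metis less_asym' linorder_neqE_nat less_irrefl)
  let ?a = "?xs ! (k - 1)"
  have "{..?a} = (!) ?xs ` {..k - 1}"
  proof (intro Set.set_eqI iffI)
    fix b assume b: "b \<in> {..?a}"
    have "b \<in> set ?xs"
      by simp
    then obtain i where i: "i < CARD('n)" "b = ?xs ! i"
      by (metis in_set_conv_nth len)
    then have "\<not> ?a < ?xs ! i"
      using b by auto
    then have "i \<le> k - 1"
      using mono[of "k - 1" i] i assms by (cases "k - 1 < i") auto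
    with i show "b \<in> (!) ?xs ` {..k - 1}"
      by blast
  next
    fix b assume "b \<in> (!) ?xs ` {..k - 1}"
    then obtain i where i: "b = ?xs ! i" "i \<le> k - 1"
      by blast
    moreover have "k - 1 < CARD('n)" "i < CARD('n)"
      using i assms by auto
    ultimately show "b \<in> {..?a}"
      using mono[of "k - 1" i] by (simp add: not_less[symmetric])
  qed
  moreover have "inj_on ((!) ?xs) {..k - 1}"
    by (rule inj_on_nth) (use assms len in auto)
  ultimately have "rk ?a = k"
    using assms by (simp add: rk_def card_image)
  then have "unrk k = ?a"
    by (metis unrk_rk)
  then show ?thesis
    by (simp add: basis_vec_def)
qed

definition std :: "nat \<Rightarrow> ((complex, 'n::{finite,linorder}) vec) set" where
  "std k = {x. \<forall>a. k < rk a \<longrightarrow> x $ a = 0}"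

lemma span_axes: "vec.span ((\<lambda>a. axis a 1) ` A) = {x :: (complex, 'n::finite) vec. \<forall>a. a \<notin> A \<longrightarrow> x $ a = 0}"
  (is "_ = ?S")
proof
  show "vec.span ((\<lambda>a. axis a 1) ` A) \<subseteq> ?S"
  proof (rule vec.span_minimal)
    show "vec.subspace ?S"
      by (auto simp: vec.subspace_def)
  qed (auto simp: axis_def)
  show "?S \<subseteq> vec.span ((\<lambda>a. axis a 1) ` A)"
  proof
    fix x assume x: "x \<in> ?S"
    have "x = (\<Sum>a\<in>UNIV. x $ a *s axis a 1)"
      by (simp add: basis_expansion)
    also have "\<dots> \<in> vec.span ((\<lambda>a. axis a 1) ` A)"
    proof (rule vec.span_sum)
      fix a show "x $ a *s axis a 1 \<in> vec.span ((\<lambda>a. axis a 1) ` A)"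
        using x by (cases "a \<in> A") (auto intro: vec.span_scale vec.span_base simp: vec.span_zero)
    qed
    finally show "x \<in> vec.span ((\<lambda>a. axis a 1) ` A)" .
  qed
qed

lemma coordinate_flag_eq:
  assumes w: "w permutes {1..CARD('n)}"
  shows "(coordinate_flag w k :: ((complex, 'n::{finite,linorder}) vec) set) =
    {x. \<forall>a. a \<notin> (\<lambda>i. unrk (w i)) ` {1..min k CARD('n)} \<longrightarrow> x $ a = 0}"
proof -
  have "w i \<in> {1..CARD('n)}" if "i \<in> {1..min k CARD('n)}" for i
    using permutes_in_image[OF w, of i] that by auto
  then have "(\<lambda>i. basis_vec (w i) :: (complex, 'n) vec) ` {1..min k CARD('n)} =
      (\<lambda>a. axis a 1) ` (\<lambda>i. unrk (w i)) ` {1..min k CARD('n)}"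
    unfolding image_image by (intro image_cong) (auto simp: basis_vec_eq)
  then show ?thesis
    unfolding coordinate_flag_def by (simp only: span_axes)
qed

lemma coordinate_flag_id: "coordinate_flag id = std"
proof
  fix k
  have "(a :: 'a) \<in> unrk ` {1..min k CARD('a)} \<longleftrightarrow> rk a \<le> k" for a
  proof
    assume "a \<in> unrk ` {1..min k CARD('a)}"
    then show "rk a \<le> k"
      by (auto simp: rk_unrk)
  next
    assume "rk a \<le> k"
    then have "a = unrk (rk a)" "rk a \<in> {1..min k CARD('a)}"
      using rk_pos[of a] rk_le[of a] by auto
    then show "a \<in> unrk ` {1..min k CARD('a)}"
      by blast
  qed
  then show "coordinate_flag id k = (std k :: ((complex, 'a) vec) set)"
    by (simp add: coordinate_flag_eq[OF permutes_id] std_def not_le)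
qed

lemma subspace_std: "vec.subspace (std k)"
  by (auto simp: std_def vec.subspace_def)

lemma std_mono: "i \<le> j \<Longrightarrow> std i \<subseteq> std j"
  by (auto simp: std_def)

lemma rk_image: "rk ` {a :: 'n::{finite,linorder}. rk a \<le> k} = {1..min k CARD('n)}"
proof (intro Set.set_eqI iffI)
  fix i assume "i \<in> {1..min k CARD('n)}"
  then have "rk (unrk i :: 'n) = i" "i \<le> k"
    using rk_unrk[of i, where 'n = 'n] by auto
  then show "i \<in> rk ` {a :: 'n. rk a \<le> k}"
    by (metis (mono_tags, lifting) imageI mem_Collect_eq)
qed (use rk_pos rk_le in auto)

lemma card_rk_le: "card {a :: 'n::{finite,linorder}. rk a \<le> k} = min k CARD('n)"
  using rk_image[of k, where 'n = 'n]
  by (metis card_atLeastAtMost card_image diff_Suc_1 inj_on_def rk_eq_iff)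

lemma dim_std: "vec.dim (std k :: ((complex, 'n::{finite,linorder}) vec) set) = min k CARD('n)"
  using dim_substandard_cart[of "{a :: 'n. rk a \<le> k}", where 'a = complex]
  by (simp add: std_def card_rk_le not_le)

lemma axis_std: "axis b c \<in> std k" if "rk b \<le> k"
  using that by (auto simp: std_def axis_def)

lemma mult_axis_nth: "(A *v axis j 1) $ i = (A $ i $ j :: complex)"
  by (simp add: matrix_vector_mult_def axis_def if_distrib cong: if_cong)

definition flag_of :: "'n cmat \<Rightarrow> 'n::{finite,linorder} flag" where
  "flag_of g = act g (coordinate_flag id)"

lemma flag_of_apply: "flag_of g k = (*v) g ` std k"
  by (simp add: flag_of_def act_def coordinate_flag_id)

lemma act_flag_of: "act h (flag_of g) = flag_of (h ** g)"
  by (rule ext) (simp add: act_def flag_of_apply image_image matrix_vector_mul_assoc)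

lemma inj_mult: "det (g :: 'n::finite cmat) \<noteq> 0 \<Longrightarrow> inj ((*v) g)"
  by (metis inj_matrix_vector_mult invertible_det_nz)

lemma dim_mult_image: "det g \<noteq> 0 \<Longrightarrow> vec.dim ((*v) g ` S) = vec.dim (S :: (complex, 'n::finite) vec set)"
  by (rule vec.dim_image_eq) (auto intro: inj_on_subset[OF inj_mult])

lemma flag_of_in_flags: "det g \<noteq> 0 \<Longrightarrow> flag_of g \<in> flags"
  unfolding flags_def flag_of_apply mono_def
  by (auto simp: dim_mult_image dim_std intro: vec.subspace_image subspace_std dest: std_mono)

lemma flag_of_nth_UNIV: "V \<in> flags \<Longrightarrow> CARD('n) \<le> k \<Longrightarrow> V k = (UNIV :: ((complex, 'n::{finite,linorder}) vec) set)"
  by (rule vec.subspace_dim_equal) (auto simp: flags_def card_cart_basis)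

text \<open>Each \<open>v a\<close> spans \<open>V (rk a)\<close> modulo
  \<open>V (rk a - 1)\<close>, so by induction the leading columns of \<open>g\<close> span the
  members of \<open>V\<close>. At the top member this makes \<open>g\<close> surjective.\<close>

lemma flag_of_adapted:
  fixes v :: "'n::{finite,linorder} \<Rightarrow> (complex, 'n) vec"
  assumes V: "V \<in> flags" and v: "\<And>a. v a \<in> V (rk a)" "\<And>a. v a \<notin> V (rk a - 1)"
  defines "g \<equiv> \<chi> i j. v j $ i"
  shows "det g \<noteq> 0" "flag_of g = V"
proof -
  have sub: "vec.subspace (V k)" and dim: "vec.dim (V k) = min k CARD('n)" and "mono V" for k
    using V by (auto simp: flags_def)
  have g: "g *v axis a 1 = v a" for a
    by (simp add: vec_eq_iff mult_axis_nth) (simp add: g_def)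
  have le: "V k \<subseteq> (*v) g ` std k" if "k \<le> CARD('n)" for k
    using that
  proof (induction k)
    case 0
    have "V 0 \<subseteq> {0}"
      using dim[of 0] by simp
    moreover have "(0 :: (complex, 'n) vec) \<in> (*v) g ` std 0"
      by (rule image_eqI[of _ _ 0]) (auto simp: std_def)
    ultimately show ?case
      by blast
  next
    case (Suc k)
    let ?a = "unrk (Suc k) :: 'n"
    have a: "rk ?a = Suc k"
      using Suc.prems by (simp add: rk_unrk)
    have "V k \<subseteq> V (Suc k)"
      using \<open>mono V\<close> by (simp add: mono_def)
    have span: "vec.span (V k) = V k"
      using sub by (simp add: vec.span_eq_iff)
    have "vec.span (insert (v ?a) (V k)) = V (Suc k)"
    proof (rule vec.subspace_dim_equal)
      show "vec.span (insert (v ?a) (V k)) \<subseteq> V (Suc k)"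
        using v(1)[of ?a] \<open>V k \<subseteq> V (Suc k)\<close> by (intro vec.span_minimal sub) (auto simp: a)
      show "vec.dim (V (Suc k)) \<le> vec.dim (vec.span (insert (v ?a) (V k)))"
        using v(2)[of ?a] Suc.prems by (simp add: vec.dim_insert span dim a)
    qed (auto intro: sub)
    then have "\<exists>c. x - c *s v ?a \<in> V k" if "x \<in> V (Suc k)" for x
      using that span by (auto simp: vec.span_insert)
    then show ?case
    proof (intro subsetI)
      fix x assume "x \<in> V (Suc k)" and "\<And>x. x \<in> V (Suc k) \<Longrightarrow> \<exists>c. x - c *s v ?a \<in> V k"
      then obtain c where "x - c *s v ?a \<in> V k"
        by blast
      then obtain z where z: "z \<in> std k" "x - c *s v ?a = g *v z"
        using Suc by auto
      have "z + c *s axis ?a 1 \<in> std (Suc k)"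
        using z(1) std_mono[of k "Suc k"] axis_std[of ?a "Suc k" 1] a
        by (intro vec.subspace_add vec.subspace_scale subspace_std) auto
      moreover have "g *v (z + c *s axis ?a 1) = x"
        using z(2) by (simp add: vec.add vec.scale g algebra_simps flip: z(2))
      ultimately show "x \<in> (*v) g ` std (Suc k)"
        by blast
    qed
  qed
  have "surj ((*v) g)"
    using le[of "CARD('n)"] flag_of_nth_UNIV[OF V] by auto
  then show det: "det g \<noteq> 0"
    using matrix_right_invertible_surjective[of g] invertible_right_inverse[of g]
    by (auto simp: invertible_det_nz)
  show "flag_of g = V"
  proof
    fix k
    show "flag_of g k = V k"
    proof (cases "k \<le> CARD('n)")
      case True
      then have "V k = (*v) g ` std k"
        by (intro vec.subspace_dim_equal le sub vec.subspace_image subspace_std)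
          (simp_all add: dim_mult_image[OF det] dim dim_std)
      then show ?thesis
        by (simp add: flag_of_apply)
    next
      case False
      then show ?thesis
        using flag_of_nth_UNIV V flag_of_in_flags[OF det] by (metis nat_le_linear)
    qed
  qed
qed

lemma flag_obtain:
  fixes V :: "'n::{finite,linorder} flag"
  assumes "V \<in> flags"
  obtains g where "det g \<noteq> 0" "V = flag_of g"
proof -
  have "\<exists>x. x \<in> V (rk a) \<and> x \<notin> V (rk a - 1)" for a :: 'n
  proof (rule ccontr)
    assume "\<nexists>x. x \<in> V (rk a) \<and> x \<notin> V (rk a - 1)"
    then have "vec.dim (V (rk a)) \<le> vec.dim (V (rk a - 1))"
      by (intro vec.dim_subset) auto
    then show False
      using assms rk_pos[of a] rk_le[of a] by (simp add: flags_def)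
  qed
  then have "\<forall>a :: 'n. \<exists>x. x \<in> V (rk a) \<and> x \<notin> V (rk a - 1)"
    by blast
  from choice[OF this] obtain v where "\<And>a :: 'n. v a \<in> V (rk a)" "\<And>a :: 'n. v a \<notin> V (rk a - 1)"
    by blast
  then show ?thesis
    using flag_of_adapted[OF assms] that by metis
qed

section \<open>Triangular matrices and the stabilizer of the standard flag\<close>

definition upper :: "'n::{finite,linorder} cmat \<Rightarrow> bool" where
  "upper t \<longleftrightarrow> (\<forall>i j. j < i \<longrightarrow> t $ i $ j = 0)"

lemma upper_iff_std: "upper (t :: 'a::{finite,linorder} cmat) \<longleftrightarrow> (\<forall>k. (*v) t ` std k \<subseteq> std k)"
proof
  assume t: "upper t"
  show "\<forall>k. (*v) t ` std k \<subseteq> std k"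
  proof (intro allI image_subsetI)
    fix k and x :: "(complex, 'a) vec" assume x: "x \<in> std k"
    have "t $ a $ b * x $ b = 0" if "k < rk a" for a b
      using t x that unfolding upper_def std_def
      by (cases "b < a") (auto simp: rk_le_iff[symmetric] not_less)
    then show "t *v x \<in> std k"
      unfolding std_def matrix_vector_mult_def by (auto intro!: sum.neutral)
  qed
next
  assume t: "\<forall>k. (*v) t ` std k \<subseteq> std k"
  show "upper t"
    unfolding upper_def
  proof (intro allI impI)
    fix i j :: 'a assume "j < i"
    have "t *v axis j 1 \<in> std (rk j)"
      using t axis_std[of j "rk j"] by blast
    then show "t $ i $ j = 0"
      using \<open>j < i\<close> by (simp add: std_def rk_less_iff mult_axis_nth)
  qed
qed

lemma upper_image_std:
  assumes "upper t" "det t \<noteq> 0"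
  shows "(*v) t ` std k = std k"
  using assms
  by (intro vec.subspace_dim_equal)
    (auto simp: upper_iff_std dim_mult_image intro: vec.subspace_image subspace_std)

lemma flag_of_mult_upper:
  assumes "upper t" "det t \<noteq> 0"
  shows "flag_of (g ** t) = flag_of g"
proof
  fix k
  have "flag_of (g ** t) k = (*v) g ` (*v) t ` std k"
    by (simp add: flag_of_apply image_image matrix_vector_mul_assoc)
  then show "flag_of (g ** t) k = flag_of g k"
    by (simp only: upper_image_std[OF assms] flag_of_apply)
qed

text \<open>The quotient of \<open>h\<close> by \<open>g\<close> maps every \<open>std k\<close>
  into itself. Thus the fibres of \<open>flag_of\<close> on invertible matrices are the cosets of
  the invertible upper triangular ones.\<close>

lemma flag_of_eq_imp_upper:
  assumes "det g \<noteq> 0" "det h \<noteq> 0" "flag_of g = flag_of h"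
  obtains t where "upper t" "det t \<noteq> 0" "h = g ** t"
proof -
  obtain g' where g': "g ** g' = mat 1" "g' ** g = mat 1"
    using assms(1) by (auto simp flip: invertible_det_nz simp: invertible_def)
  have "(*v) (g' ** h) ` std k \<subseteq> std k" for k
  proof (rule image_subsetI)
    fix x :: "(complex, 'a) vec" assume "x \<in> std k"
    then have "h *v x \<in> (*v) g ` std k"
      using fun_cong[OF assms(3), of k] by (auto simp: flag_of_apply)
    then obtain y where "y \<in> std k" "h *v x = g *v y"
      by blast
    then show "(g' ** h) *v x \<in> std k"
      by (metis g'(2) matrix_vector_mul_assoc matrix_vector_mul_lid)
  qed
  then have "upper (g' ** h)"
    by (simp add: upper_iff_std)
  moreover have "h = g ** (g' ** h)"
    by (simp add: matrix_mul_assoc g')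
  moreover from this have "det (g' ** h) \<noteq> 0"
    using assms(2) by (metis det_mul mult_zero_right)
  ultimately show ?thesis
    using that by blast
qed

text \<open>Forward substitution, stated for one coordinate so that it applies when only the leading
  equations of the system hold.\<close>

lemma lower_solve:
  fixes A :: "'n::{finite,linorder} cmat"
  assumes "\<And>i j. i < j \<Longrightarrow> A $ i $ j = 0" "\<And>i. A $ i $ i \<noteq> 0"
    and "\<And>a. a \<le> b \<Longrightarrow> (A *v x) $ a = 0"
  shows "x $ b = 0"
  using assms(3)
proof (induction "rk b" arbitrary: b rule: less_induct)
  case less
  have x0: "x $ j = 0" if "j < b" for j
    using less.hyps[of j] less.prems that by (auto simp: rk_less_iff)
  have "(A *v x) $ b = (\<Sum>j\<in>UNIV. if j = b then A $ b $ b * x $ b else 0)"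
    unfolding matrix_vector_mult_def vec_lambda_beta
  proof (intro sum.cong refl)
    fix j show "A $ b $ j * x $ j = (if j = b then A $ b $ b * x $ b else 0)"
      using x0[of j] assms(1)[of b j] by (cases b j rule: linorder_cases) auto
  qed
  then show ?case
    using less.prems[of b] assms(2)[of b] by simp
qed

lemma det_lower_nonzero:
  fixes A :: "'n::{finite,linorder} cmat"
  assumes "\<And>i j. i < j \<Longrightarrow> A $ i $ j = 0" "\<And>i. A $ i $ i \<noteq> 0"
  shows "det A \<noteq> 0"
proof -
  have "x = 0" if "A *v x = 0" for x
    using lower_solve[OF assms, of _ x] that by (simp add: vec_eq_iff)
  then show ?thesis
    using matrix_left_invertible_ker[of A] invertible_left_inverse[of A]
    by (auto simp: invertible_det_nz)
qed

lemma det_upper_nonzero: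
  assumes "upper t" "\<And>i. t $ i $ i \<noteq> 0"
  shows "det t \<noteq> 0"
proof -
  have "det (transpose t) \<noteq> 0"
    by (rule det_lower_nonzero) (use assms in \<open>auto simp: upper_def transpose_def\<close>)
  then show ?thesis
    by simp
qed

text \<open>With a zero on the diagonal, \<open>t\<close> would map \<open>std (rk a)\<close> into
  \<open>std (rk a - 1)\<close> and lower its dimension.\<close>

lemma upper_diag_nonzero:
  assumes "upper t" "det t \<noteq> 0"
  shows "t $ a $ a \<noteq> 0"
proof
  assume "t $ a $ a = 0"
  have "(*v) t ` std (rk a) \<subseteq> std (rk a - 1)"
  proof (rule image_subsetI)
    fix x :: "(complex, 'a) vec" assume x: "x \<in> std (rk a)"
    have *: "t $ b $ j * x $ j = 0" if "rk a - 1 < rk b" for b j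
    proof -
      have "a \<le> b"
        using that by (simp flip: rk_le_iff)
      then consider "j < b" | "b = j" "j = a" | "a < j"
        by fastforce
      then show ?thesis
        using assms(1) x \<open>t $ a $ a = 0\<close> by cases (auto simp: upper_def std_def rk_less_iff)
    qed
    then show "t *v x \<in> std (rk a - 1)"
      unfolding std_def matrix_vector_mult_def by (auto intro!: sum.neutral *)
  qed
  then have "vec.dim (std (rk a) :: ((complex, 'a) vec) set) \<le> vec.dim (std (rk a - 1) :: ((complex, 'a) vec) set)"
    by (simp only: upper_image_std[OF assms] vec.dim_subset)
  then show False
    using rk_pos[of a] rk_le[of a] by (simp add: dim_std)
qed

section \<open>Topology of the flag manifold\<close>

lemma continuous_on_det [continuous_intros]:
  fixes f :: "'a::topological_space \<Rightarrow> 'n::finite cmat"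
  shows "continuous_on S f \<Longrightarrow> continuous_on S (\<lambda>x. det (f x))"
  unfolding det_def by (intro continuous_intros)

lemma continuous_on_matrix_mult [continuous_intros]:
  fixes f g :: "'a::topological_space \<Rightarrow> 'n::finite cmat"
  shows "continuous_on S f \<Longrightarrow> continuous_on S g \<Longrightarrow> continuous_on S (\<lambda>x. f x ** g x)"
  unfolding matrix_matrix_mult_def by (intro continuous_intros)

lemma open_det_nonzero: "open {g :: 'n::finite cmat. det g \<noteq> 0}"
  by (intro open_Collect_neq continuous_intros)

text \<open>The invertible matrices, unlike those of determinant 1, are open in a vector space, as
  invariance of domain requires. The diagonal matrix \<open>d g\<close> rescales one column to reach
  determinant 1 and, being upper triangular, does not move the flag.\<close>

lemma openin_flag_topology_iff:
  fixes U :: "'n::{finite,linorder} flag set"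
  shows "openin flag_topology U \<longleftrightarrow> U \<subseteq> flags \<and> open {g. det g \<noteq> 0 \<and> flag_of g \<in> U}"
proof -
  let ?SL = "{g \<in> SL_C. act g (coordinate_flag id) \<in> U}"
  let ?GL = "{g. det g \<noteq> 0 \<and> flag_of g \<in> U}"
  have "open ?GL" if SL: "openin (top_of_set SL_C) ?SL"
  proof -
    obtain T where T: "open T" "?SL = SL_C \<inter> T"
      using SL unfolding openin_open by blast
    define a :: 'n where "a = undefined"
    define d where "d g = (\<chi> i j. if i = j then if i = a then 1 / det g else 1 else 0 :: 'n cmat)" for g :: "'n cmat"
    have det_d: "det (d g) = 1 / det g" for g
    proof -
      have "det (d g) = (\<Prod>i\<in>UNIV. if i = a then 1 / det g else 1)"
        by (subst det_diagonal) (auto simp: d_def)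
      then show ?thesis
        by simp
    qed
    have "flag_of (g ** d g) = flag_of g" if "det g \<noteq> 0" for g
      by (rule flag_of_mult_upper) (use that in \<open>auto simp: upper_def det_d\<close>, simp add: d_def)
    moreover have "g ** d g \<in> SL_C" if "det g \<noteq> 0" for g
      using that by (simp add: SL_C_def det_mul det_d)
    moreover have "act h (coordinate_flag id) \<in> U \<longleftrightarrow> h \<in> T" if "h \<in> SL_C" for h
      using T(2) that by blast
    ultimately have "flag_of g \<in> U \<longleftrightarrow> g ** d g \<in> T" if "det g \<noteq> 0" for g
      using that unfolding flag_of_def by metis
    then have "?GL = {g. det g \<noteq> 0} \<inter> (\<lambda>g. g ** d g) -` T"
      by auto
    moreover have "continuous_on {g. det g \<noteq> 0} (\<lambda>g. g ** d g)"
      unfolding d_def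
    proof (intro continuous_on_matrix_mult continuous_on_id continuous_on_vec_lambda)
      fix i j :: 'n
      show "continuous_on {g. det g \<noteq> 0}
          (\<lambda>g :: 'n cmat. if i = j then if i = a then 1 / det g else 1 else 0)"
        by (cases "i = j"; cases "i = a") (auto intro!: continuous_intros)
    qed
    ultimately show ?thesis
      using continuous_open_preimage[OF _ open_det_nonzero T(1)] by simp
  qed
  moreover have "openin (top_of_set SL_C) ?SL" if "open ?GL"
  proof -
    have "?SL = SL_C \<inter> ?GL"
      by (auto simp: SL_C_def flag_of_def)
    then show ?thesis
      using that by (auto simp: openin_open)
  qed
  ultimately show ?thesis
    unfolding openin_flag_topology by blast
qed

lemma topspace_flag_topology [simp]: "topspace flag_topology = (flags :: 'a::{finite,linorder} flag set)"
proof -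
  have "{g. det g \<noteq> 0 \<and> flag_of g \<in> (flags :: 'a flag set)} = {g. det g \<noteq> 0}"
    using flag_of_in_flags by blast
  then have "openin flag_topology (flags :: 'a flag set)"
    by (simp only: openin_flag_topology_iff open_det_nonzero subset_refl simp_thms)
  moreover have "topspace flag_topology \<subseteq> (flags :: 'a flag set)"
    using openin_topspace[of flag_topology] unfolding openin_flag_topology_iff by blast
  ultimately show ?thesis
    by (simp add: openin_subset subset_antisym)
qed

section \<open>Charts by unipotent lower triangular matrices\<close>

definition strictly_lower :: "'n::{finite,linorder} cmat set" where
  "strictly_lower = {X. \<forall>i j. i \<le> j \<longrightarrow> X $ i $ j = 0}"

definition chart :: "'n::{finite,linorder} cmat \<Rightarrow> 'n cmat \<Rightarrow> 'n flag" where
  "chart g X = flag_of (g ** (mat 1 + X))"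

lemma det_unipotent: "X \<in> strictly_lower \<Longrightarrow> det (mat 1 + X) \<noteq> 0"
  by (rule det_lower_nonzero) (auto simp: strictly_lower_def mat_def)

lemma chart_in_flags: "det g \<noteq> 0 \<Longrightarrow> X \<in> strictly_lower \<Longrightarrow> chart g X \<in> flags"
  by (simp add: chart_def flag_of_in_flags det_mul det_unipotent)

text \<open>The leading block of \<open>mat 1 + X\<close> on the first \<open>k\<close> coordinates
  is again unipotent, hence invertible.\<close>

lemma unipotent_solve:
  assumes "X \<in> strictly_lower" "x \<in> std k" "\<And>a. rk a \<le> k \<Longrightarrow> ((mat 1 + X) *v x) $ a = 0"
  shows "x = 0"
proof -
  have "x $ a = 0" if "rk a \<le> k" for a
  proof (rule lower_solve[of "mat 1 + X"])
    fix b assume "b \<le> a"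
    then show "((mat 1 + X) *v x) $ b = 0"
      using assms(3)[of b] that by (metis order.trans rk_le_iff)
  qed (use assms(1) in \<open>auto simp: strictly_lower_def mat_def\<close>)
  then show ?thesis
    using assms(2) by (auto simp: vec_eq_iff std_def not_le[symmetric])
qed

lemma matrix_vector_mult_add_unit: "(mat 1 + X) *v x = x + X *v (x :: (complex, 'n::finite) vec)"
  by (simp add: matrix_vector_mult_add_rdistrib)

lemma mult_strictly_lower_axis:
  "(X :: 'n::{finite,linorder} cmat) \<in> strictly_lower \<Longrightarrow> a \<le> b \<Longrightarrow> (X *v axis b 1) $ a = 0"
  by (simp add: mult_axis_nth strictly_lower_def)

text \<open>Column \<open>b\<close> of \<open>mat 1 + Y\<close> is \<open>(mat 1 + X) *v x\<close>
  for some \<open>x\<close> in \<open>std (rk b)\<close>. On the first \<open>rk b\<close>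
  coordinates column \<open>b\<close> of either matrix agrees with \<open>axis b 1\<close>, so
  \<open>unipotent_solve\<close> applies to \<open>x - axis b 1\<close>.\<close>

lemma inj_on_chart:
  fixes g :: "'n::{finite,linorder} cmat"
  assumes "det g \<noteq> 0"
  shows "inj_on (chart g) strictly_lower"
proof (rule inj_onI)
  fix X Y assume X: "X \<in> strictly_lower" and Y: "Y \<in> strictly_lower" and eq: "chart g X = chart g Y"
  have "(mat 1 + Y) *v axis b 1 = (mat 1 + X) *v axis b 1" for b
  proof -
    have "(g ** (mat 1 + Y)) *v axis b 1 \<in> flag_of (g ** (mat 1 + Y)) (rk b)"
      unfolding flag_of_apply by (intro imageI axis_std) simp
    also have "\<dots> = flag_of (g ** (mat 1 + X)) (rk b)"
      using eq by (simp add: chart_def)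
    finally obtain x where x: "x \<in> std (rk b)"
      "(g ** (mat 1 + Y)) *v axis b 1 = (g ** (mat 1 + X)) *v x"
      by (auto simp: flag_of_apply)
    then have eq': "(mat 1 + Y) *v axis b 1 = (mat 1 + X) *v x"
      using inj_mult[OF assms] by (simp add: inj_eq flip: matrix_vector_mul_assoc)
    have "x - axis b 1 = 0"
    proof (rule unipotent_solve[OF X])
      show "x - axis b 1 \<in> std (rk b)"
        using x(1) by (intro vec.subspace_diff subspace_std axis_std) simp_all
      fix a :: 'n assume "rk a \<le> rk b"
      then have "(X *v axis b 1) $ a = 0" "(Y *v axis b 1) $ a = 0"
        using X Y by (simp_all add: mult_strictly_lower_axis rk_le_iff)
      then show "((mat 1 + X) *v (x - axis b 1)) $ a = 0"
        unfolding vec.diff eq'[symmetric] by (simp add: matrix_vector_mult_add_unit)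
    qed
    then show ?thesis
      using eq' by simp
  qed
  then have "(mat 1 + Y) $ i $ j = (mat 1 + X) $ i $ j" for i j
    by (metis mult_axis_nth)
  then show "X = Y"
    by (simp add: vec_eq_iff)
qed

text \<open>The diagonal belongs to \<open>upp\<close>, so one matrix \<open>A\<close> encodes a
  strictly lower and an upper triangular matrix at once, with the full matrix space as parameter
  space.\<close>

definition low :: "'n::{finite,linorder} cmat \<Rightarrow> 'n cmat" where
  "low A = (\<chi> i j. if j < i then A $ i $ j else 0)"

definition upp :: "'n::{finite,linorder} cmat \<Rightarrow> 'n cmat" where
  "upp A = (\<chi> i j. if i \<le> j then A $ i $ j else 0)"

lemma low_upp: "low A + upp A = A" "low A \<in> strictly_lower" "upper (upp A)"
  by (auto simp: low_def upp_def vec_eq_iff strictly_lower_def upper_def)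

lemma low_upp_add:
  assumes "X \<in> strictly_lower" "upper t"
  shows "low (X + t) = X" "upp (X + t) = t"
  using assms by (auto simp: low_def upp_def vec_eq_iff strictly_lower_def upper_def not_less)

lemma continuous_low [continuous_intros]:
  "continuous_on S f \<Longrightarrow> continuous_on S (\<lambda>x. low (f x))"
  unfolding low_def
proof (intro continuous_on_vec_lambda)
  fix i j assume "continuous_on S f"
  then show "continuous_on S (\<lambda>x. if j < i then f x $ i $ j else 0)"
    by (cases "j < i") (auto intro!: continuous_intros)
qed

lemma continuous_upp [continuous_intros]:
  "continuous_on S f \<Longrightarrow> continuous_on S (\<lambda>x. upp (f x))"
  unfolding upp_def
proof (intro continuous_on_vec_lambda)
  fix i j assume "continuous_on S f"
  then show "continuous_on S (\<lambda>x. if i \<le> j then f x $ i $ j else 0)"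
    by (cases "i \<le> j") (auto intro!: continuous_intros)
qed

text \<open>The map \<open>(X, t) \<mapsto> g (1 + X) t\<close> is defined on an open set of matrices of full dimension, so
  invariance of domain makes it open.\<close>

lemma openin_chart_image:
  fixes g :: "'n::{finite,linorder} cmat"
  assumes g: "det g \<noteq> 0" and Q: "openin (top_of_set strictly_lower) Q"
  shows "openin flag_topology (chart g ` Q)"
proof -
  have sub: "Q \<subseteq> strictly_lower"
    using openin_subset[OF Q] by simp
  obtain T where T: "open T" "Q = strictly_lower \<inter> T"
    using Q by (auto simp: openin_open)
  define F where "F A = g ** (mat 1 + low A) ** upp A" for A
  define W where "W = {A. (\<forall>i. A $ i $ i \<noteq> 0) \<and> low A \<in> Q}"
  have "W = (\<Inter>i. {A. A $ i $ i \<noteq> 0}) \<inter> low -` T"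
    using T(2) low_upp by (auto simp: W_def)
  moreover have "open (\<Inter>i :: 'n. {A :: 'n cmat. A $ i $ i \<noteq> 0})"
    by (intro open_INT ballI open_Collect_neq continuous_intros) auto
  moreover have "open (low -` T)"
    by (rule open_vimage[OF T(1) continuous_low[OF continuous_on_id]])
  ultimately have "open W"
    by auto
  have upp: "det (upp A) \<noteq> 0" if "A \<in> W" for A
    by (rule det_upper_nonzero) (use that low_upp in \<open>auto simp: W_def upp_def\<close>)
  have FW: "det (F A) \<noteq> 0" "flag_of (F A) = chart g (low A)" if "A \<in> W" for A
    using g det_unipotent[OF low_upp(2)[of A]] upp[OF that] flag_of_mult_upper[OF low_upp(3)[of A]]
    by (simp_all add: F_def det_mul chart_def)
  have "inj_on F W"
  proof (rule inj_onI)
    fix A B assume A: "A \<in> W" and B: "B \<in> W" and eq: "F A = F B"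
    then have "chart g (low A) = chart g (low B)"
      using FW by metis
    then have l: "low A = low B"
      using inj_on_chart[OF g] low_upp(2) by (auto dest: inj_onD)
    have "det (g ** (mat 1 + low A)) \<noteq> 0"
      using g det_unipotent[OF low_upp(2)] by (simp add: det_mul)
    then obtain h where "h ** (g ** (mat 1 + low A)) = mat 1"
      by (auto simp flip: invertible_det_nz simp: invertible_def)
    then have "upp A = upp B"
      using eq unfolding F_def l by (metis matrix_mul_assoc matrix_mul_lid)
    then show "A = B"
      using l low_upp(1) by metis
  qed
  moreover have "continuous_on W F"
    unfolding F_def by (intro continuous_intros)
  ultimately have "open (F ` W)"
    using \<open>open W\<close> by (intro invariance_of_domain)
  \<comment> \<open>The fibres of \<open>flag_of\<close> are cosets of upper triangular matrices, so
    the image of \<open>F\<close> is the entire preimage of the chart image.\<close>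
  moreover have "F ` W = {h. det h \<noteq> 0 \<and> flag_of h \<in> chart g ` Q}"
  proof (intro Set.set_eqI iffI)
    fix h assume "h \<in> F ` W"
    then show "h \<in> {h. det h \<noteq> 0 \<and> flag_of h \<in> chart g ` Q}"
      using FW by (auto simp: W_def)
  next
    fix h assume "h \<in> {h. det h \<noteq> 0 \<and> flag_of h \<in> chart g ` Q}"
    then obtain X where h: "det h \<noteq> 0" "X \<in> Q" "flag_of (g ** (mat 1 + X)) = flag_of h"
      by (auto simp: chart_def)
    have X: "X \<in> strictly_lower"
      using sub h(2) by blast
    obtain t where t: "upper t" "det t \<noteq> 0" "h = g ** (mat 1 + X) ** t"
      using flag_of_eq_imp_upper[OF _ h(1,3)] g det_unipotent[OF X] by (auto simp: det_mul)
    have "X + t \<in> W"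
      using upper_diag_nonzero[OF t(1,2)] X h(2)
      by (auto simp: W_def low_upp_add[OF X t(1)] strictly_lower_def)
    moreover have "F (X + t) = h"
      by (simp add: F_def low_upp_add[OF X t(1)] t(3))
    ultimately show "h \<in> F ` W"
      by blast
  qed
  ultimately show ?thesis
    using chart_in_flags[OF g] sub by (auto simp: openin_flag_topology_iff)
qed

lemma continuous_map_chart:
  assumes g: "det g \<noteq> 0"
  shows "continuous_map (top_of_set strictly_lower) flag_topology (chart g)"
  unfolding continuous_map_def
proof (intro conjI allI impI)
  show "chart g \<in> topspace (top_of_set strictly_lower) \<rightarrow> topspace flag_topology"
    using chart_in_flags[OF g] by simp
  fix U :: "'a flag set" assume "openin flag_topology U"
  then have "open {h. det h \<noteq> 0 \<and> flag_of h \<in> U}"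
    by (simp add: openin_flag_topology_iff)
  moreover have "continuous_on UNIV (\<lambda>X. g ** (mat 1 + X))"
    by (intro continuous_intros)
  ultimately have "open ((\<lambda>X. g ** (mat 1 + X)) -` {h. det h \<noteq> 0 \<and> flag_of h \<in> U})"
    using open_vimage by blast
  moreover have "{X \<in> topspace (top_of_set strictly_lower). chart g X \<in> U} =
      strictly_lower \<inter> (\<lambda>X. g ** (mat 1 + X)) -` {h. det h \<noteq> 0 \<and> flag_of h \<in> U}"
    using g det_unipotent by (auto simp: chart_def det_mul)
  ultimately show "openin (top_of_set strictly_lower)
      {X \<in> topspace (top_of_set strictly_lower). chart g X \<in> U}"
    by (auto simp: openin_open)
qed

lemma embedding_map_chart:
  assumes g: "det g \<noteq> 0"
  shows "embedding_map (top_of_set strictly_lower) flag_topology (chart g)"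
  by (rule injective_open_imp_embedding_map)
    (use continuous_map_chart[OF g] openin_chart_image[OF g] inj_on_chart[OF g] in \<open>auto simp: open_map_def\<close>)

section \<open>Dimension\<close>

text \<open>If \<open>n < m\<close>, coordinate \<open>n\<close>, counted from 0, moves freely
  inside an open set of \<open>Euclidean_space m\<close>, but it is frozen at 0 on
  \<open>Euclidean_space n\<close>.\<close>

lemma openin_Euclidean_space_le:
  assumes Q: "openin (Euclidean_space m) Q" "Q \<noteq> {}" "Q \<subseteq> topspace (Euclidean_space n)"
  shows "m \<le> n"
proof (rule ccontr)
  assume "\<not> m \<le> n"
  obtain x where x: "x \<in> Q"
    using Q(2) by blast
  then have x0: "x i = 0" if "n \<le> i" for i
    using Q(3) that by (auto simp: topspace_Euclidean_space)
  define f where "f t = x(n := t)" for t :: real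
  have "continuous_map euclideanreal (Euclidean_space m) f"
    unfolding Euclidean_space_def continuous_map_in_subtopology continuous_map_componentwise_UNIV
  proof (intro conjI allI)
    show "continuous_map euclideanreal euclideanreal (\<lambda>t. f t i)" for i
      by (cases "i = n") (simp_all add: f_def)
    show "f \<in> topspace euclideanreal \<rightarrow> {y. \<forall>i\<ge>m. y i = 0}"
      using x0 \<open>\<not> m \<le> n\<close> by (auto simp: f_def)
  qed
  then have "openin euclideanreal {t \<in> topspace euclideanreal. f t \<in> Q}"
    using Q(1) by (rule openin_continuous_map_preimage)
  moreover have "{t \<in> topspace euclideanreal. f t \<in> Q} = {0}"
  proof -
    have "f 0 = x"
      using x0[of n] by (auto simp: f_def)
    moreover have "t = 0" if "f t \<in> Q" for t
      using that Q(3) by (auto simp: topspace_Euclidean_space f_def dest!: subsetD spec[of _ n])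
    ultimately show ?thesis
      using x by auto
  qed
  ultimately show False
    by (simp add: not_open_singleton)
qed

text \<open>The smaller Euclidean space is a coordinate subspace of the larger one. If the
  dimensions differed, invariance of domain would produce a nonempty open set of the larger space
  inside the smaller one.\<close>

lemma open_Euclidean_space_dimension:
  assumes Q: "openin (Euclidean_space m) Q" "Q \<noteq> {}"
    and hom: "subtopology (Euclidean_space m) Q homeomorphic_space Euclidean_space n"
  shows "m = n"
proof -
  obtain f g where fg: "homeomorphic_maps (subtopology (Euclidean_space m) Q) (Euclidean_space n) f g"
    using hom by (auto simp: homeomorphic_space_def)
  have Qs: "Q \<subseteq> topspace (Euclidean_space m)"
    using Q(1) by (rule openin_subset)
  then have top: "topspace (subtopology (Euclidean_space m) Q) = Q"
    by (simp add: inf.absorb2)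
  have sub: "Euclidean_space i = subtopology (Euclidean_space j) (topspace (Euclidean_space i))" if "i \<le> j" for i j
    using that by (auto simp: Euclidean_space_def subtopology_subtopology intro!: arg_cong[where f = "subtopology _"])
  have hf: "homeomorphic_map (subtopology (Euclidean_space m) Q) (Euclidean_space n) f"
    and hg: "homeomorphic_map (Euclidean_space n) (subtopology (Euclidean_space m) Q) g"
    using fg homeomorphic_maps_map by blast+
  have f: "f ` Q = topspace (Euclidean_space n)" and g: "g ` topspace (Euclidean_space n) = Q"
    using homeomorphic_imp_surjective_map[OF hf] homeomorphic_imp_surjective_map[OF hg] unfolding top .
  have inj: "inj_on f Q" "inj_on g (topspace (Euclidean_space n))"
    using homeomorphic_imp_injective_map[OF hf] homeomorphic_imp_injective_map[OF hg] unfolding top .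
  consider "n < m" | "m < n" | "m = n" by linarith
  then show ?thesis
  proof cases
    case 1
    have "continuous_map (subtopology (Euclidean_space m) Q) (Euclidean_space m) f"
      using fg sub[of n m] 1 unfolding homeomorphic_maps_def
      by (metis continuous_map_into_fulltopology less_imp_le)
    then have "openin (Euclidean_space m) (topspace (Euclidean_space n))"
      using invariance_of_domain_Euclidean_space[OF Q(1) _ inj(1)] f by simp
    then show ?thesis
      using openin_Euclidean_space_le[of m _ n] Q(2) f 1 by (metis image_is_empty leD order_refl)
  next
    case 2
    have "continuous_map (Euclidean_space n) (Euclidean_space m) g"
      using fg unfolding homeomorphic_maps_def by (metis continuous_map_into_fulltopology)
    then have "continuous_map (subtopology (Euclidean_space n) (topspace (Euclidean_space n))) (Euclidean_space n) g"
      using sub[of m n] 2 by (metis continuous_map_into_fulltopology less_imp_le subtopology_topspace)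
    then have "openin (Euclidean_space n) Q"
      using invariance_of_domain_Euclidean_space[OF openin_topspace _ inj(2)] g by simp
    then show ?thesis
      using openin_Euclidean_space_le[of n Q m] Q(2) Qs 2 by simp
  qed
qed

text \<open>\<open>GREATEST\<close> needs a bound. Any open set modelled on a dimension
  \<open>e\<close> contains a piece modelled on \<open>d\<close>, and invariance of dimension forces
  \<open>e = d\<close>.\<close>

lemma complex_dimension_eqI:
  assumes ne: "topspace T \<noteq> {}"
    and loc: "\<And>U. openin T U \<Longrightarrow> U \<noteq> {} \<Longrightarrow>
      \<exists>W\<subseteq>U. openin T W \<and> W \<noteq> {} \<and> subtopology T W homeomorphic_space Euclidean_space (2 * d)"
  shows "complex_dimension T = d"
proof -
  let ?P = "\<lambda>e. \<exists>U. openin T U \<and> U \<noteq> {} \<and> subtopology T U homeomorphic_space Euclidean_space (2 * e)"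
  have uniq: "e = d" if Pe: "?P e" for e
  proof -
    obtain U where U: "openin T U" "U \<noteq> {}" "subtopology T U homeomorphic_space Euclidean_space (2 * e)"
      using Pe by blast
    obtain f where f: "homeomorphic_map (subtopology T U) (Euclidean_space (2 * e)) f"
      using U(3) homeomorphic_space by blast
    obtain W where W: "W \<subseteq> U" "openin T W" "W \<noteq> {}"
        "subtopology T W homeomorphic_space Euclidean_space (2 * d)"
      using loc[OF U(1,2)] by blast
    have top: "topspace (subtopology T U) = U"
      using openin_subset[OF U(1)] by (simp add: inf.absorb2)
    have "openin (subtopology T U) W"
      using W(1,2) by (simp add: openin_open_subtopology[OF U(1)])
    then have op: "openin (Euclidean_space (2 * e)) (f ` W)"
      using f W(1) by (metis homeomorphic_map_openness top)
    then have "f ` (topspace (subtopology T U) \<inter> W) = topspace (Euclidean_space (2 * e)) \<inter> f ` W"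
      using W(1) openin_subset[OF op] unfolding top by (simp add: inf.absorb2)
    then have "homeomorphic_map (subtopology (subtopology T U) W) (subtopology (Euclidean_space (2 * e)) (f ` W)) f"
      by (rule homeomorphic_map_subtopologies[OF f])
    then have "subtopology (Euclidean_space (2 * e)) (f ` W) homeomorphic_space subtopology T W"
      using W(1) by (metis homeomorphic_map_imp_homeomorphic_space homeomorphic_space_sym inf.absorb2 subtopology_subtopology)
    then have "subtopology (Euclidean_space (2 * e)) (f ` W) homeomorphic_space Euclidean_space (2 * d)"
      using W(4) homeomorphic_space_trans by blast
    then show ?thesis
      using open_Euclidean_space_dimension[OF op, of "2 * d"] W(3) by simp
  qed
  show ?thesis
    unfolding complex_dimension_def
  proof (rule Greatest_equality)
    show "?P d"
      using loc[OF openin_topspace ne] by blast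
    fix e assume "?P e"
    then show "e \<le> d"
      using uniq by blast
  qed
qed

lemma homeomorphic_subspace_Euclidean_space:
  fixes S :: "'b::euclidean_space set"
  assumes "subspace S"
  shows "top_of_set S homeomorphic_space Euclidean_space (dim S)"
proof -
  obtain B where B: "B \<subseteq> S" "pairwise orthogonal B" "\<And>x. x \<in> B \<Longrightarrow> norm x = 1"
    "independent B" "card B = dim S" "span B = S"
    using orthonormal_basis_subspace[OF assms] by metis
  obtain f g where "homeomorphic_maps (Euclidean_space (dim S)) (top_of_set (span B)) f g"
    using homeomorphic_maps_Euclidean_space_euclidean_gen[OF B(4,2,5,3)] by metis
  then show ?thesis
    using B(6) homeomorphic_space_def homeomorphic_space_sym by blast
qed

lemma subspace_Int_ball_homeomorphic:
  fixes S :: "'b::euclidean_space set"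
  assumes "subspace S" "x \<in> S" "0 < e"
  shows "top_of_set (S \<inter> ball x e) homeomorphic_space top_of_set S"
proof -
  \<comment> \<open>Radial compression: the norm \<open>r\<close> becomes
    \<open>e * r / (1 + r)\<close>, with inverse \<open>r / (e - r)\<close>.\<close>
  define f where "f y = x + (e / (1 + norm y)) *\<^sub>R y" for y
  define g where "g z = (1 / (e - norm (z - x))) *\<^sub>R (z - x)" for z
  have pos: "0 < 1 + norm y" for y :: 'b
    by (rule add_pos_nonneg) auto
  have nf: "norm (f y - x) = e * norm y / (1 + norm y)" for y
    using assms(3) pos[of y] by (simp add: f_def)
  have fS: "f y \<in> S \<inter> ball x e" if "y \<in> S" for y
  proof -
    have "norm (f y - x) < e"
      unfolding nf using assms(3) pos[of y] by (simp add: pos_divide_less_eq)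
    then show ?thesis
      using assms that by (simp add: f_def subspace_add subspace_scale dist_norm norm_minus_commute)
  qed
  have gS: "g z \<in> S" if "z \<in> S" for z
    using assms that by (simp add: g_def subspace_diff subspace_scale)
  have gf: "g (f y) = y" for y
  proof -
    have "e - norm (f y - x) = e / (1 + norm y)"
      unfolding nf using pos[of y] by (simp add: field_simps)
    then show ?thesis
      using assms(3) pos[of y] by (simp add: g_def) (simp add: f_def)
  qed
  have fg: "f (g z) = z" if "z \<in> ball x e" for z
  proof -
    have d: "0 < e - norm (z - x)"
      using that by (simp add: dist_norm norm_minus_commute)
    then have "norm (g z) = norm (z - x) / (e - norm (z - x))"
      by (simp add: g_def)
    then have "1 + norm (g z) = e / (e - norm (z - x))"
      using d by (simp add: field_simps)
    then have "e / (1 + norm (g z)) = e - norm (z - x)"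
      using d assms(3) by simp
    then have "f (g z) = x + (e - norm (z - x)) *\<^sub>R g z"
      by (simp only: f_def)
    then show ?thesis
      using d by (simp add: g_def)
  qed
  have "continuous_on S f"
    unfolding f_def using pos by (intro continuous_intros) (metis less_irrefl)
  moreover have "continuous_on (S \<inter> ball x e) g"
    unfolding g_def by (intro continuous_intros) (auto simp: dist_norm norm_minus_commute)
  ultimately have "homeomorphic_maps (top_of_set S) (top_of_set (S \<inter> ball x e)) f g"
    using fS gS fg gf unfolding homeomorphic_maps_def by auto
  then show ?thesis
    using homeomorphic_space_def homeomorphic_space_sym by blast
qed

text \<open>A relatively open part of a subspace contains a relative ball around each of its points,
  and such a ball is homeomorphic to the whole subspace. Since the ball is chosen inside the image
  of \<open>U \<inter> N\<close>, the chart domain \<open>N\<close> may stick out of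
  \<open>U\<close>.\<close>

lemma complex_dimension_chartsI:
  fixes T :: "'a topology" and d :: nat
  assumes ne: "topspace T \<noteq> {}"
    and loc: "\<And>U. openin T U \<Longrightarrow> U \<noteq> {} \<Longrightarrow>
      \<exists>N (S :: 'b::euclidean_space set) W h. openin T N \<and> U \<inter> N \<noteq> {} \<and> subspace S \<and> dim S = 2 * d \<and>
        openin (top_of_set S) W \<and> homeomorphic_map (subtopology T N) (top_of_set W) h"
  shows "complex_dimension T = d"
proof (rule complex_dimension_eqI[OF ne])
  fix U assume U: "openin T U" "U \<noteq> {}"
  obtain N W h and S :: "'b set" where N: "openin T N" "U \<inter> N \<noteq> {}" and S: "subspace S" "dim S = 2 * d"
    and W: "openin (top_of_set S) W" and h: "homeomorphic_map (subtopology T N) (top_of_set W) h"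
    using loc[OF U] by blast
  have topN: "topspace (subtopology T N) = N"
    using openin_subset[OF N(1)] by (simp add: inf.absorb2)
  have "openin (subtopology T N) (U \<inter> N)"
    using U(1) N(1) by (simp add: openin_open_subtopology[OF N(1)] openin_Int)
  then have "openin (top_of_set W) (h ` (U \<inter> N))"
    using h by (metis homeomorphic_map_openness inf_le2 topN)
  then have "openin (top_of_set S) (h ` (U \<inter> N))"
    using W openin_trans by blast
  then obtain P where P: "open P" "h ` (U \<inter> N) = S \<inter> P"
    by (auto simp: openin_open)
  obtain p where p: "p \<in> U \<inter> N"
    using N(2) by blast
  then have "h p \<in> S \<inter> P"
    using P(2) by blast
  then obtain e where e: "0 < e" "ball (h p) e \<subseteq> P"
    using P(1) open_contains_ball by blast
  let ?B = "S \<inter> ball (h p) e"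
  have B: "?B \<subseteq> h ` (U \<inter> N)"
    using e(2) P(2) by blast
  have BW: "?B \<subseteq> W"
    using B \<open>openin (top_of_set W) (h ` (U \<inter> N))\<close>[THEN openin_subset] by auto
  define V where "V = {v \<in> N. h v \<in> ?B}"
  have hV: "h ` V = ?B"
    using B by (auto simp: V_def)
  have inj: "inj_on h N"
    using homeomorphic_imp_injective_map[OF h] unfolding topN .
  have VU: "V \<subseteq> U"
  proof
    fix v assume "v \<in> V"
    then obtain u where "u \<in> U \<inter> N" "h v = h u" "v \<in> N"
      using B by (auto simp: V_def)
    then show "v \<in> U"
      using inj by (auto dest: inj_onD)
  qed
  have "openin (top_of_set W) (h ` V)"
    unfolding hV using BW by (intro openin_subset_trans[of S ?B W]) (auto simp: openin_open openin_imp_subset[OF W])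
  then have "openin (subtopology T N) V"
    using homeomorphic_map_openness[OF h, of V] topN by (auto simp: V_def)
  then have oV: "openin T V"
    using openin_trans_full N(1) by blast
  have "homeomorphic_map (subtopology (subtopology T N) V) (subtopology (top_of_set W) ?B) h"
    by (rule homeomorphic_map_subtopologies[OF h]) (use hV BW topN in \<open>auto simp: V_def\<close>)
  then have "subtopology (subtopology T N) V homeomorphic_space subtopology (top_of_set W) ?B"
    by (rule homeomorphic_map_imp_homeomorphic_space)
  moreover have "subtopology (subtopology T N) V = subtopology T V"
    by (simp add: subtopology_subtopology V_def inf_absorb2 Collect_restrict)
  moreover have "subtopology (top_of_set W) ?B = top_of_set ?B"
    using BW by (simp add: subtopology_subtopology inf.absorb2)
  ultimately have "subtopology T V homeomorphic_space top_of_set ?B"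
    by simp
  also have "top_of_set ?B homeomorphic_space top_of_set S"
    using \<open>h p \<in> S \<inter> P\<close> by (intro subspace_Int_ball_homeomorphic S(1) e(1)) auto
  also have "top_of_set S homeomorphic_space Euclidean_space (2 * d)"
    using homeomorphic_subspace_Euclidean_space[OF S(1)] S(2) by simp
  finally have "subtopology T V homeomorphic_space Euclidean_space (2 * d)" .
  moreover have "V \<noteq> {}"
    using \<open>h p \<in> S \<inter> P\<close> e(1) p by (auto simp: V_def)
  ultimately show "\<exists>V\<subseteq>U. openin T V \<and> V \<noteq> {} \<and> subtopology T V homeomorphic_space Euclidean_space (2 * d)"
    using VU oV by blast
qed

section \<open>Coordinate subspaces of matrices and dimension in charts\<close>

definition coord_space :: "('n \<times> 'n) set \<Rightarrow> 'n::finite cmat set" where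
  "coord_space P = {X. \<forall>i j. (i, j) \<notin> P \<longrightarrow> X $ i $ j = 0}"

lemma subspace_coord_space: "subspace (coord_space P)"
  by (auto simp: coord_space_def subspace_def)

text \<open>\<open>dim\<close> is the real dimension: each free complex entry contributes the basis
  elements for \<open>1\<close> and \<open>\<i>\<close>.\<close>

lemma dim_coord_space: "dim (coord_space P :: 'n::finite cmat set) = 2 * card P"
proof -
  define f :: "('n \<times> 'n) \<times> complex \<Rightarrow> 'n cmat" where "f = (\<lambda>((i, j), u). axis i (axis j u))"
  let ?d = "f ` (P \<times> {1, \<i>})"
  have inj: "inj_on f (P \<times> {1, \<i>})"
    by (auto simp: inj_on_def f_def axis_eq_axis)
  have "coord_space P = {X. \<forall>b\<in>Basis. b \<notin> ?d \<longrightarrow> X \<bullet> b = 0}"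
  proof (intro Set.set_eqI iffI)
    fix X :: "'n cmat" assume X: "X \<in> coord_space P"
    have "X \<bullet> axis i (axis j u) = 0" if "axis i (axis j u) \<notin> ?d" "u \<in> {1, \<i>}" for i j u
    proof -
      have "(i, j) \<notin> P"
        using that by (auto simp: f_def image_iff)
      then show ?thesis
        using X by (simp add: coord_space_def inner_axis)
    qed
    then show "X \<in> {X. \<forall>b\<in>Basis. b \<notin> ?d \<longrightarrow> X \<bullet> b = 0}"
      by (auto simp: Basis_vec_def Basis_complex_def)
  next
    fix X :: "'n cmat" assume X: "X \<in> {X. \<forall>b\<in>Basis. b \<notin> ?d \<longrightarrow> X \<bullet> b = 0}"
    show "X \<in> coord_space P"
      unfolding coord_space_def
    proof (intro CollectI allI impI)
      fix i j assume ij: "(i, j) \<notin> P"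
      have "X \<bullet> axis i (axis j u) = 0" if u: "u \<in> {1, \<i>}" for u
      proof -
        have "axis i (axis j u) \<in> (Basis :: 'n cmat set)"
          using u by (auto simp: Basis_vec_def Basis_complex_def)
        moreover have "axis i (axis j u) \<notin> ?d"
          using ij u by (auto simp: f_def axis_eq_axis)
        ultimately show ?thesis
          using X by blast
      qed
      from this[of 1] this[of \<i>] show "X $ i $ j = 0"
        by (simp add: inner_axis complex_eq_iff inner_complex_def)
    qed
  qed
  moreover have "?d \<subseteq> Basis"
    by (auto simp: f_def Basis_vec_def Basis_complex_def)
  ultimately have "dim (coord_space P :: 'n cmat set) = card ?d"
    using dim_substandard[of ?d] by simp
  also have "\<dots> = card P * card {1, \<i>}"
    using inj by (simp only: card_image card_cartesian_product)
  finally show ?thesis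
    by simp
qed

lemma strictly_lower_eq: "strictly_lower = coord_space {(i, j). j < i}"
  by (auto simp: strictly_lower_def coord_space_def not_less)

text \<open>A chart is requested only around some point of \<open>U \<inter> X\<close>, so a dense
  set of well-behaved points is enough. For a Schubert variety these are the points of the
  cell.\<close>

lemma flag_dim_eqI:
  fixes X :: "'n::{finite,linorder} flag set"
  assumes sub: "X \<subseteq> flags" and ne: "X \<noteq> {}"
    and loc: "\<And>U. openin flag_topology U \<Longrightarrow> U \<inter> X \<noteq> {} \<Longrightarrow>
      \<exists>g (S :: 'n cmat set) W f. det g \<noteq> 0 \<and> U \<inter> X \<inter> chart g ` strictly_lower \<noteq> {} \<and>
        subspace S \<and> dim S = 2 * d \<and> openin (top_of_set S) W \<and>
        homeomorphic_map (top_of_set {Y \<in> strictly_lower. chart g Y \<in> X}) (top_of_set W) f"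
  shows "flag_dim X = d"
  unfolding flag_dim_def
proof (rule complex_dimension_chartsI[where 'b = "'n cmat"])
  show "topspace (subtopology flag_topology X) \<noteq> {}"
    using sub ne by auto
  fix U assume "openin (subtopology flag_topology X) U" "U \<noteq> {}"
  then obtain U' where U': "openin flag_topology U'" "U = U' \<inter> X"
    by (auto simp: openin_subtopology)
  then obtain g W f and S :: "'n cmat set" where g: "det g \<noteq> 0" "U' \<inter> X \<inter> chart g ` strictly_lower \<noteq> {}"
    and S: "subspace S" "dim S = 2 * d" and W: "openin (top_of_set S) W"
    and f: "homeomorphic_map (top_of_set {Y \<in> strictly_lower. chart g Y \<in> X}) (top_of_set W) f"
    using loc[OF U'(1)] \<open>U \<noteq> {}\<close> by blast
  let ?C = "chart g ` strictly_lower" and ?A = "{Y \<in> strictly_lower. chart g Y \<in> X}"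
  have C: "openin flag_topology ?C"
    by (rule openin_chart_image[OF g(1)]) simp
  have "homeomorphic_map (top_of_set strictly_lower) (subtopology flag_topology ?C) (chart g)"
    using embedding_map_chart[OF g(1)] by (simp add: embedding_map_def)
  then have "homeomorphic_map (subtopology (top_of_set strictly_lower) ?A)
      (subtopology (subtopology flag_topology ?C) X) (chart g)"
    by (rule homeomorphic_map_subtopologies) (use sub in auto)
  moreover have "subtopology (top_of_set strictly_lower) ?A = top_of_set ?A"
    by (simp add: subtopology_subtopology inf.absorb2 Collect_restrict)
  moreover have "subtopology (subtopology flag_topology ?C) X = subtopology (subtopology flag_topology X) (X \<inter> ?C)"
    by (simp add: subtopology_subtopology inf_commute)
  ultimately have "homeomorphic_map (top_of_set ?A) (subtopology (subtopology flag_topology X) (X \<inter> ?C)) (chart g)"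
    by simp
  then have "subtopology (subtopology flag_topology X) (X \<inter> ?C) homeomorphic_space top_of_set ?A"
    using homeomorphic_map_imp_homeomorphic_space homeomorphic_space_sym by blast
  also have "top_of_set ?A homeomorphic_space top_of_set W"
    using f by (rule homeomorphic_map_imp_homeomorphic_space)
  finally obtain h where "homeomorphic_map (subtopology (subtopology flag_topology X) (X \<inter> ?C)) (top_of_set W) h"
    using homeomorphic_space by blast
  moreover have "openin (subtopology flag_topology X) (X \<inter> ?C)"
    using C by (auto simp: openin_subtopology)
  moreover have "U \<inter> (X \<inter> ?C) \<noteq> {}"
    using g(2) U'(2) by blast
  ultimately show "\<exists>N (S :: 'n cmat set) W h. openin (subtopology flag_topology X) N \<and> U \<inter> N \<noteq> {} \<and>
      subspace S \<and> dim S = 2 * d \<and> openin (top_of_set S) W \<and>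
      homeomorphic_map (subtopology (subtopology flag_topology X) N) (top_of_set W) h"
    using S W by blast
qed

lemma chart_zero [simp]: "chart g 0 = flag_of g"
  by (simp add: chart_def)

lemma zero_strictly_lower [simp]: "0 \<in> strictly_lower"
  by (simp add: strictly_lower_def)

lemma flags_nonempty: "(flags :: 'n::{finite,linorder} flag set) \<noteq> {}"
  using flag_of_in_flags[of "mat 1 :: 'n cmat"] by auto

lemma flag_dim_flags:
  "flag_dim (flags :: 'n::{finite,linorder} flag set) = card {(i, j). j < (i :: 'n)}"
proof (rule flag_dim_eqI)
  fix U :: "'n flag set" assume "U \<inter> flags \<noteq> {}"
  then obtain g where g: "det g \<noteq> 0" "flag_of g \<in> U"
    by (auto elim: flag_obtain)
  have "{Y \<in> strictly_lower. chart g Y \<in> flags} = strictly_lower"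
    using chart_in_flags[OF g(1)] by blast
  then have "homeomorphic_map (top_of_set {Y \<in> strictly_lower. chart g Y \<in> flags}) (top_of_set strictly_lower) id"
    by simp
  moreover have "flag_of g \<in> U \<inter> flags \<inter> chart g ` strictly_lower"
    using g flag_of_in_flags by (auto intro: image_eqI[of _ _ 0])
  moreover have "subspace (strictly_lower :: 'n cmat set)"
    unfolding strictly_lower_eq by (rule subspace_coord_space)
  moreover have "dim (strictly_lower :: 'n cmat set) = 2 * card {(i, j). j < (i :: 'n)}"
    unfolding strictly_lower_eq by (rule dim_coord_space)
  moreover have "openin (top_of_set strictly_lower) (strictly_lower :: 'n cmat set)"
    by (rule openin_subtopology_self)
  ultimately show "\<exists>g (S :: 'n cmat set) W f. det g \<noteq> 0 \<and> U \<inter> flags \<inter> chart g ` strictly_lower \<noteq> {} \<and>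
        subspace S \<and> dim S = 2 * card {(i, j). j < (i :: 'n)} \<and> openin (top_of_set S) W \<and>
        homeomorphic_map (top_of_set {Y \<in> strictly_lower. chart g Y \<in> flags}) (top_of_set W) f"
    using g(1) by blast
qed (auto simp: flags_nonempty)

section \<open>Schubert varieties\<close>

definition pos_perm :: "(nat \<Rightarrow> nat) \<Rightarrow> 'n \<Rightarrow> 'n::{finite,linorder}" where
  "pos_perm w a = unrk (w (rk a))"

definition perm_mat :: "(nat \<Rightarrow> nat) \<Rightarrow> 'n::{finite,linorder} cmat" where
  "perm_mat w = (\<chi> i j. if i = pos_perm w j then 1 else 0)"

lemma rk_pos_perm:
  assumes "w permutes {1..CARD('n)}"
  shows "rk (pos_perm w (a :: 'n::{finite,linorder})) = w (rk a)"
  unfolding pos_perm_def using permutes_in_image[OF assms, of "rk a"] rk_pos[of a] rk_le[of a]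
  by (intro rk_unrk) auto

lemma bij_pos_perm:
  assumes "w permutes {1..CARD('n)}"
  shows "bij (pos_perm w :: 'n::{finite,linorder} \<Rightarrow> 'n)"
proof -
  have "inj (pos_perm w :: 'n \<Rightarrow> 'n)"
  proof (rule injI)
    fix a b :: 'n assume "pos_perm w a = pos_perm w b"
    then have "w (rk a) = w (rk b)"
      by (metis rk_pos_perm[OF assms])
    then show "a = b"
      using permutes_inj[OF assms] by (simp add: inj_eq)
  qed
  then show ?thesis
    by (simp add: bij_def finite_UNIV_inj_surj)
qed

lemma perm_mat_nth:
  assumes "w permutes {1..CARD('n)}"
  shows "(perm_mat w *v x) $ pos_perm w (a :: 'n::{finite,linorder}) = x $ a"
  using bij_is_inj[OF bij_pos_perm[OF assms]]
  by (simp add: perm_mat_def matrix_vector_mult_def inj_eq if_distrib[of "\<lambda>c. c * _"] cong: if_cong)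

lemma det_perm_mat:
  assumes "w permutes {1..CARD('n)}"
  shows "det (perm_mat w :: 'n::{finite,linorder} cmat) \<noteq> 0"
proof -
  have "x = 0" if "(perm_mat w :: 'n cmat) *v x = 0" for x
    using perm_mat_nth[OF assms, of x] that by (simp add: vec_eq_iff)
  then show ?thesis
    using matrix_left_invertible_ker[of "perm_mat w :: 'n cmat"] invertible_left_inverse[of "perm_mat w :: 'n cmat"]
    by (auto simp: invertible_det_nz)
qed

lemma perm_mat_std:
  assumes w: "w permutes {1..CARD('n)}"
  shows "(*v) (perm_mat w :: 'n::{finite,linorder} cmat) ` std k =
    {y. \<forall>a. a \<notin> pos_perm w ` {b. rk b \<le> k} \<longrightarrow> y $ a = 0}" (is "?L = ?R")
proof (intro Set.set_eqI iffI)
  fix y assume "y \<in> ?L"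
  then obtain x where x: "x \<in> std k" "y = perm_mat w *v x"
    by blast
  have "y $ a = 0" if "a \<notin> pos_perm w ` {b. rk b \<le> k}" for a
  proof -
    obtain b where "a = pos_perm w b"
      using bij_pos_perm[OF w] by (metis bij_pointE)
    then show ?thesis
      using that x perm_mat_nth[OF w, of x b] by (cases "rk b \<le> k") (auto simp: std_def)
  qed
  then show "y \<in> ?R"
    by blast
next
  fix y :: "(complex, 'n) vec" assume y: "y \<in> ?R"
  define x where "x = (\<chi> b :: 'n. y $ pos_perm w b)"
  have "perm_mat w *v x = y"
    unfolding vec_eq_iff
  proof
    fix a :: 'n
    obtain b where "a = pos_perm w b"
      using bij_pos_perm[OF w] by (metis bij_pointE)
    then show "(perm_mat w *v x) $ a = y $ a"
      using perm_mat_nth[OF w, of x b] by (simp add: x_def)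
  qed
  moreover have "x \<in> std k"
  proof -
    have "pos_perm w b \<notin> pos_perm w ` {b. rk b \<le> k}" if "k < rk b" for b :: 'n
      using that by (simp add: inj_image_mem_iff[OF bij_is_inj[OF bij_pos_perm[OF w]]])
    then show ?thesis
      using y by (auto simp: std_def x_def)
  qed
  ultimately show "y \<in> ?L"
    by blast
qed

lemma coordinate_flag_perm_mat:
  assumes w: "w permutes {1..CARD('n)}"
  shows "coordinate_flag w = flag_of (perm_mat w :: 'n::{finite,linorder} cmat)"
proof
  fix k
  have "(\<lambda>i. unrk (w i)) ` {1..min k CARD('n)} = pos_perm w ` {b :: 'n. rk b \<le> k}"
    unfolding rk_image[symmetric] image_image pos_perm_def ..
  then show "coordinate_flag w k = flag_of (perm_mat w :: 'n cmat) k"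
    by (simp only: coordinate_flag_eq[OF w] flag_of_apply perm_mat_std[OF w])
qed

lemma mat_commute: "mat c ** A = A ** (mat c :: 'n::finite cmat)"
  by (simp add: vec_eq_iff matrix_matrix_mult_def mat_def if_distrib[of "\<lambda>c. c * _"] if_distrib[of "\<lambda>c. _ * c"]
      mult.commute cong: if_cong)

lemma det_mat: "det (mat c :: 'n::finite cmat) = c ^ CARD('n)"
  by (subst det_diagonal) (auto simp: mat_def)

lemma upper_mat: "upper (mat c)"
  by (simp add: upper_def mat_def)

lemma complex_root_exists:
  assumes "z \<noteq> (0 :: complex)" "0 < n"
  shows "\<exists>c. c ^ n = z"
proof -
  have "exp (of_nat n * (Ln z / of_nat n)) = z"
    using assms by simp
  then show ?thesis
    by (metis exp_of_nat_mult)
qed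

lemma upper_mult: "upper s \<Longrightarrow> upper t \<Longrightarrow> upper (s ** t)"
  unfolding upper_iff_std by (simp add: image_subset_iff flip: matrix_vector_mul_assoc)

text \<open>Scalars fix every flag, so multiplication by an \<open>n\<close>-th root of
  \<open>1 / det b\<close> brings an invertible upper triangular \<open>b\<close> into
  \<open>Borel\<close>.\<close>

lemma schubert_cell_eq:
  assumes w: "w permutes {1..CARD('n)}"
  shows "schubert_cell w = {flag_of (b ** perm_mat w) |b :: 'n::{finite,linorder} cmat. upper b \<and> det b \<noteq> 0}"
proof (intro Set.set_eqI iffI)
  fix V assume "V \<in> (schubert_cell w :: 'n flag set)"
  then show "V \<in> {flag_of (b ** perm_mat w) |b. upper b \<and> det b \<noteq> 0}"
    by (auto simp: schubert_cell_def orbit_of_def Borel_def SL_C_def upper_def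
        coordinate_flag_perm_mat[OF w] act_flag_of)
next
  fix V assume "V \<in> {flag_of (b ** perm_mat w) |b :: 'n cmat. upper b \<and> det b \<noteq> 0}"
  then obtain b :: "'n cmat" where b: "upper b" "det b \<noteq> 0" "V = flag_of (b ** perm_mat w)"
    by blast
  obtain c where c: "c ^ CARD('n) = 1 / det b"
    using complex_root_exists[of "1 / det b" "CARD('n)"] b(2) by auto
  have "b ** mat c \<in> Borel"
    using upper_mult[OF b(1) upper_mat[of c]] b(2)
    by (auto simp: Borel_def SL_C_def det_mul det_mat c upper_def)
  moreover have "V = flag_of (b ** mat c ** perm_mat w)"
  proof -
    have "b ** mat c ** perm_mat w = b ** perm_mat w ** mat c"
      by (simp add: mat_commute flip: matrix_mul_assoc)
    moreover have "det (mat c :: 'n cmat) \<noteq> 0"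
      using b(2) by (simp add: det_mat c)
    ultimately show ?thesis
      using b(3) flag_of_mult_upper[OF upper_mat] by metis
  qed
  ultimately show "V \<in> schubert_cell w"
    by (auto simp: schubert_cell_def orbit_of_def coordinate_flag_perm_mat[OF w] act_flag_of)
qed

lemma schubert_cell_subset_flags:
  assumes w: "w permutes {1..CARD('n)}"
  shows "schubert_cell w \<subseteq> (flags :: 'n::{finite,linorder} flag set)"
  using det_perm_mat[OF w] by (auto simp: schubert_cell_eq[OF w] det_mul intro: flag_of_in_flags)

lemma schubert_variety_subset_flags: "schubert_variety w \<subseteq> (flags :: 'n::{finite,linorder} flag set)"
  using closure_of_subset_topspace[of "flag_topology :: 'n flag topology"] by (simp add: schubert_variety_def)

lemma schubert_cell_subset_variety:
  assumes w: "w permutes {1..CARD('n)}"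
  shows "schubert_cell w \<subseteq> (schubert_variety w :: 'n::{finite,linorder} flag set)"
  unfolding schubert_variety_def by (rule closure_of_subset) (simp add: schubert_cell_subset_flags[OF w])

section \<open>Ranks on subspaces and their semicontinuity\<close>

lemma dim_image_inj_on:
  fixes A :: "'n::finite cmat"
  assumes "vec.subspace E" "\<And>x. x \<in> E \<Longrightarrow> A *v x = 0 \<Longrightarrow> x = 0"
  shows "vec.dim ((*v) A ` E) = vec.dim E"
proof (rule vec.dim_image_eq)
  have span: "vec.span E = E"
    using assms(1) by (simp add: vec.span_eq_iff)
  show "inj_on ((*v) A) (vec.span E)"
    unfolding span
  proof (rule inj_onI)
    fix x y assume "x \<in> E" "y \<in> E" "A *v x = A *v y"
    then have "A *v (x - y) = 0" "x - y \<in> E"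
      using assms(1) by (auto simp: vec.diff vec.subspace_diff)
    then show "x = y"
      using assms(2)[of "x - y"] by simp
  qed
qed simp

text \<open>A right inverse on the image of \<open>E\<close>, given as a matrix on the whole space.
  It supplies the complement of the kernel in \<open>rank_nullity_on\<close> and the perturbation
  \<open>C\<close> in \<open>open_rank_ge\<close>.\<close>

lemma section_matrix:
  fixes A :: "'n::finite cmat"
  assumes E: "vec.subspace E"
  shows "\<exists>H. (\<forall>v. H *v v \<in> E) \<and> (\<forall>v\<in>(*v) A ` E. A *v (H *v v) = v)"
proof -
  obtain h where h: "range h \<subseteq> E" "Vector_Spaces.linear (*s) (*s) h" "\<forall>v\<in>(*v) A ` E. A *v h v = v"
    using vec.linear_exists_right_inverse_on[OF matrix_vector_mul_linear_gen E, of A] by blast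
  have "matrix h *v v = h v" for v
    using matrix_works[OF h(2)] by simp
  then show ?thesis
    using h by (intro exI[of _ "matrix h"]) auto
qed

lemma rank_nullity_on:
  fixes A :: "'n::finite cmat"
  assumes E: "vec.subspace E"
  shows "vec.dim {x \<in> E. A *v x = 0} + vec.dim ((*v) A ` E) = vec.dim E"
proof -
  obtain H where H: "\<And>v. H *v v \<in> E" "\<And>v. v \<in> (*v) A ` E \<Longrightarrow> A *v (H *v v) = v"
    using section_matrix[OF E, of A] by blast
  let ?K = "{x \<in> E. A *v x = 0}" and ?R = "(*v) A ` E"
  let ?S = "(*v) H ` ?R"
  have K: "vec.subspace ?K"
    using E by (auto simp: vec.subspace_def vec.add vec.scale)
  have R: "vec.subspace ?R"
    by (rule vec.subspace_image[OF E])
  have S: "vec.subspace ?S"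
    by (rule vec.subspace_image[OF R])
  have "vec.dim ?S = vec.dim ?R"
  proof (rule dim_image_inj_on[OF R])
    fix v assume "v \<in> ?R" "H *v v = 0"
    then show "v = 0"
      using H(2)[of v] by simp
  qed
  moreover have "?K \<inter> ?S = {0}"
  proof -
    have "0 \<in> ?K \<inter> ?S"
      using vec.subspace_0[OF K] vec.subspace_0[OF S] by blast
    moreover have "x = 0" if x: "x \<in> ?K \<inter> ?S" for x
    proof -
      obtain v where v: "v \<in> ?R" "x = H *v v"
        using x by blast
      then have "v = A *v x"
        using H(2) by simp
      then show ?thesis
        using x v(2) by simp
    qed
    ultimately show ?thesis
      by blast
  qed
  moreover have "{x + y |x y. x \<in> ?K \<and> y \<in> ?S} = E"
  proof (intro Set.set_eqI iffI)
    fix z assume "z \<in> {x + y |x y. x \<in> ?K \<and> y \<in> ?S}"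
    then show "z \<in> E"
      using E H(1) by (auto simp: vec.subspace_add)
  next
    fix z assume z: "z \<in> E"
    have "z - H *v (A *v z) \<in> ?K"
      using z H(1) H(2)[of "A *v z"] E by (auto simp: vec.subspace_diff vec.diff)
    moreover have "H *v (A *v z) \<in> ?S"
      using z by blast
    moreover have "z = (z - H *v (A *v z)) + H *v (A *v z)"
      by simp
    ultimately show "z \<in> {x + y |x y. x \<in> ?K \<and> y \<in> ?S}"
      by blast
  qed
  ultimately show ?thesis
    using vec.dim_sums_Int[OF K S] by simp
qed

text \<open>Take a section \<open>H\<close> at \<open>g0\<close>. Near \<open>g0\<close> the matrix
  \<open>C g\<close> is invertible, and on the old image \<open>?R\<close> it acts as
  \<open>Q ** g\<close> after \<open>H\<close>, so it embeds \<open>?R\<close> into the new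
  image.\<close>

lemma open_rank_ge:
  fixes Q :: "'n::finite cmat" and E :: "(complex, 'n) vec set"
  assumes E: "vec.subspace E"
  shows "open {g. s \<le> vec.dim ((*v) (Q ** g) ` E)}"
proof (subst open_subopen, rule ballI)
  fix g0 assume "g0 \<in> {g. s \<le> vec.dim ((*v) (Q ** g) ` E)}"
  then have s: "s \<le> vec.dim ((*v) (Q ** g0) ` E)"
    by simp
  let ?R = "(*v) (Q ** g0) ` E"
  obtain H where H: "\<And>v. H *v v \<in> E" "\<And>v. v \<in> ?R \<Longrightarrow> (Q ** g0) *v (H *v v) = v"
    using section_matrix[OF E, of "Q ** g0"] by blast
  define C where "C g = mat 1 + (Q ** g - Q ** g0) ** H" for g
  define T where "T = {g. det (C g) \<noteq> 0}"
  have "open T"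
    unfolding T_def C_def by (intro open_Collect_neq continuous_intros)
  moreover have "(Q ** g0 - Q ** g0) ** H = 0"
    by (simp add: vec_eq_iff matrix_matrix_mult_def)
  then have "g0 \<in> T"
    by (simp add: T_def C_def)
  moreover have "s \<le> vec.dim ((*v) (Q ** g) ` E)" if "g \<in> T" for g
  proof -
    have "C g *v v = (Q ** g) *v (H *v v)" if "v \<in> ?R" for v
    proof -
      have "C g *v v = v + ((Q ** g) *v (H *v v) - (Q ** g0) *v (H *v v))"
        by (simp add: C_def matrix_vector_mult_add_rdistrib matrix_vector_mult_diff_rdistrib
            flip: matrix_vector_mul_assoc)
      then show ?thesis
        using H(2)[OF that] by simp
    qed
    then have "(*v) (C g) ` ?R \<subseteq> (*v) (Q ** g) ` E"
      using H(1) by auto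
    then have "vec.dim ((*v) (C g) ` ?R) \<le> vec.dim ((*v) (Q ** g) ` E)"
      by (rule vec.dim_subset)
    moreover have "vec.dim ((*v) (C g) ` ?R) = vec.dim ?R"
      using that by (intro dim_mult_image) (simp add: T_def)
    ultimately show ?thesis
      using s by simp
  qed
  ultimately show "\<exists>T. open T \<and> g0 \<in> T \<and> T \<subseteq> {g. s \<le> vec.dim ((*v) (Q ** g) ` E)}"
    by blast
qed

text \<open>Projection with kernel \<open>std k\<close>: it converts intersections with the standard
  flag into ranks.\<close>

definition tail_mat :: "nat \<Rightarrow> 'n::{finite,linorder} cmat" where
  "tail_mat k = (\<chi> i j. if i = j \<and> k < rk i then 1 else 0)"

lemma tail_mat_nth: "(tail_mat k *v x) $ a = (if k < rk a then x $ a else 0)"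
proof -
  have "(tail_mat k *v x) $ a = (\<Sum>j\<in>UNIV. if j = a then if k < rk a then x $ a else 0 else 0)"
    unfolding tail_mat_def matrix_vector_mult_def vec_lambda_beta by (rule sum.cong) auto
  then show ?thesis
    by simp
qed

lemma tail_mat_eq_0_iff: "tail_mat k *v x = 0 \<longleftrightarrow> x \<in> std k"
  by (auto simp: vec_eq_iff tail_mat_nth std_def)

lemma dim_flag_Int_std:
  fixes g :: "'n::{finite,linorder} cmat"
  assumes "det g \<noteq> 0"
  shows "vec.dim (flag_of g t \<inter> std k) + vec.dim ((*v) (tail_mat k ** g) ` std t) = min t CARD('n)"
proof -
  have "flag_of g t \<inter> std k = (*v) g ` {x \<in> std t. (tail_mat k ** g) *v x = 0}"
    by (auto simp: flag_of_apply tail_mat_eq_0_iff simp flip: matrix_vector_mul_assoc)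
  then have "vec.dim (flag_of g t \<inter> std k) = vec.dim {x \<in> std t. (tail_mat k ** g) *v x = 0}"
    by (simp add: dim_mult_image[OF assms])
  then show ?thesis
    using rank_nullity_on[OF subspace_std, of t "tail_mat k ** g"] by (simp add: dim_std)
qed

lemma openin_dim_Int_std_le:
  "openin flag_topology {V \<in> (flags :: 'n::{finite,linorder} flag set). vec.dim (V t \<inter> std k) \<le> r}"
proof -
  have *: "{g :: 'n cmat. det g \<noteq> 0 \<and> flag_of g \<in> {V \<in> flags. vec.dim (V t \<inter> std k) \<le> r}} =
      {g. det g \<noteq> 0} \<inter> {g. min t CARD('n) - r \<le> vec.dim ((*v) (tail_mat k ** g) ` std t)}"
  proof -
    have "vec.dim (flag_of g t \<inter> std k) \<le> r \<longleftrightarrow>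
        min t CARD('n) - r \<le> vec.dim ((*v) (tail_mat k ** g) ` std t)" if "det g \<noteq> 0" for g :: "'n cmat"
      using dim_flag_Int_std[OF that, of t k] by linarith
    then show ?thesis
      using flag_of_in_flags by blast
  qed
  show ?thesis
    unfolding openin_flag_topology_iff *
    by (intro conjI open_Int open_det_nonzero open_rank_ge[OF subspace_std] Collect_restrict)
qed

definition rank_count :: "(nat \<Rightarrow> nat) \<Rightarrow> nat \<Rightarrow> nat \<Rightarrow> nat" where
  "rank_count w t k = card {i\<in>{1..t}. w i \<le> k}"

lemma rank_count_eq:
  assumes "t \<le> CARD('n)"
  shows "card {a :: 'n::{finite,linorder}. rk a \<le> t \<and> w (rk a) \<le> k} = rank_count w t k"
proof -
  have "rk ` {a :: 'n. rk a \<le> t \<and> w (rk a) \<le> k} = {i\<in>{1..t}. w i \<le> k}"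
  proof (intro Set.set_eqI iffI)
    fix i assume "i \<in> {i\<in>{1..t}. w i \<le> k}"
    then have "rk (unrk i :: 'n) = i" "i \<le> t" "w i \<le> k"
      using rk_unrk[of i, where 'n = 'n] assms by auto
    then show "i \<in> rk ` {a :: 'n. rk a \<le> t \<and> w (rk a) \<le> k}"
      by (intro image_eqI[of _ _ "unrk i"]) auto
  qed (use rk_pos rk_le in auto)
  moreover have "card (rk ` {a :: 'n. rk a \<le> t \<and> w (rk a) \<le> k}) = card {a :: 'n. rk a \<le> t \<and> w (rk a) \<le> k}"
    by (rule card_image) (simp add: inj_on_def)
  ultimately show ?thesis
    by (simp add: rank_count_def)
qed

text \<open>The upper triangular factor \<open>b\<close> preserves \<open>std k\<close>, which
  reduces the count to the coordinate flag.\<close>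

lemma dim_schubert_cell:
  fixes V :: "'n::{finite,linorder} flag"
  assumes w: "w permutes {1..CARD('n)}" and V: "V \<in> schubert_cell w" and t: "t \<le> CARD('n)"
  shows "vec.dim (V t \<inter> std k) = rank_count w t k"
proof -
  obtain b :: "'n cmat" where b: "upper b" "det b \<noteq> 0" "V = flag_of (b ** perm_mat w)"
    using V unfolding schubert_cell_eq[OF w] by blast
  have "V t = (*v) b ` (*v) (perm_mat w) ` std t"
    unfolding b(3) flag_of_apply by (simp add: image_image matrix_vector_mul_assoc)
  then have "V t \<inter> std k = (*v) b ` ((*v) (perm_mat w) ` std t \<inter> std k)"
    using upper_image_std[OF b(1,2), of k] image_Int[OF inj_mult[OF b(2)]] by metis
  then have "vec.dim (V t \<inter> std k) = vec.dim ((*v) (perm_mat w :: 'n cmat) ` std t \<inter> std k)"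
    by (simp add: dim_mult_image[OF b(2)])
  also have "(*v) (perm_mat w :: 'n cmat) ` std t \<inter> std k =
      {y. \<forall>a. a \<notin> pos_perm w ` {a. rk a \<le> t \<and> w (rk a) \<le> k} \<longrightarrow> y $ a = 0}"
  proof -
    have *: "a \<notin> pos_perm w ` {a. rk a \<le> t \<and> w (rk a) \<le> k} \<longleftrightarrow>
        a \<notin> pos_perm w ` {a. rk a \<le> t} \<or> k < rk a" for a :: 'n
    proof -
      obtain b where "a = pos_perm w b"
        using bij_pos_perm[OF w] by (metis bij_pointE)
      then show ?thesis
        by (auto simp: inj_image_mem_iff[OF bij_is_inj[OF bij_pos_perm[OF w]]] rk_pos_perm[OF w])
    qed
    show ?thesis
      unfolding perm_mat_std[OF w]
      unfolding std_def * Collect_conj_eq[symmetric] by (rule Collect_cong) metis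
  qed
  also have "vec.dim \<dots> = card (pos_perm w ` {a :: 'n. rk a \<le> t \<and> w (rk a) \<le> k})"
    by (rule dim_substandard_cart)
  also have "\<dots> = card {a :: 'n. rk a \<le> t \<and> w (rk a) \<le> k}"
    using bij_is_inj[OF bij_pos_perm[OF w]] by (intro card_image) (rule inj_on_subset, auto)
  finally show ?thesis
    by (simp add: rank_count_eq[OF t])
qed

text \<open>By semicontinuity a dimension that is too small at \<open>V\<close> stays too small on
  an open set around \<open>V\<close>. That set meets the cell, where the dimension is
  known.\<close>

lemma dim_schubert_variety:
  fixes V :: "'n::{finite,linorder} flag"
  assumes w: "w permutes {1..CARD('n)}" and V: "V \<in> schubert_variety w" and t: "t \<le> CARD('n)"
  shows "rank_count w t k \<le> vec.dim (V t \<inter> std k)"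
proof (rule ccontr)
  assume less: "\<not> rank_count w t k \<le> vec.dim (V t \<inter> std k)"
  let ?U = "{U \<in> (flags :: 'n flag set). vec.dim (U t \<inter> std k) \<le> vec.dim (V t \<inter> std k)}"
  have VU: "V \<in> ?U"
    using V schubert_variety_subset_flags by auto
  have "\<forall>T. V \<in> T \<and> openin flag_topology T \<longrightarrow> (\<exists>U. U \<in> schubert_cell w \<and> U \<in> T)"
    using V by (simp add: schubert_variety_def in_closure_of)
  then have "\<exists>U. U \<in> schubert_cell w \<and> U \<in> ?U"
    by (rule allE) (erule mp, rule conjI[OF VU openin_dim_Int_std_le])
  then obtain U where U: "U \<in> schubert_cell w" "U \<in> ?U"
    by (elim exE conjE) (rule that)
  then show False
    using dim_schubert_cell[OF w U(1) t, of k] less U(2) by simp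
qed

section \<open>Local form of a Schubert variety along its cell\<close>

text \<open>These are the inversions of \<open>w\<close>, written as matrix positions (row, column)
  below the diagonal, with the later position first.\<close>

definition noninv_pairs :: "(nat \<Rightarrow> nat) \<Rightarrow> ('n::{finite,linorder} \<times> 'n) set" where
  "noninv_pairs w = {(i, j). j < i \<and> w (rk i) < w (rk j)}"

lemma card_noninv_pairs:
  "card (noninv_pairs w :: ('n::{finite,linorder} \<times> 'n) set) = inversions CARD('n) w"
proof -
  let ?f = "\<lambda>(i :: 'n, j). (rk j, rk i)"
  have "?f ` noninv_pairs w = {(i, j). 1 \<le> i \<and> i < j \<and> j \<le> CARD('n) \<and> w j < w i}"
  proof (intro Set.set_eqI iffI)
    fix z assume "z \<in> {(i, j). 1 \<le> i \<and> i < j \<and> j \<le> CARD('n) \<and> w j < w i}"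
    then obtain p q where z: "z = (p, q)" "1 \<le> p" "p < q" "q \<le> CARD('n)" "w q < w p"
      by blast
    then have "rk (unrk p :: 'n) = p" "rk (unrk q :: 'n) = q"
      by (simp_all add: rk_unrk)
    moreover from this z have "(unrk q :: 'n, unrk p) \<in> noninv_pairs w"
      by (simp add: noninv_pairs_def flip: rk_less_iff)
    ultimately show "z \<in> ?f ` noninv_pairs w"
      using z(1) by (force intro: image_eqI[of _ _ "(unrk q, unrk p)"])
  qed (auto simp: noninv_pairs_def rk_pos[unfolded One_nat_def] rk_le rk_less_iff)
  moreover have "card (?f ` noninv_pairs w) = card (noninv_pairs w :: ('n \<times> 'n) set)"
    by (rule card_image) (auto simp: inj_on_def)
  ultimately show ?thesis
    by (simp add: inversions_def)
qed

lemma matrix_eq_on_axes: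
  fixes A B :: "'n::finite cmat"
  assumes "\<And>j. A *v axis j 1 = B *v axis j 1"
  shows "A = B"
  unfolding vec_eq_iff
proof (intro allI)
  fix i j
  show "A $ i $ j = B $ i $ j"
    using assms[of j] mult_axis_nth[of A j i] mult_axis_nth[of B j i] by simp
qed

text \<open>Conjugation by the permutation matrix moves the entry in row \<open>i\<close> and column
  \<open>j\<close> to row \<open>w i\<close> and column \<open>w j\<close>. The inversions are the
  positions below the diagonal that land above it.\<close>

lemma perm_conjugate:
  assumes w: "w permutes {1..CARD('n)}" and X: "(X :: 'n::{finite,linorder} cmat) \<in> coord_space (noninv_pairs w)"
  obtains c where "upper c" "perm_mat w ** (mat 1 + X) = c ** perm_mat w"
proof -
  let ?q = "inv_into UNIV (pos_perm w :: 'n \<Rightarrow> 'n)"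
  note bij = bij_pos_perm[OF w]
  have q: "?q (pos_perm w a) = a" "pos_perm w (?q a) = a" for a
    using bij by (simp_all add: bij_is_inj bij_is_surj surj_f_inv_f)
  define c where "c = (\<chi> i j. (mat 1 + X) $ ?q i $ ?q j)"
  have "upper c"
    unfolding upper_def
  proof (intro allI impI)
    fix i j :: 'n assume "j < i"
    then have "w (rk (?q j)) < w (rk (?q i))"
      by (simp add: q flip: rk_pos_perm[OF w] rk_less_iff)
    then have "(?q i, ?q j) \<notin> noninv_pairs w" "?q i \<noteq> ?q j"
      by (auto simp: noninv_pairs_def)
    then show "c $ i $ j = 0"
      using X by (simp add: c_def mat_def coord_space_def)
  qed
  moreover have "perm_mat w ** (mat 1 + X) = c ** perm_mat w"
  proof -
    have "perm_mat w *v ((mat 1 + X) *v axis j 1) = c *v (perm_mat w *v axis j 1)" for j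
    proof -
      have P: "perm_mat w *v axis j 1 = axis (pos_perm w j) 1"
        by (simp add: vec_eq_iff mult_axis_nth) (simp add: perm_mat_def axis_def)
      have *: "(perm_mat w *v ((mat 1 + X) *v axis j 1)) $ pos_perm w a = (c *v axis (pos_perm w j) 1) $ pos_perm w a" for a
        by (simp only: perm_mat_nth[OF w] mult_axis_nth) (simp add: c_def q)
      show ?thesis
        unfolding vec_eq_iff P
      proof
        fix i
        show "(perm_mat w *v ((mat 1 + X) *v axis j 1)) $ i = (c *v axis (pos_perm w j) 1) $ i"
          using *[of "?q i"] by (simp only: q(2))
      qed
    qed
    then show ?thesis
      by (intro matrix_eq_on_axes) (simp flip: matrix_vector_mul_assoc)
  qed
  ultimately show ?thesis
    by (rule that)
qed

text \<open>Matrices supported on the inversions stay in the cell, because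
  \<open>perm_conjugate\<close> moves the unipotent factor into the upper triangular group.
  Conversely, the dimension bounds that hold on the closure already force all other entries to
  vanish, one column \<open>j\<close> at a time.\<close>

lemma schubert_chart:
  fixes b :: "'n::{finite,linorder} cmat"
  assumes w: "w permutes {1..CARD('n)}" and b: "upper b" "det b \<noteq> 0"
  shows "{X \<in> strictly_lower. chart (b ** perm_mat w) X \<in> schubert_variety w} = coord_space (noninv_pairs w)"
proof (intro Set.set_eqI iffI)
  fix X :: "'n cmat" assume X: "X \<in> coord_space (noninv_pairs w)"
  then have sl: "X \<in> strictly_lower"
    unfolding strictly_lower_eq by (auto simp: coord_space_def noninv_pairs_def)
  obtain c where c: "upper c" "perm_mat w ** (mat 1 + X) = c ** perm_mat w"
    using perm_conjugate[OF w X] by blast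
  have "det c \<noteq> 0"
    using arg_cong[OF c(2), of det] det_unipotent[OF sl] det_perm_mat[OF w] by (auto simp: det_mul)
  have "chart (b ** perm_mat w) X = flag_of (b ** c ** perm_mat w)"
    by (simp add: chart_def c(2) flip: matrix_mul_assoc)
  moreover have "upper (b ** c)" "det (b ** c) \<noteq> 0"
    using b c(1) \<open>det c \<noteq> 0\<close> by (auto simp: upper_mult det_mul)
  ultimately have "chart (b ** perm_mat w) X \<in> schubert_cell w"
    unfolding schubert_cell_eq[OF w] by blast
  then show "X \<in> {X \<in> strictly_lower. chart (b ** perm_mat w) X \<in> schubert_variety w}"
    using sl schubert_cell_subset_variety[OF w] by blast
next
  fix X :: "'n cmat" assume "X \<in> {X \<in> strictly_lower. chart (b ** perm_mat w) X \<in> schubert_variety w}"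
  then have sl: "X \<in> strictly_lower" and V: "chart (b ** perm_mat w) X \<in> schubert_variety w"
    by auto
  let ?u = "mat 1 + X"
  have "X $ a $ j = 0" if "w (rk j) \<le> w (rk a)" "a \<noteq> j" for a j
  proof -
    \<comment> \<open>\<open>?k\<close> is the least index for which \<open>std ?k\<close> contains
      \<open>perm_mat w *v axis j 1\<close>; the claim for column \<open>j\<close> is that
      \<open>X\<close> does not lead out of \<open>std ?k\<close>.\<close>
    let ?t = "rk j" and ?k = "w (rk j)"
    let ?T = "{x \<in> std ?t. (perm_mat w ** ?u) *v x \<in> std ?k}"
    have T: "vec.subspace ?T"
      using subspace_std[of ?t, where 'a = 'n] subspace_std[of ?k, where 'a = 'n]
      by (auto simp: vec.subspace_def vec.add vec.scale)
    have "chart (b ** perm_mat w) X ?t = (*v) b ` (*v) (perm_mat w ** ?u) ` std ?t"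
      by (simp add: chart_def flag_of_apply image_image matrix_vector_mul_assoc matrix_mul_assoc)
    then have "chart (b ** perm_mat w) X ?t \<inter> std ?k = (*v) b ` ((*v) (perm_mat w ** ?u) ` std ?t \<inter> std ?k)"
      using upper_image_std[OF b, of ?k] image_Int[OF inj_mult[OF b(2)]] by metis
    moreover have "(*v) (perm_mat w ** ?u) ` std ?t \<inter> std ?k = (*v) (perm_mat w ** ?u) ` ?T"
      by auto
    moreover have "det (perm_mat w ** ?u) \<noteq> 0"
      using det_unipotent[OF sl] det_perm_mat[OF w] by (simp add: det_mul)
    ultimately have "vec.dim (chart (b ** perm_mat w) X ?t \<inter> std ?k) = vec.dim ?T"
      using b(2) by (simp add: dim_mult_image)
    then have le: "rank_count w ?t ?k \<le> vec.dim ?T"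
      using dim_schubert_variety[OF w V rk_le, of j ?k] by simp
    \<comment> \<open>Truncation to the first \<open>?t\<close> coordinates. After \<open>?u\<close>
      it embeds \<open>?T\<close> into the coordinate space on \<open>?A\<close>, whose dimension is
      the lower bound known for \<open>?T\<close>. So the embedding is onto, and a preimage of
      \<open>axis j 1\<close> must be \<open>axis j 1\<close> itself.\<close>
    define Q :: "'n cmat" where "Q = mat 1 - tail_mat ?t"
    have Q: "(Q *v x) $ a = (if rk a \<le> ?t then x $ a else 0)" for x a
      by (simp add: Q_def matrix_vector_mult_diff_rdistrib tail_mat_nth)
    let ?A = "{a. rk a \<le> ?t \<and> w (rk a) \<le> ?k}"
    have "(*v) (Q ** ?u) ` ?T = {y. \<forall>a. a \<notin> ?A \<longrightarrow> y $ a = 0}"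
    proof (rule vec.subspace_dim_equal)
      show "vec.subspace ((*v) (Q ** ?u) ` ?T)"
        by (rule vec.subspace_image[OF T])
      show "vec.subspace {y :: (complex, 'n) vec. \<forall>a. a \<notin> ?A \<longrightarrow> y $ a = 0}"
        by (auto simp: vec.subspace_def)
      show "(*v) (Q ** ?u) ` ?T \<subseteq> {y. \<forall>a. a \<notin> ?A \<longrightarrow> y $ a = 0}"
      proof (rule image_subsetI, intro CollectI allI impI)
        fix x and a :: 'n assume x: "x \<in> ?T" and a: "a \<notin> ?A"
        have "(?u *v x) $ a = 0" if "?k < w (rk a)"
        proof -
          have "(perm_mat w *v (?u *v x)) $ pos_perm w a = 0"
            using x that by (simp add: std_def rk_pos_perm[OF w] flip: matrix_vector_mul_assoc)
          then show ?thesis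
            by (simp only: perm_mat_nth[OF w])
        qed
        then show "((Q ** ?u) *v x) $ a = 0"
          using a Q[of "?u *v x" a] by (auto simp flip: matrix_vector_mul_assoc)
      qed
      have "vec.dim ((*v) (Q ** ?u) ` ?T) = vec.dim ?T"
      proof (rule dim_image_inj_on[OF T])
        fix x assume x: "x \<in> ?T" and 0: "(Q ** ?u) *v x = 0"
        show "x = 0"
        proof (rule unipotent_solve[OF sl])
          show "x \<in> std ?t"
            using x by simp
          fix a :: 'n assume "rk a \<le> ?t"
          then show "(?u *v x) $ a = 0"
            using 0 Q[of "?u *v x" a] by (simp flip: matrix_vector_mul_assoc)
        qed
      qed
      moreover have "vec.dim {y :: (complex, 'n) vec. \<forall>a. a \<notin> ?A \<longrightarrow> y $ a = 0} = rank_count w ?t ?k"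
        by (simp only: dim_substandard_cart rank_count_eq[OF rk_le])
      ultimately show "vec.dim {y :: (complex, 'n) vec. \<forall>a. a \<notin> ?A \<longrightarrow> y $ a = 0} \<le> vec.dim ((*v) (Q ** ?u) ` ?T)"
        using le by simp
    qed
    moreover have "axis j 1 \<in> {y :: (complex, 'n) vec. \<forall>a. a \<notin> ?A \<longrightarrow> y $ a = 0}"
      by (auto simp: axis_def)
    ultimately obtain x where x: "x \<in> ?T" "axis j 1 = (Q ** ?u) *v x"
      by blast
    have "x - axis j 1 = 0"
    proof (rule unipotent_solve[OF sl])
      show "x - axis j 1 \<in> std ?t"
        using x(1) by (intro vec.subspace_diff subspace_std axis_std) simp_all
      fix a :: 'n assume a: "rk a \<le> ?t"
      have "(?u *v x) $ a = axis j 1 $ a"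
        using Q[of "?u *v x" a] a x(2) by (simp flip: matrix_vector_mul_assoc)
      moreover have "(X *v axis j 1) $ a = 0"
        using mult_strictly_lower_axis[OF sl, of a j] a by (simp add: rk_le_iff)
      ultimately show "(?u *v (x - axis j 1)) $ a = 0"
        by (simp add: vec.diff matrix_vector_mult_add_unit)
    qed
    then have "x = axis j 1"
      by simp
    then have P: "perm_mat w *v (?u *v axis j 1) \<in> std ?k"
      using x(1) by (simp flip: matrix_vector_mul_assoc)
    have "w (rk a) \<noteq> w (rk j)"
      using \<open>a \<noteq> j\<close> permutes_inj[OF w] by (simp add: inj_eq)
    then have "?k < rk (pos_perm w a :: 'n)"
      using that(1) by (simp add: rk_pos_perm[OF w])
    then have "(perm_mat w *v (?u *v axis j 1)) $ pos_perm w a = 0"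
      using P by (simp add: std_def)
    then have "?u $ a $ j = 0"
      by (simp only: perm_mat_nth[OF w] mult_axis_nth)
    then show ?thesis
      using \<open>a \<noteq> j\<close> by (simp add: mat_def)
  qed
  then show "X \<in> coord_space (noninv_pairs w)"
    using sl unfolding coord_space_def noninv_pairs_def strictly_lower_def
    by (auto simp: not_less)
qed

text \<open>An open set that meets the closure meets the cell, so charts centred at points of the
  cell reach every such set.\<close>

lemma flag_dim_schubert_variety:
  assumes w: "w permutes {1..CARD('n)}"
  shows "flag_dim (schubert_variety w :: 'n::{finite,linorder} flag set) = inversions CARD('n) w"
proof (rule flag_dim_eqI)
  have "coordinate_flag w \<in> (schubert_cell w :: 'n flag set)"
    unfolding schubert_cell_eq[OF w] coordinate_flag_perm_mat[OF w]
    by (rule CollectI, rule exI[of _ "mat 1"]) (simp add: upper_mat matrix_mul_lid)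
  then show "schubert_variety w \<noteq> ({} :: 'n flag set)"
    using schubert_cell_subset_variety[OF w] by blast
next
  fix U :: "'n flag set" assume U: "openin flag_topology U" "U \<inter> schubert_variety w \<noteq> {}"
  then obtain V' where "V' \<in> U" "V' \<in> schubert_variety w"
    by blast
  then obtain V where V: "V \<in> schubert_cell w" "V \<in> U"
    using U(1) unfolding schubert_variety_def in_closure_of by blast
  then obtain b :: "'n cmat" where b: "upper b" "det b \<noteq> 0" "V = flag_of (b ** perm_mat w)"
    unfolding schubert_cell_eq[OF w] by blast
  have "V \<in> U \<inter> schubert_variety w \<inter> chart (b ** perm_mat w) ` strictly_lower"
    using V b(3) schubert_cell_subset_variety[OF w] by (auto intro: image_eqI[of _ _ 0])
  moreover have "homeomorphic_map (top_of_set {Y \<in> strictly_lower. chart (b ** perm_mat w) Y \<in> schubert_variety w})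
      (top_of_set (coord_space (noninv_pairs w))) id"
    by (simp add: schubert_chart[OF w b(1,2)])
  moreover have "det (b ** perm_mat w) \<noteq> 0"
    using b(2) det_perm_mat[OF w] by (simp add: det_mul)
  moreover have "subspace (coord_space (noninv_pairs w) :: 'n cmat set)"
    by (rule subspace_coord_space)
  moreover have "dim (coord_space (noninv_pairs w) :: 'n cmat set) = 2 * inversions CARD('n) w"
    by (simp only: dim_coord_space card_noninv_pairs)
  moreover have "openin (top_of_set (coord_space (noninv_pairs w))) (coord_space (noninv_pairs w) :: 'n cmat set)"
    by (rule openin_subtopology_self)
  ultimately show "\<exists>g (S :: 'n cmat set) W f. det g \<noteq> 0 \<and> U \<inter> schubert_variety w \<inter> chart g ` strictly_lower \<noteq> {} \<and>
        subspace S \<and> dim S = 2 * inversions CARD('n) w \<and> openin (top_of_set S) W \<and>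
        homeomorphic_map (top_of_set {Y \<in> strictly_lower. chart g Y \<in> schubert_variety w}) (top_of_set W) f"
    by blast
qed (rule schubert_variety_subset_flags)

section \<open>Isotropic flags\<close>

definition opp :: "'n::{finite,linorder} \<Rightarrow> 'n" where
  "opp a = unrk (CARD('n) + 1 - rk a)"

lemma rk_opp: "rk (opp (a :: 'n::{finite,linorder})) = CARD('n) + 1 - rk a"
  unfolding opp_def using rk_pos[of a] rk_le[of a] by (intro rk_unrk) auto

lemma rk_opp_add: "rk (opp (a :: 'n::{finite,linorder})) + rk a = CARD('n) + 1"
  using rk_opp[of a] rk_le[of a] by simp

lemma opp_opp [simp]: "opp (opp a) = a"
proof -
  have "rk (opp (opp a)) = rk a"
    using rk_opp_add[of "opp a"] rk_opp_add[of a] by linarith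
  then show ?thesis
    by simp
qed

lemma opp_eq_iff [simp]: "opp a = opp b \<longleftrightarrow> a = b"
  by (metis opp_opp)

lemma opp_less_iff: "opp a < opp b \<longleftrightarrow> b < a"
  using rk_opp_add[of a] rk_opp_add[of b] by (simp flip: rk_less_iff) linarith

text \<open>It has two roles: the Gram matrix of a normalised basis of an isotropic flag, and the
  column reversal that conjugation induces on an adapted basis,
  \<open>mcj g = g ** J\<close>.\<close>

definition J :: "'n::{finite,linorder} cmat" where
  "J = (\<chi> i j. if i = opp j then 1 else 0)"

lemma mult_J_nth: "(A ** J) $ i $ j = A $ i $ opp j"
proof -
  have "(A ** J) $ i $ j = (\<Sum>k\<in>UNIV. if k = opp j then A $ i $ k else 0)"
    unfolding matrix_matrix_mult_def J_def vec_lambda_beta by (rule sum.cong) auto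
  then show ?thesis
    by simp
qed

lemma J_mult_nth: "(J ** A) $ i $ j = A $ opp i $ j"
proof -
  have "(J ** A) $ i $ j = (\<Sum>k\<in>UNIV. if k = opp i then A $ k $ j else 0)"
    unfolding matrix_matrix_mult_def J_def vec_lambda_beta by (rule sum.cong) auto
  then show ?thesis
    by simp
qed

lemma J_vec_nth: "(J *v x) $ i = x $ opp i"
proof -
  have "(J *v x) $ i = (\<Sum>k\<in>UNIV. if k = opp i then x $ k else 0)"
    unfolding matrix_vector_mult_def J_def vec_lambda_beta by (rule sum.cong) auto
  then show ?thesis
    by simp
qed

lemma J_J: "J ** J = mat 1"
  by (simp add: vec_eq_iff J_mult_nth) (simp add: J_def mat_def)

section \<open>Complex conjugation and the bilinear form\<close>

definition cj :: "(complex, 'n::finite) vec \<Rightarrow> (complex, 'n) vec" where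
  "cj x = (\<chi> i. cnj (x $ i))"

definition mcj :: "'n::finite cmat \<Rightarrow> 'n cmat" where
  "mcj A = (\<chi> i j. cnj (A $ i $ j))"

lemma cj_nth [simp]: "cj x $ i = cnj (x $ i)"
  by (simp add: cj_def)

lemma mcj_nth [simp]: "mcj A $ i $ j = cnj (A $ i $ j)"
  by (simp add: mcj_def)

lemma cj_simps [simp]: "cj (cj x) = x" "cj 0 = 0" "cj x = 0 \<longleftrightarrow> x = 0"
  by (simp_all add: vec_eq_iff)

lemma cj_add: "cj (x + y) = cj x + cj y" and cj_scale: "cj (c *s x) = cnj c *s cj x"
  by (simp_all add: vec_eq_iff)

lemma cj_mult: "cj (A *v x) = mcj A *v cj x"
  by (simp add: vec_eq_iff matrix_vector_mult_def)

lemma mcj_mult: "mcj (A ** B) = mcj A ** mcj B"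
  by (simp add: vec_eq_iff matrix_matrix_mult_def)

lemma mcj_mat_1 [simp]: "mcj (mat 1) = mat 1"
  by (simp add: vec_eq_iff mat_def)

lemma det_mcj: "det (mcj A) = cnj (det A)"
  by (simp add: det_def cnj_sum cnj_prod)

lemma cj_std: "x \<in> std k \<Longrightarrow> cj x \<in> std k"
  by (simp add: std_def)

lemma subspace_cj: "vec.subspace S \<Longrightarrow> vec.subspace (cj ` S)"
  unfolding vec.subspace_def
proof (intro conjI ballI allI)
  assume S: "0 \<in> S \<and> (\<forall>x\<in>S. \<forall>y\<in>S. x + y \<in> S) \<and> (\<forall>c. \<forall>x\<in>S. c *s x \<in> S)"
  show "0 \<in> cj ` S"
    using S by (intro image_eqI[of _ _ 0]) auto
  fix x assume "x \<in> cj ` S"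
  then obtain p where p: "p \<in> S" "x = cj p"
    by blast
  show "c *s x \<in> cj ` S" for c
    using S p by (intro image_eqI[of _ _ "cnj c *s p"]) (auto simp: cj_scale)
  fix y assume "y \<in> cj ` S"
  then obtain q where "q \<in> S" "y = cj q"
    by blast
  then show "x + y \<in> cj ` S"
    using S p by (intro image_eqI[of _ _ "p + q"]) (auto simp: cj_add)
qed

text \<open>\<open>cj\<close> is only conjugate linear. Conjugating a basis gives one inequality,
  and the involution gives the other.\<close>

lemma dim_cj:
  assumes "vec.subspace S"
  shows "vec.dim (cj ` S) = vec.dim S"
proof -
  have le: "vec.dim (cj ` S) \<le> vec.dim S" if "vec.subspace S" for S :: "(complex, 'a) vec set"
  proof -
    obtain B where B: "B \<subseteq> S" "vec.independent B" "S \<subseteq> vec.span B" "card B = vec.dim S"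
      using vec.basis_exists by blast
    have "finite B"
      using B(2) vec.finiteI_independent by blast
    have "vec.subspace {x. cj x \<in> vec.span (cj ` B)}"
      by (auto simp: vec.subspace_def cj_add cj_scale vec.span_zero intro: vec.span_add vec.span_scale)
    moreover have "B \<subseteq> {x. cj x \<in> vec.span (cj ` B)}"
      by (auto intro: vec.span_base)
    ultimately have "vec.span B \<subseteq> {x. cj x \<in> vec.span (cj ` B)}"
      by (intro vec.span_minimal)
    then have "cj ` S \<subseteq> vec.span (cj ` B)"
      using B(3) by blast
    then have "vec.dim (cj ` S) \<le> card (cj ` B)"
      using \<open>finite B\<close> by (intro vec.dim_le_card) auto
    also have "\<dots> \<le> card B"
      using \<open>finite B\<close> by (rule card_image_le)
    finally show ?thesis
      using B(4) by simp
  qed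
  have "cj ` cj ` S = S"
    by (simp add: image_image)
  then show ?thesis
    using le[OF assms] le[OF subspace_cj[OF assms]] by simp
qed

text \<open>\<open>bilin (cj x) x\<close> is the squared Hermitian norm of \<open>x\<close>.\<close>

lemma bilin_cj_eq_0: "bilin (cj x) x = 0 \<Longrightarrow> x = 0"
proof -
  assume "bilin (cj x) x = 0"
  then have "complex_of_real (\<Sum>i\<in>UNIV. (cmod (x $ i))\<^sup>2) = 0"
    unfolding of_real_sum complex_norm_square by (simp add: bilin_def mult.commute)
  then have "(\<Sum>i\<in>UNIV. (cmod (x $ i))\<^sup>2) = 0"
    by (simp only: of_real_eq_0_iff)
  then have "\<forall>i\<in>UNIV. (cmod (x $ i))\<^sup>2 = 0"
    by (subst (asm) sum_nonneg_eq_0_iff) auto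
  then show "x = 0"
    by (simp add: vec_eq_iff)
qed

lemma bilin_transpose: "bilin (A *v x) y = bilin x (transpose A *v y)"
proof -
  have "bilin (A *v x) y = (\<Sum>i\<in>UNIV. \<Sum>j\<in>UNIV. A $ i $ j * x $ j * y $ i)"
    by (simp add: bilin_def matrix_vector_mult_def sum_distrib_right)
  also have "\<dots> = (\<Sum>j\<in>UNIV. \<Sum>i\<in>UNIV. A $ i $ j * x $ j * y $ i)"
    by (rule sum.swap)
  also have "\<dots> = bilin x (transpose A *v y)"
    by (simp add: bilin_def matrix_vector_mult_def transpose_def sum_distrib_left mult_ac)
  finally show ?thesis .
qed

lemma bilin_axis: "bilin (axis a 1) y = y $ a"
proof -
  have "bilin (axis a 1) y = (\<Sum>i\<in>UNIV. if i = a then y $ i else 0)"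
    unfolding bilin_def axis_def by (rule sum.cong) auto
  then show ?thesis
    by simp
qed

lemma dim_high_coordinates:
  "vec.dim {x :: (complex, 'n::{finite,linorder}) vec. \<forall>a. rk a \<le> k \<longrightarrow> x $ a = 0} = CARD('n) - k"
proof -
  have "{a :: 'n. k < rk a} = UNIV - {a. rk a \<le> k}"
    by auto
  then have "card {a :: 'n. k < rk a} = CARD('n) - min k CARD('n)"
    by (simp add: card_Diff_subset card_rk_le)
  then show ?thesis
    using dim_substandard_cart[of "{a :: 'n. k < rk a}", where 'a = complex] by (simp add: not_less)
qed

text \<open>\<open>transpose g\<close> carries the orthogonal complement onto the vectors whose
  first \<open>k\<close> coordinates vanish.\<close>

lemma perp_flag:
  fixes g :: "'n::{finite,linorder} cmat"
  assumes "det g \<noteq> 0"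
  shows "perp (flag_of g k) = {v. \<forall>a. rk a \<le> k \<longrightarrow> (transpose g *v v) $ a = 0}"
    and "vec.dim (perp (flag_of g k)) = CARD('n) - k"
    and "vec.subspace (perp (flag_of g k))"
proof -
  have sym: "bilin v x = bilin x v" for v x :: "(complex, 'n) vec"
    by (simp add: bilin_def mult.commute)
  show eq: "perp (flag_of g k) = {v. \<forall>a. rk a \<le> k \<longrightarrow> (transpose g *v v) $ a = 0}"
  proof (intro Set.set_eqI iffI)
    fix v assume v: "v \<in> perp (flag_of g k)"
    have "(transpose g *v v) $ a = 0" if "rk a \<le> k" for a
    proof -
      have "g *v axis a 1 \<in> flag_of g k"
        using that by (simp add: flag_of_apply axis_std)
      then have "bilin v (g *v axis a 1) = 0"
        using v by (simp add: perp_def)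
      then show ?thesis
        by (simp add: sym[of v] bilin_transpose bilin_axis)
    qed
    then show "v \<in> {v. \<forall>a. rk a \<le> k \<longrightarrow> (transpose g *v v) $ a = 0}"
      by blast
  next
    fix v assume v: "v \<in> {v. \<forall>a. rk a \<le> k \<longrightarrow> (transpose g *v v) $ a = 0}"
    have "bilin v (g *v x) = 0" if "x \<in> std k" for x
    proof -
      have "x $ a * (transpose g *v v) $ a = 0" for a
        using v that by (cases "rk a \<le> k") (auto simp: std_def)
      then have "bilin x (transpose g *v v) = 0"
        unfolding bilin_def by (intro sum.neutral) simp
      then show ?thesis
        by (simp add: sym[of v] bilin_transpose)
    qed
    then show "v \<in> perp (flag_of g k)"
      by (auto simp: perp_def flag_of_apply)
  qed
  have det: "det (transpose g) \<noteq> 0"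
    using assms by simp
  let ?C = "{x :: (complex, 'n) vec. \<forall>a. rk a \<le> k \<longrightarrow> x $ a = 0}"
  have "surj ((*v) (transpose g))"
    using inj_mult[OF det] matrix_left_right_inverse[of "transpose g"]
      matrix_left_invertible_injective[of "transpose g"] matrix_right_invertible_surjective[of "transpose g"]
    by auto
  moreover have "perp (flag_of g k) = (*v) (transpose g) -` ?C"
    unfolding eq by auto
  ultimately have "(*v) (transpose g) ` perp (flag_of g k) = ?C"
    by (simp only: surj_image_vimage_eq)
  then have "vec.dim (perp (flag_of g k)) = vec.dim ?C"
    using dim_mult_image[OF det] by metis
  then show "vec.dim (perp (flag_of g k)) = CARD('n) - k"
    by (simp only: dim_high_coordinates)
  show "vec.subspace (perp (flag_of g k))"
    unfolding eq by (auto simp: vec.subspace_def vec.add vec.scale simp del: transpose_matrix_vector)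
qed

lemma gram_nth: "(transpose g ** g) $ a $ b = bilin (g *v axis a 1) (g *v axis b 1)"
  by (simp add: bilin_transpose bilin_axis matrix_vector_mul_assoc mult_axis_nth)

lemma gram_sum: "(transpose A ** B) $ a $ b = (\<Sum>i\<in>UNIV. A $ i $ a * B $ i $ b)"
  by (simp add: matrix_matrix_mult_def transpose_def)

text \<open>The Gram entries say that the members \<open>i\<close> and \<open>j\<close> are
  orthogonal for \<open>i + j \<le> n\<close>. By dimension, member \<open>n - j\<close> is then the
  whole complement of member \<open>j\<close>, which settles the intersections with
  \<open>i + j > n\<close>.\<close>

lemma isotropic_flag_of_iff:
  fixes g :: "'n::{finite,linorder} cmat"
  assumes g: "det g \<noteq> 0"
  shows "isotropic_flag (flag_of g) \<longleftrightarrow>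
    (\<forall>a b. rk a + rk b \<le> CARD('n) \<longrightarrow> (transpose g ** g) $ a $ b = 0)"
proof
  assume iso: "isotropic_flag (flag_of g)"
  show "\<forall>a b. rk a + rk b \<le> CARD('n) \<longrightarrow> (transpose g ** g) $ a $ b = 0"
  proof (intro allI impI)
    fix a b :: 'n assume ab: "rk a + rk b \<le> CARD('n)"
    have "vec.dim (flag_of g (rk a) \<inter> perp (flag_of g (rk b))) = rk a"
      using iso ab by (simp add: isotropic_flag_def)
    moreover have "vec.dim (flag_of g (rk a)) = rk a"
      using ab by (simp add: flag_of_apply dim_mult_image[OF g] dim_std)
    ultimately have "flag_of g (rk a) \<inter> perp (flag_of g (rk b)) = flag_of g (rk a)"
      using perp_flag(3)[OF g]
      by (intro vec.subspace_dim_equal vec.subspace_inter)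
        (auto simp: flag_of_apply intro: vec.subspace_image subspace_std)
    moreover have "g *v axis a 1 \<in> flag_of g (rk a)" "g *v axis b 1 \<in> flag_of g (rk b)"
      by (simp_all add: flag_of_apply axis_std)
    ultimately show "(transpose g ** g) $ a $ b = 0"
      unfolding gram_nth perp_def by blast
  qed
next
  assume M: "\<forall>a b. rk a + rk b \<le> CARD('n) \<longrightarrow> (transpose g ** g) $ a $ b = 0"
  have sub: "flag_of g i \<subseteq> perp (flag_of g j)" if ij: "i + j \<le> CARD('n)" for i j
  proof
    fix v assume "v \<in> flag_of g i"
    then obtain x where x: "x \<in> std i" "v = g *v x"
      by (auto simp: flag_of_apply)
    have "(transpose g ** g) $ a $ b * x $ b = 0" if "rk a \<le> j" for a b
      using M x(1) ij that by (cases "rk b \<le> i") (auto simp: std_def)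
    then have "((transpose g ** g) *v x) $ a = 0" if "rk a \<le> j" for a
      using that unfolding matrix_vector_mult_def vec_lambda_beta by (intro sum.neutral) blast
    then show "v \<in> perp (flag_of g j)"
      by (simp add: perp_flag(1)[OF g] x(2) matrix_vector_mul_assoc del: transpose_matrix_vector)
  qed
  have dim: "vec.dim (flag_of g k) = min k CARD('n)" and ss: "vec.subspace (flag_of g k)" for k
    by (auto simp: flag_of_apply dim_mult_image[OF g] dim_std intro: vec.subspace_image subspace_std)
  show "isotropic_flag (flag_of g)"
    unfolding isotropic_flag_def
  proof (intro allI impI)
    fix i j assume ij: "i \<le> CARD('n)" "j \<le> CARD('n)"
    show "vec.dim (flag_of g i \<inter> perp (flag_of g j)) = min i (CARD('n) - j)"
    proof (cases "i \<le> CARD('n) - j")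
      case True
      then have "i + j \<le> CARD('n)"
        using ij by simp
      then have "flag_of g i \<inter> perp (flag_of g j) = flag_of g i"
        using sub by blast
      then show ?thesis
        using True by (simp add: dim)
    next
      case False
      have "flag_of g (CARD('n) - j) = perp (flag_of g j)"
        using ij by (intro vec.subspace_dim_equal ss perp_flag(3)[OF g] sub) (simp_all add: dim perp_flag(2)[OF g])
      moreover have "flag_of g (CARD('n) - j) \<subseteq> flag_of g i"
        using False unfolding flag_of_apply by (intro image_mono std_mono) simp
      ultimately have "flag_of g i \<inter> perp (flag_of g j) = flag_of g (CARD('n) - j)"
        by blast
      then show ?thesis
        using False by (simp add: dim)
    qed
  qed
qed

lemma isotropic_orthogonal:
  fixes V :: "'n::{finite,linorder} flag"
  assumes V: "V \<in> flags" "isotropic_flag V" and "i + j \<le> CARD('n)" "x \<in> V i" "y \<in> V j"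
  shows "bilin x y = 0"
proof -
  obtain g where g: "det g \<noteq> 0" "V = flag_of g"
    using flag_obtain[OF V(1)] by blast
  have "vec.dim (V i \<inter> perp (V j)) = i"
    using V(2) assms(3) by (simp add: isotropic_flag_def)
  then have "V i \<inter> perp (V j) = V i"
    using V(1) assms(3) perp_flag(3)[OF g(1), of j]
    by (intro vec.subspace_dim_equal vec.subspace_inter) (auto simp: flags_def simp flip: g(2))
  then show ?thesis
    using assms(4,5) by (auto simp: perp_def)
qed

section \<open>Flags transversal to their conjugates\<close>

text \<open>Weaker than isotropy, yet strong enough for the condition on \<open>w\<close>. Unlike
  isotropy it holds for some flag in every nonempty open set of flags
  (\<open>open_meets_generic\<close>).\<close>

definition generic_flag :: "'n::{finite,linorder} flag \<Rightarrow> bool" where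
  "generic_flag V \<longleftrightarrow> (\<forall>i\<le>CARD('n). V i \<inter> cj ` V (CARD('n) - i) \<subseteq> {0})"

text \<open>A common vector has the form \<open>cj q\<close> with \<open>q\<close> in
  \<open>V (n - i)\<close>. Isotropy makes it orthogonal to \<open>q\<close>, so the Hermitian norm
  of \<open>q\<close> is zero.\<close>

lemma isotropic_imp_generic:
  fixes V :: "'n::{finite,linorder} flag"
  assumes "V \<in> flags" "isotropic_flag V"
  shows "generic_flag V"
  unfolding generic_flag_def
proof (intro allI impI subsetI)
  fix i x assume i: "i \<le> CARD('n)" and x: "x \<in> V i \<inter> cj ` V (CARD('n) - i)"
  then obtain q where q: "q \<in> V (CARD('n) - i)" "x = cj q"
    by blast
  have "bilin (cj q) q = 0"
    by (rule isotropic_orthogonal[OF assms, of i "CARD('n) - i"]) (use i x q in auto)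
  then show "x \<in> {0}"
    using bilin_cj_eq_0[of q] q(2) by simp
qed

text \<open>The subspaces \<open>std k\<close> are real, so \<open>V t \<inter> std k\<close> and the conjugate of
  \<open>V (n - t) \<inter> std k\<close> are independent subspaces of \<open>std k\<close>.\<close>

lemma generic_dim_le:
  fixes V :: "'n::{finite,linorder} flag"
  assumes V: "V \<in> flags" "generic_flag V" and t: "t \<le> CARD('n)"
  shows "vec.dim (V t \<inter> std k) + vec.dim (V (CARD('n) - t) \<inter> std k) \<le> min k CARD('n)"
proof -
  let ?P = "V t \<inter> std k" and ?Q = "V (CARD('n) - t) \<inter> std k"
  have sub: "vec.subspace (V i)" for i
    using V(1) by (simp add: flags_def)
  have P: "vec.subspace ?P" and Q: "vec.subspace ?Q"
    by (intro vec.subspace_inter sub subspace_std)+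
  have "?P \<inter> cj ` ?Q \<subseteq> V t \<inter> cj ` V (CARD('n) - t)"
    by blast
  also have "\<dots> \<subseteq> {0}"
    using V(2) t by (simp add: generic_flag_def)
  finally have "vec.dim (?P \<inter> cj ` ?Q) = 0"
    by simp
  moreover have "{x + y |x y. x \<in> ?P \<and> y \<in> cj ` ?Q} \<subseteq> std k"
    using cj_std subspace_std[of k] by (auto intro: vec.subspace_add)
  then have "vec.dim {x + y |x y. x \<in> ?P \<and> y \<in> cj ` ?Q} \<le> vec.dim (std k :: (complex, 'n) vec set)"
    by (rule vec.dim_subset)
  ultimately show ?thesis
    using vec.dim_sums_Int[OF P subspace_cj[OF Q]] unfolding dim_cj[OF Q] dim_std by linarith
qed

text \<open>Altogether \<open>min k n\<close> values are at most \<open>k\<close>. Subtracting those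
  in the first \<open>n - t\<close> positions leaves those in the last \<open>t\<close>, which the
  reflection \<open>n + 1 - i\<close> indexes.\<close>

lemma dominatedI:
  assumes w: "w permutes {1..n}"
    and le: "\<And>t k. t \<le> n \<Longrightarrow> rank_count w t k + rank_count w (n - t) k \<le> min k n"
  shows "dominated n w"
  unfolding dominated_def
proof (intro allI impI)
  fix t k assume "t \<le> n div 2"
  then have t: "t \<le> n"
    by simp
  let ?H = "{i\<in>{n - t + 1..n}. w i \<le> k}"
  have "{i\<in>{1..n}. w i \<le> k} = {i\<in>{1..n - t}. w i \<le> k} \<union> ?H"
    by auto
  moreover have "{i\<in>{1..n - t}. w i \<le> k} \<inter> ?H = {}"
    by auto
  ultimately have "card {i\<in>{1..n}. w i \<le> k} = rank_count w (n - t) k + card ?H"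
    by (simp add: rank_count_def card_Un_disjoint)
  moreover have "card {i\<in>{1..n}. w i \<le> k} = min k n"
  proof -
    have "w ` {i\<in>{1..n}. w i \<le> k} = {1..min k n}"
    proof (intro Set.set_eqI iffI)
      fix y assume y: "y \<in> {1..min k n}"
      then have "y \<in> w ` {1..n}"
        using permutes_image[OF w] by simp
      then show "y \<in> w ` {i\<in>{1..n}. w i \<le> k}"
        using y by auto
    next
      fix y assume "y \<in> w ` {i\<in>{1..n}. w i \<le> k}"
      then obtain i where i: "i \<in> {1..n}" "y = w i" "w i \<le> k"
        by blast
      then have "w i \<in> {1..n}"
        using permutes_in_image[OF w] by blast
      then show "y \<in> {1..min k n}"
        using i by simp
    qed
    moreover have "card (w ` {i\<in>{1..n}. w i \<le> k}) = card {i\<in>{1..n}. w i \<le> k}"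
      by (intro card_image inj_on_subset[OF permutes_inj[OF w]]) simp
    ultimately show ?thesis
      by simp
  qed
  moreover have "card ?H = card {i\<in>{1..t}. w (n + 1 - i) \<le> k}"
  proof (rule bij_betw_same_card)
    show "bij_betw (\<lambda>i. n + 1 - i) ?H {i\<in>{1..t}. w (n + 1 - i) \<le> k}"
      by (rule bij_betw_byWitness[where f' = "\<lambda>i. n + 1 - i"]) (use t in auto)
  qed
  ultimately show "card {i\<in>{1..t}. w i \<le> k} \<le> card {i\<in>{1..t}. w (n + 1 - i) \<le> k}"
    using le[OF t, of k] unfolding rank_count_def by linarith
qed

lemma generic_imp_dominated:
  fixes V :: "'n::{finite,linorder} flag"
  assumes w: "w permutes {1..CARD('n)}" and V: "V \<in> schubert_variety w" "generic_flag V"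
  shows "dominated CARD('n) w"
proof (rule dominatedI[OF w])
  fix t k :: nat assume t: "t \<le> CARD('n)"
  have "V \<in> flags"
    using V(1) schubert_variety_subset_flags by blast
  then show "rank_count w t k + rank_count w (CARD('n) - t) k \<le> min k CARD('n)"
    using generic_dim_le[OF _ V(2) t, of k] dim_schubert_variety[OF w V(1) t, of k]
      dim_schubert_variety[OF w V(1), of "CARD('n) - t" k] by simp
qed

text \<open>The ranks of \<open>a\<close> and \<open>opp a\<close> add up to \<open>n + 1\<close>,
  so the two subspaces defining \<open>L a\<close> share a nonzero vector, and conjugation exchanges
  \<open>L a\<close> with \<open>L (opp a)\<close>. One vector per pair, with its conjugate as
  partner, yields columns that conjugation reverses.\<close>

lemma generic_adapted:
  fixes V :: "'n::{finite,linorder} flag"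
  assumes V: "V \<in> flags" "generic_flag V"
  obtains g where "det g \<noteq> 0" "V = flag_of g" "mcj g = g ** J"
proof -
  have sub: "vec.subspace (V i)" and dim: "vec.dim (V i) = min i CARD('n)" for i
    using V(1) by (auto simp: flags_def)
  define L where "L a = V (rk a) \<inter> cj ` V (rk (opp a))" for a :: 'n
  have L: "vec.subspace (L a)" for a
    unfolding L_def by (intro vec.subspace_inter sub subspace_cj)
  have cjL: "cj x \<in> L (opp a)" if x: "x \<in> L a" for x a
    using x unfolding L_def by (auto intro: image_eqI[of _ _ x])
  have "\<exists>x. x \<in> L a \<and> x \<noteq> 0" for a
  proof (rule ccontr)
    assume "\<nexists>x. x \<in> L a \<and> x \<noteq> 0"
    then have "vec.dim (L a) = 0"
      by (subst vec.dim_eq_0) blast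
    then have "vec.dim {x + y |x y. x \<in> V (rk a) \<and> y \<in> cj ` V (rk (opp a))} = CARD('n) + 1"
      using vec.dim_sums_Int[OF sub[of "rk a"] subspace_cj[OF sub[of "rk (opp a)"]]] rk_opp_add[of a]
        rk_le[of a] rk_le[of "opp a"] unfolding dim_cj[OF sub] dim L_def by linarith
    moreover have "vec.dim {x + y |x y. x \<in> V (rk a) \<and> y \<in> cj ` V (rk (opp a))} \<le> CARD('n)"
      using vec.dim_subset_UNIV by (simp add: vec.dimension_def card_cart_basis)
    ultimately show False
      by simp
  qed
  then have "\<forall>a. \<exists>x. x \<in> L a \<and> x \<noteq> 0"
    by blast
  from choice[OF this] obtain u where u: "\<And>a. u a \<in> L a" "\<And>a. u a \<noteq> 0"
    by blast
  \<comment> \<open>The middle index \<open>opp a = a\<close> of odd \<open>n\<close> requires a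
    real vector: twice the real part of \<open>u a\<close>, or \<open>\<i> *s u a\<close> if
    \<open>u a\<close> is purely imaginary.\<close>
  define v where "v a = (if a < opp a then u a else if opp a < a then cj (u (opp a))
    else if u a + cj (u a) \<noteq> 0 then u a + cj (u a) else \<i> *s u a)" for a
  have vL: "v a \<in> L a" for a
  proof -
    consider "a < opp a" | "opp a < a" | "opp a = a"
      by fastforce
    then show ?thesis
    proof cases
      case 2
      then show ?thesis
        using cjL[OF u(1)[of "opp a"]] by (auto simp: v_def)
    next
      case 3
      then have "cj (u a) \<in> L a"
        using cjL[OF u(1)[of a]] by simp
      then show ?thesis
        using 3 u(1)[of a] vec.subspace_add[OF L] vec.subspace_scale[OF L] by (simp add: v_def)
    qed (use u in \<open>simp add: v_def\<close>)
  qed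
  have v0: "v a \<noteq> 0" for a
    using u(2)[of a] u(2)[of "opp a"] by (simp add: v_def)
  have cjv: "cj (v a) = v (opp a)" for a
  proof -
    consider "a < opp a" | "opp a < a" | "opp a = a"
      by fastforce
    then show ?thesis
    proof cases
      case 3
      show ?thesis
      proof (cases "u a + cj (u a) = 0")
        case True
        then have "cj (u a) = - u a"
          by (simp add: add_eq_0_iff)
        then show ?thesis
          using 3 True by (simp add: v_def cj_scale vec_eq_iff)
      next
        case False
        then show ?thesis
          using 3 by (simp add: v_def cj_add add.commute)
      qed
    qed (auto simp: v_def)
  qed
  have v1: "v a \<in> V (rk a)" for a
    using vL[of a] by (simp add: L_def)
  have v2: "v a \<notin> V (rk a - 1)" for a
  proof
    assume "v a \<in> V (rk a - 1)"
    \<comment> \<open>The rank of \<open>opp a\<close> is \<open>n - (rk a - 1)\<close>, so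
      transversality at the index \<open>rk a - 1\<close> applies.\<close>
    moreover have "v a \<in> cj ` V (CARD('n) - (rk a - 1))"
      using vL[of a] rk_opp[of a] rk_pos[of a] rk_le[of a] by (simp add: L_def Suc_diff_le)
    moreover have "V (rk a - 1) \<inter> cj ` V (CARD('n) - (rk a - 1)) \<subseteq> {0}"
      using V(2) rk_le[of a] unfolding generic_flag_def by auto
    ultimately show False
      using v0[of a] by blast
  qed
  define g where "g = (\<chi> i j. v j $ i)"
  have "mcj g = g ** J"
    unfolding vec_eq_iff mult_J_nth by (simp add: g_def flip: cjv)
  then show ?thesis
    using that[of g] flag_of_adapted[OF V(1), of v, OF v1 v2] by (simp add: g_def)
qed

text \<open>Isotropy kills the Gram entries above the antidiagonal, and
  \<open>mcj g = g ** J\<close> reflects this to those below. On the antidiagonal stand the squared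
  column norms, positive and equal for \<open>a\<close> and \<open>opp a\<close>, so a diagonal
  rescaling turns them into 1.\<close>

lemma isotropic_adapted:
  fixes V :: "'n::{finite,linorder} flag"
  assumes V: "V \<in> flags" "isotropic_flag V"
  obtains g where "det g \<noteq> 0" "V = flag_of g" "transpose g ** g = J"
proof -
  obtain g where g: "det g \<noteq> 0" "V = flag_of g" "mcj g = g ** J"
    using generic_adapted[OF V(1) isotropic_imp_generic[OF V]] by blast
  have g_opp: "g $ i $ opp a = cnj (g $ i $ a)" for i a
    using g(3) by (simp add: vec_eq_iff mult_J_nth)
  define M where "M = transpose g ** g"
  have M_nth: "M $ a $ b = (\<Sum>i\<in>UNIV. g $ i $ a * g $ i $ b)" for a b
    unfolding M_def by (rule gram_sum)
  have M_opp: "M $ opp a $ opp b = cnj (M $ a $ b)" for a b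
    by (simp add: M_nth g_opp cnj_sum)
  have M0: "M $ a $ b = 0" if "rk a + rk b \<le> CARD('n)" for a b
    using V(2) that unfolding g(2) isotropic_flag_of_iff[OF g(1)] M_def by blast
  have M1: "M $ a $ b = 0" if "a \<noteq> opp b" for a b
  proof (cases "rk a + rk b \<le> CARD('n)")
    case False
    have "rk a \<noteq> rk (opp b)"
      using that by simp
    then have "rk (opp a) + rk (opp b) \<le> CARD('n)"
      using False rk_opp_add[of a] rk_opp_add[of b] by linarith
    then have "cnj (M $ a $ b) = 0"
      using M0 M_opp by metis
    then show ?thesis
      by simp
  qed (rule M0)
  define d where "d a = (\<Sum>i\<in>UNIV. (cmod (g $ i $ a))\<^sup>2)" for a
  have Md: "M $ a $ opp a = complex_of_real (d a)" for a
    unfolding d_def of_real_sum complex_norm_square by (simp add: M_nth g_opp)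
  have d_opp: "d (opp a) = d a" for a
    by (simp add: d_def g_opp)
  have d_pos: "0 < d a" for a
  proof -
    have "d a \<noteq> 0"
    proof
      assume "d a = 0"
      then have "\<forall>i\<in>UNIV. (cmod (g $ i $ a))\<^sup>2 = 0"
        unfolding d_def by (subst (asm) sum_nonneg_eq_0_iff) auto
      then have "g *v axis a 1 = g *v 0"
        by (simp add: vec_eq_iff mult_axis_nth)
      then have "axis a (1 :: complex) = 0"
        using inj_mult[OF g(1)] by (simp only: inj_eq)
      then show False
        by (simp add: axis_eq_0_iff)
    qed
    moreover have "0 \<le> d a"
      by (simp add: d_def sum_nonneg)
    ultimately show ?thesis
      by simp
  qed
  define s where "s a = complex_of_real (sqrt (d a))" for a
  have s: "s a \<noteq> 0" "s a * s a = complex_of_real (d a)" "s (opp a) = s a" for a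
    using d_pos[of a] by (simp_all add: s_def d_opp flip: of_real_mult)
  define t where "t = (\<chi> i j. if i = j then 1 / s i else 0 :: 'n cmat)"
  have t: "upper t" "det t \<noteq> 0"
  proof -
    show "upper t"
      by (simp add: upper_def t_def)
    then show "det t \<noteq> 0"
      by (rule det_upper_nonzero) (simp add: t_def s)
  qed
  have gt: "(g ** t) $ i $ a = g $ i $ a / s a" for i a
  proof -
    have "(g ** t) $ i $ a = (\<Sum>k\<in>UNIV. if k = a then g $ i $ a / s a else 0)"
      unfolding matrix_matrix_mult_def t_def vec_lambda_beta by (rule sum.cong) auto
    then show ?thesis
      by simp
  qed
  have "transpose (g ** t) ** (g ** t) = J"
    unfolding vec_eq_iff
  proof (intro allI)
    fix a b :: 'n
    have "(transpose (g ** t) ** (g ** t)) $ a $ b = (\<Sum>i\<in>UNIV. (g ** t) $ i $ a * (g ** t) $ i $ b)"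
      by (rule gram_sum)
    also have "\<dots> = M $ a $ b / (s a * s b)"
      by (simp add: gt M_nth sum_divide_distrib)
    also have "\<dots> = J $ a $ b"
    proof (cases "a = opp b")
      case True
      then have "b = opp a"
        by simp
      then show ?thesis
        using s[of a] d_pos[of a] by (simp add: Md J_def)
    qed (simp add: M1 J_def)
    finally show "(transpose (g ** t) ** (g ** t)) $ a $ b = J $ a $ b" .
  qed
  moreover have "V = flag_of (g ** t)"
    using flag_of_mult_upper[OF t] g(2) by simp
  moreover have "det (g ** t) \<noteq> 0"
    using g(1) t(2) by (simp add: det_mul)
  ultimately show ?thesis
    using that by blast
qed

section \<open>Open orbits\<close>

text \<open>Along the line the determinant is a polynomial in \<open>t\<close> that does not vanish
  at \<open>t = 1\<close>.\<close>

lemma finite_singular_pencil: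
  fixes A B :: "'n::finite cmat"
  assumes B: "det B \<noteq> 0"
  shows "finite {t :: real. det ((1 - t) *\<^sub>R A + t *\<^sub>R B) = 0}"
proof -
  define p where "p = det (\<chi> i j. [:A $ i $ j, B $ i $ j - A $ i $ j:])"
  have p: "poly p (complex_of_real t) = det ((1 - t) *\<^sub>R A + t *\<^sub>R B)" for t
  proof -
    have "poly p z = det (\<chi> i j. A $ i $ j + z * (B $ i $ j - A $ i $ j))" for z
      by (simp add: p_def det_def poly_sum poly_prod)
    moreover have "(\<chi> i j. A $ i $ j + complex_of_real t * (B $ i $ j - A $ i $ j)) = (1 - t) *\<^sub>R A + t *\<^sub>R B"
      by (simp add: vec_eq_iff) (simp add: scaleR_conv_of_real algebra_simps)
    ultimately show ?thesis
      by simp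
  qed
  have "poly p 1 \<noteq> 0"
    using p[of 1] B by simp
  then have "p \<noteq> 0"
    by auto
  then have "finite (complex_of_real -` {z. poly p z = 0})"
    by (intro finite_vimageI poly_roots_finite) (simp_all add: inj_on_def)
  then show ?thesis
    by (simp add: p vimage_def)
qed

text \<open>Its columns are the first \<open>i\<close> columns of \<open>h\<close>, followed by the
  conjugates of the first \<open>n - i\<close> columns in reverse order. They span member
  \<open>i\<close> of the flag and the conjugate of member \<open>n - i\<close>, and they depend on
  \<open>h\<close> in a real linear way.\<close>

definition mixed :: "nat \<Rightarrow> 'n::{finite,linorder} cmat \<Rightarrow> 'n cmat" where
  "mixed i h = h ** (mat 1 - tail_mat i) + mcj h ** (J ** tail_mat i)"

lemma matrix_mult_distribs:
  fixes A B C :: "'n::finite cmat"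
  shows "(A + B) ** C = A ** C + B ** C" "A ** (B + C) = A ** B + A ** C"
    "(A - B) ** C = A ** C - B ** C" "A ** (B - C) = A ** B - A ** C"
    "(r *\<^sub>R A) ** B = r *\<^sub>R (A ** B)" "A ** (r *\<^sub>R B) = r *\<^sub>R (A ** B)"
  by (simp_all add: vec_eq_iff matrix_matrix_mult_def sum.distrib sum_subtractf algebra_simps scaleR_sum_right)

lemma mixed_line:
  "mixed i ((1 - t) *\<^sub>R A + t *\<^sub>R B) = (1 - t) *\<^sub>R mixed i A + t *\<^sub>R mixed i B"
proof -
  have "mcj ((1 - t) *\<^sub>R A + t *\<^sub>R B) = (1 - t) *\<^sub>R mcj A + t *\<^sub>R mcj B"
    by (simp add: vec_eq_iff)
  then show ?thesis
    unfolding mixed_def by (simp only: matrix_mult_distribs) (simp add: algebra_simps)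
qed

lemma mixed_adapted: "mcj g = g ** J \<Longrightarrow> mixed i g = g"
proof -
  assume "mcj g = g ** J"
  then have "mcj g ** (J ** tail_mat i) = g ** tail_mat i"
    by (metis J_J matrix_mul_assoc matrix_mul_lid)
  then show ?thesis
    by (simp add: mixed_def matrix_mult_distribs)
qed

lemma generic_flag_ofI:
  fixes h :: "'n::{finite,linorder} cmat"
  assumes det: "\<And>i. i \<le> CARD('n) \<Longrightarrow> det (mixed i h) \<noteq> 0"
  shows "generic_flag (flag_of h)"
  unfolding generic_flag_def
proof (intro allI impI subsetI)
  fix i x assume i: "i \<le> CARD('n)" and x: "x \<in> flag_of h i \<inter> cj ` flag_of h (CARD('n) - i)"
  then obtain p q where p: "p \<in> std i" "x = h *v p" and q: "q \<in> std (CARD('n) - i)" "x = cj (h *v q)"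
    by (auto simp: flag_of_apply)
  \<comment> \<open>\<open>p\<close> occupies the ranks up to \<open>i\<close> and the reversed
    \<open>q\<close> those above. With opposite signs they combine into one kernel vector of
    \<open>mixed i h\<close>.\<close>
  define z where "z = (\<chi> a. if rk a \<le> i then p $ a else - cnj (q $ opp a))"
  have "(mat 1 - tail_mat i) *v z = p"
    using p(1) by (auto simp: vec_eq_iff matrix_vector_mult_diff_rdistrib tail_mat_nth z_def std_def)
  moreover have "(J ** tail_mat i) *v z = - cj q"
    unfolding vec_eq_iff
  proof
    fix a :: 'n
    have "((J ** tail_mat i) *v z) $ a = (if i < rk (opp a) then z $ opp a else 0)"
      by (simp add: J_vec_nth tail_mat_nth flip: matrix_vector_mul_assoc)
    moreover have "i < rk (opp a) \<longleftrightarrow> rk a \<le> CARD('n) - i"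
      using rk_opp_add[of a] i by linarith
    ultimately show "((J ** tail_mat i) *v z) $ a = (- cj q) $ a"
      using q(1) by (auto simp: z_def std_def)
  qed
  moreover have "mcj h *v (- cj q) = - x"
    unfolding q(2) cj_mult by (rule vec.neg)
  ultimately have "mixed i h *v z = 0"
    by (simp add: mixed_def matrix_vector_mult_add_rdistrib p(2) flip: matrix_vector_mul_assoc[of h] matrix_vector_mul_assoc[of "mcj h"])
  then have "mixed i h *v z = mixed i h *v 0"
    by simp
  then have "z = 0"
    using inj_mult[OF det[OF i]] by (simp only: inj_eq)
  then have "p = 0"
    using p(1) by (auto simp: vec_eq_iff z_def std_def) (metis linorder_not_le)
  then show "x \<in> {0}"
    using p(2) by simp
qed

text \<open>Join a matrix over \<open>D\<close> to the adapted \<open>g\<close> by a real line. At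
  \<open>g\<close> each \<open>mixed i\<close> equals \<open>g\<close>, hence is invertible, so only
  finitely many points of the line fail, and all points near the start still lie over
  \<open>D\<close>.\<close>

lemma open_meets_generic:
  fixes g :: "'n::{finite,linorder} cmat" and D :: "'n flag set"
  assumes D: "openin flag_topology D" "D \<noteq> {}" and g: "det g \<noteq> 0" "mcj g = g ** J"
  obtains h where "det h \<noteq> 0" "flag_of h \<in> D" "generic_flag (flag_of h)"
proof -
  obtain V where V: "V \<in> D"
    using D(2) by blast
  then have "V \<in> flags"
    using openin_subset[OF D(1)] by auto
  then obtain h where h: "det h \<noteq> 0" "flag_of h \<in> D"
    using V by (metis flag_obtain)
  define H where "H t = (1 - t) *\<^sub>R h + t *\<^sub>R g" for t
  have "open {k. det k \<noteq> 0 \<and> flag_of k \<in> D}"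
    using D(1) by (simp add: openin_flag_topology_iff)
  moreover have "continuous_on UNIV H"
    unfolding H_def by (intro continuous_intros)
  ultimately have op: "open (H -` {k. det k \<noteq> 0 \<and> flag_of k \<in> D})"
    by (rule open_vimage)
  have "0 \<in> H -` {k. det k \<noteq> 0 \<and> flag_of k \<in> D}"
    using h by (simp add: H_def)
  with op have "\<exists>e>0. ball 0 e \<subseteq> H -` {k. det k \<noteq> 0 \<and> flag_of k \<in> D}"
    unfolding open_contains_ball by (rule bspec)
  then obtain e where e: "0 < e" "ball 0 e \<subseteq> H -` {k. det k \<noteq> 0 \<and> flag_of k \<in> D}"
    by (elim exE conjE) (rule that)
  let ?F = "\<Union>i\<in>{..CARD('n)}. {t. det (mixed i (H t)) = 0}"
  have "finite {t. det (mixed i (H t)) = 0}" for i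
    unfolding H_def mixed_line
    by (rule finite_singular_pencil) (simp add: mixed_adapted[OF g(2)] g(1))
  then have finF: "finite ?F"
    by simp
  have inf: "infinite (ball 0 e :: real set)"
    using e(1) by (simp add: ball_eq_greaterThanLessThan infinite_Ioo)
  have "\<not> ball 0 e \<subseteq> ?F"
  proof
    assume "ball 0 e \<subseteq> ?F"
    from finite_subset[OF this finF] inf show False
      by contradiction
  qed
  then have "\<exists>t. t \<in> ball 0 e \<and> t \<notin> ?F"
    by (simp only: subset_iff not_all not_imp)
  then obtain t where t: "t \<in> ball 0 e" "t \<notin> ?F"
    by (elim exE conjE) (rule that)
  have "generic_flag (flag_of (H t))"
    by (rule generic_flag_ofI) (use t(2) in auto)
  moreover have "det (H t) \<noteq> 0" "flag_of (H t) \<in> D"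
    using e(2) t(1) by auto
  ultimately show ?thesis
    using that by blast
qed

text \<open>As \<open>d\<close> is positive, \<open>1 / d\<close> has a real \<open>n\<close>-th
  root for even \<open>n\<close> as well. Scaling by it leads into \<open>SL_R\<close> and fixes all
  flags.\<close>

lemma real_orbit_mult:
  fixes A h :: "'n::{finite,linorder} cmat"
  assumes D: "D = orbit_of SL_R V" "V \<in> flags" and h: "flag_of h \<in> D"
    and A: "mcj A = A" "det A = complex_of_real d" "0 < d"
  shows "flag_of (A ** h) \<in> D"
proof -
  obtain g where g: "det g \<noteq> 0" "V = flag_of g"
    using flag_obtain[OF D(2)] by blast
  obtain s where s: "s \<in> SL_R" "flag_of h = flag_of (s ** g)"
    using h unfolding D(1) g(2) orbit_of_def by (auto simp: act_flag_of)
  define c where "c = root CARD('n) (1 / d)"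
  have c: "c ^ CARD('n) = 1 / d"
    unfolding c_def using A(3) by (intro real_root_pow_pos2) auto
  let ?C = "mat (complex_of_real c) :: 'n cmat"
  have A_real: "A $ i $ j \<in> \<real>" for i j
    using A(1) by (simp add: vec_eq_iff complex_is_Real_iff complex_eq_iff)
  have "?C ** A ** s \<in> SL_R"
  proof -
    have "(?C ** A ** s) $ i $ j \<in> \<real>" for i j
      unfolding matrix_matrix_mult_def vec_lambda_beta
      using A_real s(1) by (intro sum_in_Reals Reals_mult) (auto simp: mat_def SL_R_def)
    moreover have "complex_of_real c ^ CARD('n) * complex_of_real d = 1"
      using c A(3) by (simp flip: of_real_power of_real_mult)
    ultimately show ?thesis
      using s(1) by (simp add: SL_R_def SL_C_def det_mul det_mat A(2))
  qed
  moreover have "flag_of (A ** h) = act (?C ** A ** s) V"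
  proof -
    have "flag_of (A ** h) = act A (flag_of (s ** g))"
      by (simp add: act_flag_of flip: s(2))
    also have "\<dots> = flag_of (A ** s ** g ** ?C)"
    proof -
      have "det ?C \<noteq> 0"
        using c A(3) by (simp add: det_mat flip: of_real_power)
      then show ?thesis
        by (simp add: act_flag_of flag_of_mult_upper[OF upper_mat] matrix_mul_assoc)
    qed
    also have "A ** s ** g ** ?C = ?C ** A ** s ** g"
      by (simp only: mat_commute[symmetric] matrix_mul_assoc)
    finally show ?thesis
      by (simp add: g(2) act_flag_of)
  qed
  ultimately show ?thesis
    unfolding D(1) orbit_of_def by blast
qed

lemma complex_det_real:
  assumes "mcj A = A"
  shows "det A = complex_of_real (Re (det A))"
proof -
  have "cnj (det A) = det A"
    using det_mcj[of A] assms by simp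
  then show ?thesis
    by (simp add: complex_eq_iff)
qed

text \<open>Two adapted bases with determinants of opposite sign: one of them is reached by a real matrix
  of positive determinant.\<close>

lemma orbit_contains_adapted:
  fixes g g' :: "'n::{finite,linorder} cmat"
  assumes D: "open_real_orbit D" and g: "det g \<noteq> 0" "mcj g = g ** J" and g': "det g' = - det g" "mcj g' = g' ** J"
  shows "flag_of g \<in> D \<or> flag_of g' \<in> D"
proof -
  obtain V where V: "V \<in> flags" "D = orbit_of SL_R V" "openin flag_topology D"
    using D by (auto simp: open_real_orbit_def)
  have "mat 1 \<in> (SL_R :: 'n cmat set)"
    by (simp add: SL_R_def SL_C_def mat_def[of 1]) (simp flip: mat_def)
  then have "D \<noteq> {}"
    using V(2) by (auto simp: orbit_of_def)
  obtain h where h: "det h \<noteq> 0" "flag_of h \<in> D" "generic_flag (flag_of h)"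
    using open_meets_generic[OF V(3) \<open>D \<noteq> {}\<close> g] by blast
  obtain k where k: "det k \<noteq> 0" "flag_of h = flag_of k" "mcj k = k ** J"
    using generic_adapted[OF flag_of_in_flags[OF h(1)] h(3)] by blast
  obtain k' where k': "k ** k' = mat 1" "k' ** k = mat 1"
    using k(1) by (auto simp flip: invertible_det_nz simp: invertible_def)
  have mcj_k': "mcj k' = J ** k'"
  proof -
    have "(k ** J) ** mcj k' = mat 1"
      using arg_cong[OF k'(1), of mcj] by (simp add: mcj_mult k(3))
    then have "J ** mcj k' = k'"
      by (metis k'(2) matrix_mul_assoc matrix_mul_lid matrix_mul_rid)
    then show ?thesis
      by (metis J_J matrix_mul_assoc matrix_mul_lid)
  qed
  \<comment> \<open>Conjugation multiplies both \<open>f\<close> and \<open>k\<close> by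
    \<open>J\<close> on the right, and the two factors cancel in the quotient
    \<open>f ** k'\<close>.\<close>
  have real: "mcj (f ** k') = f ** k'" if "mcj f = f ** J" for f
  proof -
    have "mcj (f ** k') = f ** (J ** J) ** k'"
      by (simp add: mcj_mult that mcj_k' matrix_mul_assoc)
    then show ?thesis
      by (simp add: J_J)
  qed
  have in_D: "flag_of f \<in> D" if "mcj f = f ** J" "0 < Re (det (f ** k'))" for f
  proof -
    have "flag_of (f ** k' ** k) \<in> D"
      using h(2) by (intro real_orbit_mult[OF V(2,1) _ real[OF that(1)] complex_det_real[OF real[OF that(1)]] that(2)])
        (simp add: k(2))
    then show ?thesis
      by (simp add: k'(2) flip: matrix_mul_assoc)
  qed
  have "det k' \<noteq> 0"
    using arg_cong[OF k'(1), of det] by (auto simp: det_mul)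
  then have "det (g ** k') \<noteq> 0"
    using g(1) by (simp add: det_mul)
  then have "Re (det (g ** k')) \<noteq> 0"
    using complex_det_real[OF real[OF g(2)]] by auto
  moreover have "Re (det (g' ** k')) = - Re (det (g ** k'))"
    by (simp add: det_mul g'(1))
  ultimately show ?thesis
    using in_D[OF g(2)] in_D[OF g'(2)] by linarith
qed

section \<open>Explicit isotropic flags in the cells of spaced permutations\<close>

text \<open>For \<open>a < opp a\<close> the columns \<open>a\<close> and \<open>opp a\<close> are
  \<open>axis a 1 + e a *s axis (opp a) 1\<close> and its conjugate. The definitions
  \<open>cross_low\<close> and \<open>cross_upp\<close> give a triangular factorisation, which
  locates the flag in a Schubert cell.\<close>

definition cross :: "('n::{finite,linorder} \<Rightarrow> complex) \<Rightarrow> 'n cmat" where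
  "cross e = (\<chi> i a. if a < opp a then if i = a then 1 else if i = opp a then e a else 0
     else if opp a < a then if i = opp a then 1 else if i = a then cnj (e (opp a)) else 0
     else if i = a then 1 else 0)"

definition cross_low :: "('n::{finite,linorder} \<Rightarrow> complex) \<Rightarrow> 'n cmat" where
  "cross_low e = (\<chi> i a. if a < opp a \<and> i = opp a then e a else 0)"

definition cross_upp :: "('n::{finite,linorder} \<Rightarrow> complex) \<Rightarrow> 'n cmat" where
  "cross_upp e = (\<chi> i a. if opp a < a then if i = opp a then 1
     else if i = a then cnj (e (opp a)) - e (opp a) else 0 else if i = a then 1 else 0)"

lemma mcj_cross: "mcj (cross e) = cross e ** J"
  unfolding vec_eq_iff mult_J_nth
proof (intro allI)
  fix i a :: 'a
  consider "a < opp a" | "opp a < a" | "opp a = a"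
    by fastforce
  then show "mcj (cross e) $ i $ a = cross e $ i $ opp a"
    by cases (auto simp: cross_def)
qed

lemma cross_factor: "cross e = (mat 1 + cross_low e) ** cross_upp e"
proof (rule matrix_eq_on_axes)
  fix a :: 'a
  show "cross e *v axis a 1 = ((mat 1 + cross_low e) ** cross_upp e) *v axis a 1"
  proof (cases "opp a < a")
    case True
    then have "cross_upp e *v axis a 1 = axis (opp a) 1 + (cnj (e (opp a)) - e (opp a)) *s axis a 1"
      by (auto simp: vec_eq_iff mult_axis_nth) (auto simp: cross_upp_def axis_def)
    then have "((mat 1 + cross_low e) ** cross_upp e) *v axis a 1 =
        (mat 1 + cross_low e) *v axis (opp a) 1 + (cnj (e (opp a)) - e (opp a)) *s ((mat 1 + cross_low e) *v axis a 1)"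
      by (simp only: vec.add vec.scale flip: matrix_vector_mul_assoc)
    then show ?thesis
      using True by (simp add: vec_eq_iff mult_axis_nth) (auto simp: cross_def cross_low_def mat_def)
  next
    case False
    then have "cross_upp e *v axis a 1 = axis a 1"
      by (auto simp: vec_eq_iff mult_axis_nth) (auto simp: cross_upp_def axis_def)
    then have "((mat 1 + cross_low e) ** cross_upp e) *v axis a 1 = (mat 1 + cross_low e) *v axis a 1"
      by (simp flip: matrix_vector_mul_assoc)
    then show ?thesis
      using False by (simp add: vec_eq_iff mult_axis_nth) (auto simp: cross_def cross_low_def mat_def)
  qed
qed

lemma cross_low_strictly_lower: "cross_low e \<in> strictly_lower"
  by (auto simp: cross_low_def strictly_lower_def)

lemma upper_cross_upp: "upper (cross_upp e)"
  by (auto simp: cross_upp_def upper_def)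

lemma det_cross_upp:
  assumes "\<And>a. cnj (e a) \<noteq> e a"
  shows "det (cross_upp e) \<noteq> 0"
  by (rule det_upper_nonzero[OF upper_cross_upp]) (use assms in \<open>auto simp: cross_upp_def\<close>)

lemma det_cross:
  assumes "\<And>a. cnj (e a) \<noteq> e a"
  shows "det (cross e) \<noteq> 0"
  unfolding cross_factor det_mul
  using det_unipotent[OF cross_low_strictly_lower[of e]] det_cross_upp[of e] assms by auto

text \<open>The lower factor has entries only in row \<open>opp a\<close> and column
  \<open>a\<close>, and spacing makes these positions inversions. So \<open>perm_conjugate\<close>
  moves it to the left as an upper triangular matrix, while the upper factor does not change the
  flag.\<close>

lemma perm_mat_cross_in_cell:
  fixes e :: "'n::{finite,linorder} \<Rightarrow> complex"
  assumes w: "w permutes {1..CARD('n)}" and sp: "spacing_condition CARD('n) w"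
    and e: "\<And>a. cnj (e a) \<noteq> e a"
  shows "flag_of (perm_mat w ** cross e) \<in> schubert_cell w"
proof -
  have "w (rk (opp a)) < w (rk a)" if "a < opp a" for a :: 'n
  proof -
    have "rk a < rk (opp a)"
      using that by (simp add: rk_less_iff)
    then have "rk a \<in> {1..CARD('n) div 2}"
      using rk_opp_add[of a] rk_pos[of a] by auto
    then show ?thesis
      using sp by (simp add: spacing_condition_def rk_opp)
  qed
  then have "cross_low e \<in> coord_space (noninv_pairs w)"
    by (auto simp: coord_space_def noninv_pairs_def cross_low_def)
  then obtain c where c: "upper c" "perm_mat w ** (mat 1 + cross_low e) = c ** perm_mat w"
    using perm_conjugate[OF w] by blast
  have "det c \<noteq> 0"
    using arg_cong[OF c(2), of det] det_unipotent[OF cross_low_strictly_lower[of e]] det_perm_mat[OF w]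
    by (auto simp: det_mul)
  moreover have "flag_of (perm_mat w ** cross e) = flag_of (c ** perm_mat w)"
  proof -
    have "perm_mat w ** cross e = c ** perm_mat w ** cross_upp e"
      by (simp only: cross_factor matrix_mul_assoc c(2))
    then show ?thesis
      using flag_of_mult_upper[OF upper_cross_upp det_cross_upp] e by metis
  qed
  ultimately show ?thesis
    unfolding schubert_cell_eq[OF w] using c(1) by blast
qed

lemma perm_mat_mult_nth:
  assumes w: "w permutes {1..CARD('n)}"
  shows "(perm_mat w ** A) $ pos_perm w (i :: 'n::{finite,linorder}) $ a = A $ i $ a"
proof -
  have "(perm_mat w ** A) $ pos_perm w i $ a = (perm_mat w *v (A *v axis a 1)) $ pos_perm w i"
    by (simp add: matrix_vector_mul_assoc mult_axis_nth)
  then show ?thesis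
    by (simp only: perm_mat_nth[OF w] mult_axis_nth)
qed

text \<open>Permuting rows preserves the Gram matrix. Columns of different pairs have disjoint
  supports, the square of a column is \<open>1 + e a * e a = 0\<close>, and the two columns of one
  pair have rank sum \<open>n + 1\<close>, outside the range that isotropy controls.\<close>

lemma isotropic_perm_mat_cross:
  fixes e :: "'n::{finite,linorder} \<Rightarrow> complex"
  assumes w: "w permutes {1..CARD('n)}" and e: "\<And>a. e a * e a = -1" "\<And>a. cnj (e a) \<noteq> e a"
  shows "isotropic_flag (flag_of (perm_mat w ** cross e))"
proof -
  have "det (perm_mat w ** cross e) \<noteq> 0"
    using det_perm_mat[OF w] det_cross[of e] e(2) by (auto simp: det_mul)
  moreover have "(transpose (perm_mat w ** cross e) ** (perm_mat w ** cross e)) $ a $ b = 0"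
    if ab: "rk a + rk b \<le> CARD('n)" for a b
  proof -
    have "(transpose (perm_mat w ** cross e) ** (perm_mat w ** cross e)) $ a $ b =
        (\<Sum>i\<in>UNIV. (perm_mat w ** cross e) $ i $ a * (perm_mat w ** cross e) $ i $ b)"
      by (rule gram_sum)
    also have "\<dots> = (\<Sum>i\<in>UNIV. (perm_mat w ** cross e) $ pos_perm w i $ a * (perm_mat w ** cross e) $ pos_perm w i $ b)"
      using sum.reindex_bij_betw[OF bij_pos_perm[OF w]] by (rule sym)
    also have "\<dots> = (\<Sum>i\<in>UNIV. cross e $ i $ a * cross e $ i $ b)"
      by (simp only: perm_mat_mult_nth[OF w])
    also have "\<dots> = 0"
    proof (cases "a = b")
      case True
      have "rk a < rk (opp a)"
        using ab True rk_opp_add[of a] by simp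
      then have lt: "a < opp a"
        by (simp only: rk_less_iff)
      have "cross e $ i $ a * cross e $ i $ a = (if i = a then 1 else 0) + (if i = opp a then -1 else 0)" for i
        using lt e(1)[of a] by (auto simp: cross_def)
      then show ?thesis
        using True by (simp add: sum.distrib)
    next
      case False
      have "rk a \<noteq> rk (opp b)"
        using ab rk_opp_add[of b] by linarith
      then have "a \<noteq> opp b"
        by auto
      have 0: "cross e $ i $ c = 0" if "i \<noteq> c" "i \<noteq> opp c" for i c
        using that by (simp add: cross_def)
      have "cross e $ i $ a = 0 \<or> cross e $ i $ b = 0" for i
        using 0[of i a] 0[of i b] False \<open>a \<noteq> opp b\<close> by (metis opp_opp)
      then show ?thesis
        by (intro sum.neutral) simp
    qed
    finally show ?thesis .
  qed
  ultimately show ?thesis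
    by (simp add: isotropic_flag_of_iff)
qed

lemma spaced_cell_meets_base_cycle:
  fixes D :: "'n::{finite,linorder} flag set"
  assumes D: "open_real_orbit D" and n: "2 \<le> CARD('n)"
    and w: "w permutes {1..CARD('n)}" and sp: "spacing_condition CARD('n) w"
  shows "schubert_cell w \<inter> base_cycle D \<noteq> {}"
proof -
  define a where "a = (unrk 1 :: 'n)"
  have "rk a = 1"
    using n by (simp add: a_def rk_unrk)
  then have a: "a < opp a"
    using rk_opp_add[of a] n by (simp flip: rk_less_iff)
  define e where "e = (\<lambda>b :: 'n. \<i>)"
  define e' where "e' = (\<lambda>b :: 'n. if b = a then - \<i> else \<i>)"
  have e: "e b * e b = -1" "cnj (e b) \<noteq> e b" "e' b * e' b = -1" "cnj (e' b) \<noteq> e' b" for b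
    by (auto simp: e_def e'_def complex_eq_iff)
  let ?g = "perm_mat w ** cross e" and ?g' = "perm_mat w ** cross e'"
  have "mcj (perm_mat w :: 'n cmat) = perm_mat w"
    by (simp add: vec_eq_iff perm_mat_def)
  then have mcj: "mcj (perm_mat w ** cross f) = perm_mat w ** cross f ** J" for f :: "'n \<Rightarrow> complex"
    by (simp add: mcj_mult mcj_cross matrix_mul_assoc)
  have "det (cross e') = - det (cross e)"
  proof -
    \<comment> \<open>Replacing \<open>\<i>\<close> by its conjugate at \<open>a\<close> exchanges
      the columns \<open>a\<close> and \<open>opp a\<close>, which are distinct because
      \<open>n \<ge> 2\<close>.\<close>
    let ?t = "Transposition.transpose a (opp a)"
    have "cross e' = (\<chi> i j. cross e $ i $ ?t j)"
      unfolding vec_eq_iff vec_lambda_beta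
    proof (intro allI)
      fix i j :: 'n
      consider "j = a" | "j = opp a" | "j \<noteq> a" "j \<noteq> opp a"
        by blast
      then show "cross e' $ i $ j = cross e $ i $ ?t j"
      proof cases
        case 3
        then have "opp j \<noteq> a"
          by auto
        then show ?thesis
          using 3 by (simp add: cross_def e_def e'_def)
      qed (use a in \<open>auto simp: cross_def e_def e'_def\<close>)
    qed
    moreover have "det (\<chi> i j. cross e $ i $ ?t j) = of_int (sign ?t) * det (cross e)"
      by (intro det_permute_columns permutes_swap_id) auto
    ultimately show ?thesis
      using a by (simp add: sign_swap_id)
  qed
  then have "det ?g' = - det ?g"
    by (simp add: det_mul)
  moreover have "det ?g \<noteq> 0"
    using det_perm_mat[OF w] det_cross[of e] e by (simp add: det_mul)
  ultimately have "flag_of ?g \<in> D \<or> flag_of ?g' \<in> D"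
    using orbit_contains_adapted[OF D _ mcj _ mcj] by blast
  moreover have "flag_of ?g \<in> schubert_cell w" "flag_of ?g' \<in> schubert_cell w"
    using perm_mat_cross_in_cell[OF w sp] e by blast+
  moreover have "isotropic_flag (flag_of ?g)" "isotropic_flag (flag_of ?g')"
    using isotropic_perm_mat_cross[OF w] e by blast+
  ultimately show ?thesis
    by (auto simp: base_cycle_def)
qed

section \<open>The base cycle\<close>

text \<open>Cramer's rule, so that continuity of the inverse reduces to continuity of
  determinants.\<close>

definition minv :: "'n::finite cmat \<Rightarrow> 'n cmat" where
  "minv A = (\<chi> k j. det (\<chi> i l. if l = k then axis j 1 $ i else A $ i $ l) / det A)"

lemma minv:
  assumes "det A \<noteq> 0"
  shows "A ** minv A = mat 1" "minv A ** A = mat 1"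
proof -
  have "A *v (minv A *v axis j 1) = axis j 1" for j
  proof -
    have "minv A *v axis j 1 = (\<chi> k. det (\<chi> i l. if l = k then axis j 1 $ i else A $ i $ l) / det A)"
      by (simp add: vec_eq_iff mult_axis_nth minv_def)
    then show ?thesis
      using cramer[OF assms] by blast
  qed
  then show "A ** minv A = mat 1"
    by (intro matrix_eq_on_axes) (simp flip: matrix_vector_mul_assoc)
  then show "minv A ** A = mat 1"
    using matrix_left_right_inverse by blast
qed

lemma continuous_on_minv [continuous_intros]:
  fixes f :: "'a::topological_space \<Rightarrow> 'n::finite cmat"
  assumes f: "continuous_on S f" and nz: "\<And>x. x \<in> S \<Longrightarrow> det (f x) \<noteq> 0"
  shows "continuous_on S (\<lambda>x. minv (f x))"
  unfolding minv_def
proof (intro continuous_on_vec_lambda continuous_on_divide continuous_on_det f ballI)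
  fix k j i l :: 'n
  show "continuous_on S (\<lambda>x. if l = k then axis j 1 $ i else f x $ i $ l)"
    using f by (cases "l = k") (auto intro!: continuous_intros)
qed (use nz in auto)

definition lower :: "'n::{finite,linorder} cmat \<Rightarrow> bool" where
  "lower A \<longleftrightarrow> (\<forall>i j. i < j \<longrightarrow> A $ i $ j = 0)"

lemma lower_minv:
  assumes "lower A" "\<And>i. A $ i $ i \<noteq> 0"
  shows "lower (minv A)"
  unfolding lower_def
proof (intro allI impI)
  fix i j :: 'a assume "i < j"
  have det: "det A \<noteq> 0"
    by (rule det_lower_nonzero) (use assms in \<open>auto simp: lower_def\<close>)
  have eq: "A *v (minv A *v axis j 1) = axis j 1"
    by (simp add: matrix_vector_mul_assoc minv[OF det])
  have "(minv A *v axis j 1) $ i = 0"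
  proof (rule lower_solve[of A])
    fix a assume "a \<le> i"
    then show "(A *v (minv A *v axis j 1)) $ a = 0"
      unfolding eq using \<open>i < j\<close> by (simp add: axis_def)
  qed (use assms in \<open>auto simp: lower_def\<close>)
  then show "minv A $ i $ j = 0"
    by (simp add: mult_axis_nth)
qed

lemma lower_mult_strictly_lower:
  assumes "lower A" "X \<in> strictly_lower"
  shows "A ** X \<in> strictly_lower" "X ** A \<in> strictly_lower"
proof -
  have "A $ i $ k * X $ k $ j = 0" if "i \<le> j" for i j k
    using assms that by (cases "k \<le> j") (auto simp: lower_def strictly_lower_def)
  moreover have "X $ i $ k * A $ k $ j = 0" if "i \<le> j" for i j k
    using assms that by (cases "i \<le> k") (auto simp: lower_def strictly_lower_def)
  ultimately show "A ** X \<in> strictly_lower" "X ** A \<in> strictly_lower"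
    unfolding strictly_lower_def matrix_matrix_mult_def by (auto intro!: sum.neutral)
qed

lemma lower_unipotent: "X \<in> strictly_lower \<Longrightarrow> lower (mat 1 + X)"
  by (auto simp: lower_def strictly_lower_def mat_def)

lemma lower_two_unipotent: "X \<in> strictly_lower \<Longrightarrow> lower (mat 1 + (mat 1 + X))"
  by (auto simp: lower_def strictly_lower_def mat_def)

lemma diag_strictly_lower: "X \<in> strictly_lower \<Longrightarrow> X $ i $ i = 0"
  by (simp add: strictly_lower_def)

lemma minus_strictly_lower: "X \<in> strictly_lower \<Longrightarrow> - X \<in> strictly_lower"
  and add_strictly_lower: "X \<in> strictly_lower \<Longrightarrow> Y \<in> strictly_lower \<Longrightarrow> X + Y \<in> strictly_lower"
  by (simp_all add: strictly_lower_def)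

lemma det_two_unipotent:
  assumes "X \<in> strictly_lower"
  shows "det (mat 1 + (mat 1 + X)) \<noteq> 0"
  by (rule det_lower_nonzero)
    (use lower_two_unipotent[OF assms] in \<open>auto simp: lower_def mat_def diag_strictly_lower[OF assms]\<close>)

section \<open>Cayley transform of the isotropic flags in a chart\<close>

definition orth_lower :: "'n::{finite,linorder} cmat set" where
  "orth_lower = {X \<in> strictly_lower. transpose (mat 1 + X) ** J ** (mat 1 + X) = J}"

text \<open>The Lie algebra counterpart of the unipotent group that \<open>orth_lower\<close>
  describes: a linear space whose dimension can be counted.\<close>

definition skew_lower :: "'n::{finite,linorder} cmat set" where
  "skew_lower = {Y \<in> strictly_lower. transpose Y ** J + J ** Y = 0}"

text \<open>The Cayley transform \<open>u \<mapsto> (1 - u) (1 + u)\<^sup>-\<^sup>1\<close>, with \<open>u = 1 + X\<close>.\<close>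

definition cayley :: "'n::finite cmat \<Rightarrow> 'n cmat" where
  "cayley X = - X ** minv (mat 1 + (mat 1 + X))"

definition cayley_inv :: "'n::finite cmat \<Rightarrow> 'n cmat" where
  "cayley_inv Y = minv (mat 1 + Y) ** - (Y + Y)"

text \<open>Both transforms solve the one equation \<open>Y (2 + X) = - X\<close>, so they invert
  each other. The matrices to be inverted are lower triangular with diagonal entries 2 and 1, so no
  point has to be excluded.\<close>

lemma cayley_eq_iff:
  fixes X Y :: "'n::{finite,linorder} cmat"
  assumes X: "X \<in> strictly_lower" and Y: "Y \<in> strictly_lower"
  shows "Y = cayley X \<longleftrightarrow> Y ** (mat 1 + (mat 1 + X)) = - X"
    and "X = cayley_inv Y \<longleftrightarrow> Y ** (mat 1 + (mat 1 + X)) = - X"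
proof -
  note iX = minv[OF det_two_unipotent[OF X]] and iY = minv[OF det_unipotent[OF Y]]
  show "Y = cayley X \<longleftrightarrow> Y ** (mat 1 + (mat 1 + X)) = - X"
    unfolding cayley_def by (metis iX matrix_mul_assoc matrix_mul_rid)
  have "X = cayley_inv Y \<longleftrightarrow> (mat 1 + Y) ** X = - (Y + Y)"
    unfolding cayley_inv_def by (metis iY matrix_mul_assoc matrix_mul_lid)
  also have "\<dots> \<longleftrightarrow> Y ** (mat 1 + (mat 1 + X)) = - X"
  proof -
    have "(mat 1 + Y) ** X + (Y + Y) = Y ** (mat 1 + (mat 1 + X)) + X"
      by (simp only: matrix_mult_distribs matrix_mul_lid matrix_mul_rid add_ac)
    then show ?thesis
      by (simp only: eq_neg_iff_add_eq_0)
  qed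
  finally show "X = cayley_inv Y \<longleftrightarrow> Y ** (mat 1 + (mat 1 + X)) = - X" .
qed

lemma cayley_strictly_lower: "X \<in> strictly_lower \<Longrightarrow> cayley X \<in> strictly_lower"
  unfolding cayley_def
  by (intro lower_mult_strictly_lower(2) lower_minv lower_two_unipotent minus_strictly_lower)
    (simp_all add: mat_def diag_strictly_lower)

lemma cayley_inv_strictly_lower: "Y \<in> strictly_lower \<Longrightarrow> cayley_inv Y \<in> strictly_lower"
  unfolding cayley_inv_def
  by (intro lower_mult_strictly_lower(1) lower_minv lower_unipotent minus_strictly_lower add_strictly_lower)
    (simp_all add: mat_def diag_strictly_lower)

lemma transpose_add: "transpose (A + B) = transpose A + transpose B"
  and transpose_minus: "transpose (- A) = - transpose A"
  by (simp_all add: vec_eq_iff transpose_def)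

lemma matrix_mult_minus:
  fixes A B :: "'n::finite cmat"
  shows "(- A) ** B = - (A ** B)" "A ** (- B) = - (A ** B)"
  by (simp_all add: vec_eq_iff matrix_matrix_mult_def sum_negf)

text \<open>With \<open>u = 1 + X\<close>, multiplying the skewness expression by
  \<open>1 + u\<close> on the right and by its transpose on the left gives \<open>-2\<close> times
  the defect \<open>transpose u ** J ** u - J\<close>. As \<open>1 + u\<close> is invertible, both
  vanish together.\<close>

lemma cayley_orth_iff:
  fixes X Y :: "'n::{finite,linorder} cmat"
  assumes X: "X \<in> strictly_lower" and YX: "Y ** (mat 1 + (mat 1 + X)) = - X"
  shows "transpose (mat 1 + X) ** J ** (mat 1 + X) = J \<longleftrightarrow> transpose Y ** J + J ** Y = 0"
proof -
  let ?S = "mat 1 + (mat 1 + X)"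
  have "transpose S ** (transpose Y ** J + J ** Y) ** S = transpose (Y ** S) ** J ** S + transpose S ** J ** (Y ** S)"
    for S :: "'n cmat"
    by (simp only: matrix_mult_distribs(1,2) matrix_transpose_mul matrix_mul_assoc)
  then have "transpose ?S ** (transpose Y ** J + J ** Y) ** ?S = transpose (Y ** ?S) ** J ** ?S + transpose ?S ** J ** (Y ** ?S)" .
  also have "\<dots> = - (transpose X ** J ** ?S + transpose ?S ** J ** X)"
    by (simp only: YX transpose_minus matrix_mult_minus minus_add_distrib)
  also have "transpose X ** J ** ?S + transpose ?S ** J ** X =
      2 *\<^sub>R (transpose (mat 1 + X) ** J ** (mat 1 + X) - J)"
    by (simp only: transpose_add transpose_mat matrix_mult_distribs(1,2) matrix_mul_lid matrix_mul_rid scaleR_2)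
      (simp add: algebra_simps)
  finally have eq: "transpose ?S ** (transpose Y ** J + J ** Y) ** ?S =
      - (2 *\<^sub>R (transpose (mat 1 + X) ** J ** (mat 1 + X) - J))" .
  have "transpose ?S ** A ** ?S = 0 \<longleftrightarrow> A = 0" for A
  proof
    note iS = minv[OF det_two_unipotent[OF X]]
    have iT: "transpose (minv ?S) ** transpose ?S = mat 1"
      using arg_cong[OF iS(1), of transpose] by (simp add: matrix_transpose_mul)
    assume "transpose ?S ** A ** ?S = 0"
    then have "transpose (minv ?S) ** (transpose ?S ** A ** ?S) ** minv ?S = 0"
      by (simp add: vec_eq_iff matrix_matrix_mult_def)
    moreover have "transpose (minv ?S) ** (transpose ?S ** A ** ?S) ** minv ?S =
        (transpose (minv ?S) ** transpose ?S) ** A ** (?S ** minv ?S)"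
      by (simp only: matrix_mul_assoc)
    ultimately show "A = 0"
      by (simp only: iS(1) iT matrix_mul_lid matrix_mul_rid)
  next
    assume "A = 0"
    then show "transpose ?S ** A ** ?S = 0"
      by (simp add: vec_eq_iff matrix_matrix_mult_def)
  qed
  then have "transpose Y ** J + J ** Y = 0 \<longleftrightarrow>
      - (2 *\<^sub>R (transpose (mat 1 + X) ** J ** (mat 1 + X) - J)) = 0"
    unfolding eq[symmetric] by blast
  then show ?thesis
    by simp
qed

lemma homeomorphic_cayley:
  "homeomorphic_maps (top_of_set orth_lower) (top_of_set skew_lower) cayley
    (cayley_inv :: 'n::{finite,linorder} cmat \<Rightarrow> 'n cmat)"
proof -
  have sub: "orth_lower \<subseteq> (strictly_lower :: 'n cmat set)" "skew_lower \<subseteq> (strictly_lower :: 'n cmat set)"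
    by (auto simp: orth_lower_def skew_lower_def)
  have c1: "cayley X \<in> skew_lower \<and> cayley_inv (cayley X) = X" if "X \<in> orth_lower" for X :: "'n cmat"
  proof -
    have X: "X \<in> strictly_lower"
      using that sub by blast
    note Y = cayley_strictly_lower[OF X]
    have YX: "cayley X ** (mat 1 + (mat 1 + X)) = - X"
      using cayley_eq_iff(1)[OF X Y] by blast
    moreover have "X = cayley_inv (cayley X)"
      using cayley_eq_iff(2)[OF X Y] YX by blast
    ultimately show ?thesis
      using that Y cayley_orth_iff[OF X YX] by (simp add: orth_lower_def skew_lower_def)
  qed
  have c2: "cayley_inv Y \<in> orth_lower \<and> cayley (cayley_inv Y) = Y" if "Y \<in> skew_lower" for Y :: "'n cmat"
  proof -
    have Y: "Y \<in> strictly_lower"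
      using that sub by blast
    note X = cayley_inv_strictly_lower[OF Y]
    have YX: "Y ** (mat 1 + (mat 1 + cayley_inv Y)) = - cayley_inv Y"
      using cayley_eq_iff(2)[OF X Y] by blast
    moreover have "Y = cayley (cayley_inv Y)"
      using cayley_eq_iff(1)[OF X Y] YX by blast
    ultimately show ?thesis
      using that X cayley_orth_iff[OF X YX] by (simp add: orth_lower_def skew_lower_def)
  qed
  have "continuous_on (orth_lower :: 'n cmat set) cayley"
    unfolding cayley_def using sub(1) det_two_unipotent by (intro continuous_intros) blast
  moreover have "continuous_on (skew_lower :: 'n cmat set) cayley_inv"
    unfolding cayley_inv_def using sub(2) det_unipotent by (intro continuous_intros) blast
  ultimately show ?thesis
    using c1 c2 unfolding homeomorphic_maps_def by auto
qed

section \<open>Dimension of the base cycle\<close>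

text \<open>Skewness relates the entry at \<open>(i, j)\<close> to the one at
  \<open>(opp j, opp i)\<close>, its mirror image in the antidiagonal. One position is kept from
  each mirror pair below the diagonal; entries on the antidiagonal are their own negatives and
  vanish.\<close>

definition skew_pairs :: "('n::{finite,linorder} \<times> 'n) set" where
  "skew_pairs = {(i, j). j < i \<and> rk i + rk j \<le> CARD('n)}"

definition skew_part :: "'n::{finite,linorder} cmat \<Rightarrow> 'n cmat" where
  "skew_part X = (\<chi> i j. X $ i $ j - X $ opp j $ opp i)"

lemma skew_lower_iff:
  "Y \<in> skew_lower \<longleftrightarrow> Y \<in> strictly_lower \<and> (\<forall>i j. Y $ i $ j = - Y $ opp j $ opp i)"
proof -
  have "transpose Y ** J + J ** Y = 0 \<longleftrightarrow> (\<forall>i j. Y $ opp j $ i + Y $ opp i $ j = 0)"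
    by (simp add: vec_eq_iff mult_J_nth J_mult_nth) (simp add: transpose_def)
  also have "\<dots> \<longleftrightarrow> (\<forall>i j. Y $ i $ j = - Y $ opp j $ opp i)"
    by (metis eq_neg_iff_add_eq_0 opp_opp)
  finally show ?thesis
    by (simp add: skew_lower_def)
qed

lemma skew_pairs_opp: "(i, j) \<in> skew_pairs \<Longrightarrow> (opp j, opp i) \<notin> (skew_pairs :: ('n::{finite,linorder} \<times> 'n) set)"
  using rk_opp_add[of i] rk_opp_add[of j] by (auto simp: skew_pairs_def)

lemma skew_part_image: "skew_part ` coord_space skew_pairs = (skew_lower :: 'n::{finite,linorder} cmat set)"
proof (intro Set.set_eqI iffI)
  fix Y :: "'n cmat" assume "Y \<in> skew_part ` coord_space skew_pairs"
  then obtain X where X: "X \<in> coord_space skew_pairs" "Y = skew_part X"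
    by blast
  have "X $ i $ j = 0" "X $ opp j $ opp i = 0" if "i \<le> j" for i j
    using X(1) that by (auto simp: coord_space_def skew_pairs_def opp_less_iff)
  then show "Y \<in> skew_lower"
    by (simp add: skew_lower_iff X(2) skew_part_def strictly_lower_def)
next
  fix Y :: "'n cmat" assume "Y \<in> skew_lower"
  then have sl: "Y \<in> strictly_lower" and skew: "Y $ i $ j = - Y $ opp j $ opp i" for i j
    unfolding skew_lower_iff by blast+
  define X where "X = (\<chi> i j. if (i, j) \<in> skew_pairs then Y $ i $ j else 0)"
  have "skew_part X = Y"
    unfolding vec_eq_iff
  proof (intro allI)
    fix i j :: 'n
    show "skew_part X $ i $ j = Y $ i $ j"
    proof (cases "j < i")
      case True
      then have lt: "opp i < opp j"
        by (simp add: opp_less_iff)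
      consider "rk i + rk j \<le> CARD('n)" | "rk i + rk j = CARD('n) + 1" | "CARD('n) + 2 \<le> rk i + rk j"
        by linarith
      then show ?thesis
      proof cases
        case 1
        then have "(i, j) \<in> skew_pairs"
          using True by (simp add: skew_pairs_def)
        then show ?thesis
          using skew_pairs_opp[of i j] by (simp add: skew_part_def X_def)
      next
        case 2
        then have "rk i = rk (opp j)"
          using rk_opp_add[of j] by linarith
        then have "i = opp j"
          by simp
        then have "opp i = j"
          by simp
        then have "Y $ i $ j = - Y $ i $ j"
          using skew[of i j] \<open>i = opp j\<close> by simp
        moreover have "(i, j) \<notin> skew_pairs"
          using 2 by (simp add: skew_pairs_def)
        ultimately show ?thesis
          using \<open>i = opp j\<close> \<open>opp i = j\<close> by (simp add: skew_part_def X_def)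
      next
        case 3
        then have "(i, j) \<notin> skew_pairs" "(opp j, opp i) \<in> skew_pairs"
          using lt rk_opp_add[of j] rk_opp_add[of i] by (auto simp: skew_pairs_def)
        then show ?thesis
          using skew[of i j] by (simp add: skew_part_def X_def)
      qed
    next
      case False
      then have "(i, j) \<notin> skew_pairs" "(opp j, opp i) \<notin> skew_pairs"
        by (auto simp: skew_pairs_def opp_less_iff)
      then show ?thesis
        using False sl by (simp add: skew_part_def X_def strictly_lower_def not_less)
    qed
  qed
  moreover have "X \<in> coord_space skew_pairs"
    by (simp add: X_def coord_space_def)
  ultimately show "Y \<in> skew_part ` coord_space skew_pairs"
    by blast
qed

lemma subspace_skew_lower: "subspace (skew_lower :: 'n::{finite,linorder} cmat set)"
  and dim_skew_lower: "dim (skew_lower :: 'n cmat set) = 2 * card (skew_pairs :: ('n \<times> 'n) set)"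
proof -
  have lin: "linear (skew_part :: 'n cmat \<Rightarrow> 'n cmat)"
    by (rule linearI) (simp_all add: vec_eq_iff skew_part_def scaleR_diff_right)
  show "subspace (skew_lower :: 'n cmat set)"
    using linear_subspace_image[OF lin subspace_coord_space[of skew_pairs]] by (simp add: skew_part_image)
  have span: "span (coord_space skew_pairs :: 'n cmat set) = coord_space skew_pairs"
    using subspace_coord_space by (simp add: span_eq_iff)
  have "inj_on skew_part (span (coord_space skew_pairs :: 'n cmat set))"
    unfolding span
  proof (rule inj_onI)
    fix X Y :: "'n cmat"
    assume X: "X \<in> coord_space skew_pairs" and Y: "Y \<in> coord_space skew_pairs" and eq: "skew_part X = skew_part Y"
    show "X = Y"
      unfolding vec_eq_iff
    proof (intro allI)
      fix i j
      show "X $ i $ j = Y $ i $ j"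
      proof (cases "(i, j) \<in> skew_pairs")
        case True
        then have "X $ opp j $ opp i = 0" "Y $ opp j $ opp i = 0"
          using X Y skew_pairs_opp[OF True] by (auto simp: coord_space_def)
        moreover have "skew_part X $ i $ j = skew_part Y $ i $ j"
          using eq by simp
        ultimately show ?thesis
          by (simp add: skew_part_def)
      qed (use X Y in \<open>simp add: coord_space_def\<close>)
    qed
  qed
  then have "dim (skew_part ` coord_space skew_pairs :: 'n cmat set) = dim (coord_space skew_pairs :: 'n cmat set)"
    by (rule dim_image_eq[OF lin])
  then show "dim (skew_lower :: 'n cmat set) = 2 * card (skew_pairs :: ('n \<times> 'n) set)"
    by (simp only: skew_part_image dim_coord_space)
qed

text \<open>Isotropy controls the Gram entries with rank sum at most \<open>n\<close>. For unipotent
  lower \<open>u\<close> the remaining entries of \<open>transpose u ** J ** u\<close> agree with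
  \<open>J\<close> automatically.\<close>

lemma isotropic_chart_iff:
  fixes g :: "'n::{finite,linorder} cmat"
  assumes g: "det g \<noteq> 0" "transpose g ** g = J" and X: "X \<in> strictly_lower"
  shows "isotropic_flag (chart g X) \<longleftrightarrow> X \<in> orth_lower"
proof -
  let ?u = "mat 1 + X"
  have gram: "transpose (g ** ?u) ** (g ** ?u) = transpose ?u ** J ** ?u"
    by (simp only: matrix_transpose_mul matrix_mul_assoc g(2)[symmetric])
  have nth: "(transpose ?u ** J ** ?u) $ a $ b = (\<Sum>i\<in>UNIV. ?u $ i $ a * ?u $ opp i $ b)" for a b
  proof -
    have "(transpose ?u ** J ** ?u) $ a $ b = (transpose ?u ** (J ** ?u)) $ a $ b"
      by (simp only: matrix_mul_assoc)
    then show ?thesis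
      by (simp only: gram_sum J_mult_nth)
  qed
  have high: "(transpose ?u ** J ** ?u) $ a $ b = J $ a $ b" if ab: "CARD('n) + 1 \<le> rk a + rk b" for a b
  proof -
    \<comment> \<open>A nonzero summand needs \<open>a \<le> i\<close> and
      \<open>b \<le> opp i\<close>, whose ranks add up to \<open>n + 1\<close>; so only
      \<open>i = a\<close> with \<open>a = opp b\<close> survives.\<close>
    have "?u $ i $ a * ?u $ opp i $ b = (if i = a then if a = opp b then 1 else 0 else 0)" for i
    proof (cases "a \<le> i \<and> b \<le> opp i")
      case True
      then have "rk a \<le> rk i" "rk b \<le> rk (opp i)"
        by (simp_all only: rk_le_iff)
      then have "rk i = rk a" "rk a = rk (opp b)"
        using ab rk_opp_add[of i] rk_opp_add[of b] by linarith+
      then show ?thesis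
        using diag_strictly_lower[OF X] by (simp add: mat_def)
    next
      case False
      then have "?u $ i $ a = 0 \<or> ?u $ opp i $ b = 0"
        using X by (auto simp: strictly_lower_def mat_def not_le)
      moreover have "\<not> (i = a \<and> a = opp b)"
        using False by auto
      ultimately show ?thesis
        by auto
    qed
    then show ?thesis
      unfolding nth by (simp add: J_def)
  qed
  have "isotropic_flag (chart g X) \<longleftrightarrow>
      (\<forall>a b. rk a + rk b \<le> CARD('n) \<longrightarrow> (transpose ?u ** J ** ?u) $ a $ b = 0)"
    unfolding chart_def using g(1) det_unipotent[OF X]
    by (subst isotropic_flag_of_iff) (simp_all only: det_mul mult_eq_0_iff gram simp_thms)
  also have "\<dots> \<longleftrightarrow> transpose ?u ** J ** ?u = J"
  proof
    assume low: "\<forall>a b. rk a + rk b \<le> CARD('n) \<longrightarrow> (transpose ?u ** J ** ?u) $ a $ b = 0"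
    show "transpose ?u ** J ** ?u = J"
      unfolding vec_eq_iff
    proof (intro allI)
      fix a b :: 'n
      show "(transpose ?u ** J ** ?u) $ a $ b = J $ a $ b"
      proof (cases "rk a + rk b \<le> CARD('n)")
        case True
        then have "a \<noteq> opp b"
          using rk_opp_add[of b] by auto
        then show ?thesis
          using low True by (simp add: J_def)
      qed (use high in simp)
    qed
  next
    assume eq: "transpose ?u ** J ** ?u = J"
    show "\<forall>a b. rk a + rk b \<le> CARD('n) \<longrightarrow> (transpose ?u ** J ** ?u) $ a $ b = 0"
    proof (intro allI impI)
      fix a b :: 'n assume "rk a + rk b \<le> CARD('n)"
      then have "a \<noteq> opp b"
        using rk_opp_add[of b] by auto
      then show "(transpose ?u ** J ** ?u) $ a $ b = 0"
        unfolding eq by (simp add: J_def)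
    qed
  qed
  finally show ?thesis
    using X by (simp add: orth_lower_def)
qed

text \<open>As \<open>D\<close> is open, a chart at a matrix with Gram matrix \<open>J\<close> sees
  the base cycle as a relatively open part of \<open>orth_lower\<close>, and the Cayley transform
  makes it an open part of \<open>skew_lower\<close>.\<close>

lemma flag_dim_base_cycle:
  fixes D :: "'n::{finite,linorder} flag set"
  assumes D: "open_real_orbit D" and ne: "base_cycle D \<noteq> {}"
  shows "flag_dim (base_cycle D) = card (skew_pairs :: ('n \<times> 'n) set)"
proof (rule flag_dim_eqI[OF _ ne])
  have oD: "openin flag_topology D"
    using D by (simp add: open_real_orbit_def)
  then have Df: "D \<subseteq> flags"
    using openin_subset by fastforce
  then show "base_cycle D \<subseteq> flags"
    by (auto simp: base_cycle_def)
  fix U :: "'n flag set" assume "openin flag_topology U" "U \<inter> base_cycle D \<noteq> {}"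
  then obtain V where V: "V \<in> U" "V \<in> D" "isotropic_flag V"
    by (auto simp: base_cycle_def)
  obtain g where g: "det g \<noteq> 0" "V = flag_of g" "transpose g ** g = J"
    using isotropic_adapted[of V] V Df by blast
  let ?A = "{X \<in> strictly_lower. chart g X \<in> base_cycle D}"
  let ?W = "(cayley :: 'n cmat \<Rightarrow> 'n cmat) ` ?A"
  have A: "?A = orth_lower \<inter> {X \<in> topspace (top_of_set strictly_lower). chart g X \<in> D}"
    using isotropic_chart_iff[OF g(1,3)] by (auto simp: base_cycle_def orth_lower_def)
  have "openin (top_of_set strictly_lower) {X \<in> topspace (top_of_set strictly_lower). chart g X \<in> D}"
    using continuous_map_chart[OF g(1)] oD by (rule openin_continuous_map_preimage)
  then obtain T where T: "open T" "{X \<in> topspace (top_of_set strictly_lower). chart g X \<in> D} = strictly_lower \<inter> T"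
    unfolding openin_open by blast
  have "?A = orth_lower \<inter> T"
    unfolding A T(2) by (auto simp: orth_lower_def)
  then have oA: "openin (top_of_set orth_lower) ?A"
    using T(1) by (auto simp: openin_open)
  have hom: "homeomorphic_map (top_of_set orth_lower) (top_of_set skew_lower) (cayley :: 'n cmat \<Rightarrow> 'n cmat)"
    using homeomorphic_cayley homeomorphic_maps_map by blast
  have AO: "?A \<subseteq> orth_lower"
    using A by blast
  have W: "openin (top_of_set skew_lower) ?W"
    using homeomorphic_map_openness[OF hom, of ?A] AO oA by simp
  have WS: "?W \<subseteq> skew_lower"
    using openin_subset[OF W] by simp
  have "homeomorphic_map (subtopology (top_of_set orth_lower) ?A) (subtopology (top_of_set skew_lower) ?W) cayley"
    by (rule homeomorphic_map_subtopologies[OF hom]) (use AO WS in \<open>simp add: inf.absorb2\<close>)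
  then have h: "homeomorphic_map (top_of_set ?A) (top_of_set ?W) cayley"
    unfolding subtopology_subtopology inf.absorb2[OF AO] inf.absorb2[OF WS] .
  have "V \<in> U \<inter> base_cycle D \<inter> chart g ` strictly_lower"
    using V g(2) by (auto simp: base_cycle_def intro: image_eqI[of _ _ 0])
  then have "U \<inter> base_cycle D \<inter> chart g ` strictly_lower \<noteq> {}"
    by blast
  then show "\<exists>g (S :: 'n cmat set) W f. det g \<noteq> 0 \<and> U \<inter> base_cycle D \<inter> chart g ` strictly_lower \<noteq> {} \<and>
      subspace S \<and> dim S = 2 * card (skew_pairs :: ('n \<times> 'n) set) \<and> openin (top_of_set S) W \<and>
      homeomorphic_map (top_of_set {X \<in> strictly_lower. chart g X \<in> base_cycle D}) (top_of_set W) f"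
    using g(1) subspace_skew_lower dim_skew_lower W h
    by (intro exI[of _ g] exI[of _ skew_lower] exI[of _ ?W] exI[of _ cayley] conjI) assumption+
qed

text \<open>From \<open>n\<close> to \<open>n + 2\<close>: the last term vanishes, and after an
  index shift each of the other \<open>n + 1\<close> terms is one more than an old term.\<close>

lemma sum_min_complement:
  fixes n :: nat
  shows "(\<Sum>p = 1..n. min p (n - p)) = (n div 2) * (n - n div 2)"
proof (induction n rule: nat_induct2)
  case (step n)
  have "(\<Sum>p = 1..n + 2. min p (n + 2 - p)) = (\<Sum>p = 1..n + 1. min p (n + 2 - p))"
    by simp
  also have "\<dots> = (\<Sum>p = 0..n. min (Suc p) (n + 2 - Suc p))"
    using sum.shift_bounds_cl_Suc_ivl[of "\<lambda>p. min p (n + 2 - p)" 0 n] by simp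
  also have "\<dots> = (\<Sum>p = 0..n. min p (n - p) + 1)"
    by (rule sum.cong) (auto simp: min_def)
  also have "\<dots> = (\<Sum>p = 1..n. min p (n - p)) + (n + 1)"
    by (simp add: sum.distrib sum_Suc sum.atLeast_Suc_atMost[of 0 n])
  finally have eq: "(\<Sum>p = 1..n + 2. min p (n + 2 - p)) = (n div 2) * (n - n div 2) + (n + 1)"
    by (simp only: step)
  define a b where "a = n div 2" and "b = n - n div 2"
  have "n = a + b" "(n + 2) div 2 = a + 1" "n + 2 - (n + 2) div 2 = b + 1"
    by (auto simp: a_def b_def)
  then show ?case
    unfolding eq a_def[symmetric] b_def[symmetric] by (simp only:) simp
qed auto

text \<open>The surplus is the codimension of the base cycle. Column \<open>p\<close> has
  \<open>min p (n - p)\<close> rows \<open>q > p\<close> with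
  \<open>p + q \<ge> n + 1\<close>.\<close>

lemma card_lower_pairs:
  "card {(i, j). j < (i :: 'n::{finite,linorder})} =
    card (skew_pairs :: ('n \<times> 'n) set) + (CARD('n) div 2) * (CARD('n) - CARD('n) div 2)"
proof -
  let ?n = "CARD('n)"
  let ?H = "{(i :: 'n, j). j < i \<and> ?n + 1 \<le> rk i + rk j}"
  let ?S = "Sigma {1..?n} (\<lambda>p. {max (p + 1) (?n + 1 - p)..?n})"
  have "{(i, j). j < (i :: 'n)} = skew_pairs \<union> ?H" "skew_pairs \<inter> ?H = {}"
    by (auto simp: skew_pairs_def)
  then have "card {(i, j). j < (i :: 'n)} = card (skew_pairs :: ('n \<times> 'n) set) + card ?H"
    by (simp add: card_Un_disjoint)
  moreover have "card ?H = card ?S"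
  proof -
    let ?f = "\<lambda>(i :: 'n, j :: 'n). (rk j, rk i)"
    have "?f ` ?H = ?S"
    proof (intro Set.set_eqI iffI)
      fix z assume "z \<in> ?f ` ?H"
      then obtain i j :: 'n where z: "z = (rk j, rk i)" "j < i" "?n + 1 \<le> rk i + rk j"
        by auto
      have "rk j < rk i"
        using z(2) by (simp only: rk_less_iff)
      then show "z \<in> ?S"
        using z rk_pos[of j] rk_le[of i] rk_le[of j] by auto
    next
      fix z assume "z \<in> ?S"
      then obtain p q where z: "z = (p, q)" "1 \<le> p" "p < q" "?n + 1 \<le> q + p" "q \<le> ?n"
        by auto
      then have pq: "rk (unrk p :: 'n) = p" "rk (unrk q :: 'n) = q"
        by (simp_all add: rk_unrk)
      then have "(unrk p :: 'n) < unrk q"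
        using z(3) by (simp flip: rk_less_iff)
      then have "(unrk q :: 'n, unrk p) \<in> ?H"
        using z(4) by (simp add: pq)
      moreover have "z = ?f (unrk q :: 'n, unrk p)"
        by (simp add: z(1) pq)
      ultimately show "z \<in> ?f ` ?H"
        by (rule rev_image_eqI)
    qed
    moreover have "card (?f ` ?H) = card ?H"
      by (rule card_image) (auto simp: inj_on_def)
    ultimately show ?thesis
      by simp
  qed
  moreover have "card ?S = (\<Sum>p = 1..?n. min p (?n - p))"
  proof -
    have "card ?S = (\<Sum>p = 1..?n. card {max (p + 1) (?n + 1 - p)..?n})"
      by simp
    also have "\<dots> = (\<Sum>p = 1..?n. min p (?n - p))"
      by (rule sum.cong) (auto simp: min_def max_def)
    finally show ?thesis .
  qed
  ultimately show ?thesis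
    by (simp only: sum_min_complement)
qed

theorem theorem8:
  fixes D :: "'n::{finite,linorder} flag set" and w :: "nat \<Rightarrow> nat" and n m :: nat
  assumes "n = CARD('n)" and "n \<ge> 2" and "m = n div 2"
    and "open_real_orbit D"
    and "w permutes {1..n}"
  shows "(schubert_variety w \<in> dual_schubert_varieties (base_cycle D)
            \<longleftrightarrow> double_box_contraction n w)
       \<and> (double_box_contraction n w \<longrightarrow>
            spacing_condition n w
          \<and> (n = 2 * m \<longrightarrow> inversions n w = m\<^sup>2)
          \<and> (n = 2 * m + 1 \<longrightarrow> inversions n w = m\<^sup>2 + m))"
proof (intro conjI impI)
  have w: "w permutes {1..CARD('n)}"
    using assms by simp
  \<comment> \<open>The dimension of the base cycle is computed at one of its points, so the
    equivalence is stated for a nonempty cycle.\<close>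
  have dims: "flag_dim (schubert_variety w :: 'n flag set) + flag_dim (base_cycle D) = flag_dim (flags :: 'n flag set) \<longleftrightarrow>
      inversions n w = m * (n - m)" if "base_cycle D \<noteq> {}"
    using flag_dim_schubert_variety[OF w] flag_dim_base_cycle[OF assms(4) that] flag_dim_flags[where 'n = 'n]
      card_lower_pairs[where 'n = 'n] assms(1,3) by auto
  have dbc: "spacing_condition n w" "inversions n w = m * (n - m)" if "double_box_contraction n w"
    using that double_box_contraction_iff[OF assms(5)] inversions_spaced_eq_iff(2)[OF assms(5)] assms(3) by blast+
  show "spacing_condition n w" if "double_box_contraction n w"
    using dbc(1)[OF that] .
  show "inversions n w = m\<^sup>2" if "double_box_contraction n w" "n = 2 * m"
    using dbc(2)[OF that(1)] that(2) by (simp add: power2_eq_square)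
  show "inversions n w = m\<^sup>2 + m" if "double_box_contraction n w" "n = 2 * m + 1"
    using dbc(2)[OF that(1)] that(2) by (simp add: power2_eq_square)
  show "schubert_variety w \<in> dual_schubert_varieties (base_cycle D) \<longleftrightarrow> double_box_contraction n w"
  proof
    assume "schubert_variety w \<in> dual_schubert_varieties (base_cycle D)"
    \<comment> \<open>Membership provides some permutation with the same variety. Both conditions
      depend on the variety as a set, so they hold for \<open>w\<close>.\<close>
    then have dim: "flag_dim (schubert_variety w :: 'n flag set) + flag_dim (base_cycle D) = flag_dim (flags :: 'n flag set)"
      and ne: "schubert_variety w \<inter> base_cycle D \<noteq> {}"
      unfolding dual_schubert_varieties_def by auto
    obtain V :: "'n flag" where V: "V \<in> schubert_variety w" "isotropic_flag V"
      using ne by (auto simp: base_cycle_def)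
    then have "generic_flag V"
      using schubert_variety_subset_flags by (blast intro: isotropic_imp_generic)
    then have "dominated n w"
      using generic_imp_dominated[OF w V(1)] assms(1) by simp
    moreover have "inversions n w = m * (n - m)"
      using dims dim ne by blast
    ultimately show "double_box_contraction n w"
      using dominated_imp_inversions[OF assms(5)] assms(3) by blast
  next
    assume d: "double_box_contraction n w"
    have "schubert_cell w \<inter> base_cycle D \<noteq> {}"
      using spaced_cell_meets_base_cycle[OF assms(4) _ w] dbc(1)[OF d] assms(1,2) by simp
    then have "schubert_variety w \<inter> base_cycle D \<noteq> {}"
      using schubert_cell_subset_variety[OF w] by blast
    moreover from this have "base_cycle D \<noteq> {}"
      by blast
    then have "flag_dim (schubert_variety w :: 'n flag set) + flag_dim (base_cycle D) = flag_dim (flags :: 'n flag set)"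
      using dims dbc(2)[OF d] by blast
    ultimately show "schubert_variety w \<in> dual_schubert_varieties (base_cycle D)"
      unfolding dual_schubert_varieties_def using w by blast
  qed
qed

end
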